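(* Let $\mathfrak{g}$ be a complex simple Lie algebra of rank $l$ (equivalently, consider any untwisted affine Lie algebra $\widetilde{\mathfrak{g}}$) with set of positive roots $R_+$. Then, as formal power series in $q,y_1,\dots,y_l$, $$\frac{1}{\prod_{\alpha\in R_+}(\alpha;q)_\infty}=\sum_{\substack{r_1^{(1)}\ge\cdots\ge r_1^{(m)}\ge\cdots\ge0\\ \vdots\\ r_l^{(1)}\ge\cdots\ge r_l^{(m)}\ge\cdots\ge0}}\frac{q^{\sum_{i=1}^l\sum_{t\ge1}(r_i^{(t)})^2-\sum_{i=2}^l\sum_{t\ge1}\sum_{p=0}^{\mu_i-1}r_{i'}^{(t)}r_i^{(\mu_it-p)}}}{\prod_{i=1}^l\prod_{j\ge1}(q;q)_{r_i^{(j)}-r_i^{(j+1)}}}\ \prod_{i=1}^ly_i^{n_i},$$ where $n_i=\sum_{t\ge1}r_i^{(t)}$ for $i=1,\dots,l$ and the sum on the right hand side goes over all ($l$-tuples of) descending infinite sequences of nonnegative integers with finite support.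
   Context: The invariant symmetric form $\langle\cdot,\cdot\rangle$ on $\mathfrak{h}^*$ ($\mathfrak{h}$ a Cartan subalgebra of $\mathfrak{g}$) is normalized so that $\langle\alpha,\alpha\rangle=2$ for long roots. The simple roots $\alpha_1,\dots,\alpha_l$ are labelled as follows: - $A_l$: chain $\alpha_1-\alpha_2-\cdots-\alpha_l$; - $B_l$: chain $\alpha_1-\cdots-\alpha_{l-1}\Rightarrow\alpha_l$ ($\alpha_l$ short, the others long); - $C_l$: chain $\alpha_1\Rightarrow\alpha_2-\alpha_3-\cdots-\alpha_l$ ($\alpha_1$ long, the others short); - $D_l$: chain $\alpha_1-\cdots-\alpha_{l-1}$, with $\alpha_l$ attached to $\alpha_{l-2}$; - $E_6,E_7$: chain $\alpha_1-\cdots-\alpha_{l-1}$, with $\alpha_l$ attached to $\alpha_3$; - $E_8$: chain $\alpha_1-\cdots-\alpha_7$, with $\alpha_8$ attached to $\alpha_5$; - $F_4$: chain $\alpha_1-\alpha_2\Rightarrow\alpha_3-\alpha_4$ ($\alpha_1,\alpha_2$ long, $\alpha_3,\alpha_4$ short); - $G_2$: $\alpha_1\Rrightarrow\alpha_2$ ($\alpha_1$ long, $\alpha_2$ short). Notation: $\nu_i=1,2,3$ according to $\langle\alpha_i,\alpha_i\rangle=2,1,\tfrac23$. $i'=l-2$ if $i=l$ and $\mathfrak{g}=D_l$; $i'=3$ if $i=l$ and $\mathfrak{g}=E_6,E_7$; $i'=5$ if $i=l$ and $\mathfrak{g}=E_8$; $i'=i-1$ otherwise. $\mu_i=\nu_i/\nu_{i'}$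 for $i=2,\dots,l$ (always a positive integer). $(a;q)_r=\prod_{s=1}^r(1-aq^{s-1})$ for $r\ge0$ and $(a;q)_\infty=\prod_{s\ge1}(1-aq^{s-1})$. For a positive root $\alpha=a_1\alpha_1+\cdots+a_l\alpha_l\in R_+$, $$(\alpha;q)_\infty=(q\,y_1^{a_1}\cdots y_l^{a_l};q)_\infty.$$ *)

theory Defs
  imports "HOL-Analysis.Analysis" "HOL-Library.Multiset"
begin

section \<open>Multivariate formal power series\<close>

text \<open>
  A monomial in the variables \<open>'v\<close> is a finite multiset of variables, so that the exponent of \<open>v\<close>
  in \<open>m\<close> is \<open>count m v\<close> and the product of monomials is the sum of multisets. A formal power series
  is an arbitrary family of coefficients indexed by monomials.
\<close>

typedef ('v, 'a) mfps = "UNIV :: ('v multiset \<Rightarrow> 'a) set"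
  morphisms mcoeff Abs_mfps by simp

lemma mcoeff_Abs_mfps [simp]: "mcoeff (Abs_mfps f) = f"
  by (simp add: Abs_mfps_inverse)

lemma mfps_eqI: "(\<And>m. mcoeff F m = mcoeff G m) \<Longrightarrow> F = G"
  by (metis ext mcoeff_inject)

lemma finite_submultisets: "finite {A. A \<subseteq># M}"
proof (induction M)
  case empty
  then show ?case by simp
next
  case (add x M)
  have "{A. A \<subseteq># add_mset x M} \<subseteq> {A. A \<subseteq># M} \<union> add_mset x ` {A. A \<subseteq># M}"
  proof
    fix A assume "A \<in> {A. A \<subseteq># add_mset x M}"
    then have A: "A \<subseteq># add_mset x M" by simp
    show "A \<in> {A. A \<subseteq># M} \<union> add_mset x ` {A. A \<subseteq># M}"
    proof (cases "x \<in># A")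
      case True
      then obtain B where "A = add_mset x B" by (metis insert_DiffM)
      then show ?thesis using A by auto
    next
      case False
      then show ?thesis using A
        by (auto simp: subseteq_mset_def not_in_iff split: if_splits)
           (metis count_add_mset le0)
    qed
  qed
  then show ?case using add by (meson finite_UnI finite_imageI finite_subset)
qed

instantiation mfps :: (type, comm_ring_1) comm_ring_1
begin

definition "0 = Abs_mfps (\<lambda>_. 0)"
definition "1 = Abs_mfps (\<lambda>m. if m = {#} then 1 else 0)"
definition "F + G = Abs_mfps (\<lambda>m. mcoeff F m + mcoeff G m)"
definition "- F = Abs_mfps (\<lambda>m. - mcoeff F m)"
definition "F - G = Abs_mfps (\<lambda>m. mcoeff F m - mcoeff G m)"
definition "F * G = Abs_mfps (\<lambda>m. \<Sum>k | k \<subseteq># m. mcoeff F k * mcoeff G (m - k))"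

instance
proof
  fix F G H :: "('a, 'b) mfps"
  show "F + G + H = F + (G + H)" "F + G = G + F" "0 + F = F" "- F + F = 0" "F - G = F + - G"
    by (auto intro!: mfps_eqI
        simp: plus_mfps_def zero_mfps_def uminus_mfps_def minus_mfps_def algebra_simps)
  show "(0 :: ('a, 'b) mfps) \<noteq> 1"
    by (auto simp: zero_mfps_def one_mfps_def Abs_mfps_inject fun_eq_iff)
  show "1 * F = F"
  proof (rule mfps_eqI)
    fix m :: "'a multiset"
    have "mcoeff (1 * F) m = (\<Sum>k | k \<subseteq># m. if k = {#} then mcoeff F m else 0)"
      by (auto simp: times_mfps_def one_mfps_def intro!: sum.cong)
    then show "mcoeff (1 * F) m = mcoeff F m"
      by (simp add: finite_submultisets)
  qed
  show "F * G = G * F"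
  proof (rule mfps_eqI)
    fix m :: "'a multiset"
    show "mcoeff (F * G) m = mcoeff (G * F) m"
      unfolding times_mfps_def mcoeff_Abs_mfps
      by (rule sum.reindex_bij_witness[of _ "\<lambda>k. m - k" "\<lambda>k. m - k"])
         (auto simp: mult.commute subset_mset.diff_diff_right double_diff)
  qed
  show "(F + G) * H = F * H + G * H"
    by (rule mfps_eqI) (simp add: times_mfps_def plus_mfps_def algebra_simps sum.distrib)
  show "F * G * H = F * (G * H)"
  proof (rule mfps_eqI)
    fix m :: "'a multiset"
    have sub1: "j + i \<subseteq># m" if "j \<subseteq># m" "i \<subseteq># m - j" for i j
      using that by (simp add: subset_mset.le_diff_conv2 add.commute)
    have sub2: "j \<subseteq># m" if "k \<subseteq># m" "j \<subseteq># k" for j k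
      using that by (rule subset_mset.order_trans[rotated])
    have sub3: "k - j \<subseteq># m - j" if "k \<subseteq># m" for j k
      using that by (simp add: subseteq_mset_def diff_le_mono)
    have sub4: "m - j - (k - j) = m - k" if "j \<subseteq># k" for j k
      using that by (metis diff_diff_add_mset subset_mset.add_diff_inverse)
    have "mcoeff (F * G * H) m =
        (\<Sum>(k, j) \<in> (SIGMA k:{k. k \<subseteq># m}. {j. j \<subseteq># k}). mcoeff F j * mcoeff G (k - j) * mcoeff H (m - k))"
      by (simp add: times_mfps_def sum_distrib_right sum.Sigma finite_submultisets)
    also have "\<dots> = (\<Sum>(j, i) \<in> (SIGMA j:{j. j \<subseteq># m}. {i. i \<subseteq># m - j}).
        mcoeff F j * (mcoeff G i * mcoeff H (m - j - i)))"
      by (rule sum.reindex_bij_witness[of _ "\<lambda>(j, i). (j + i, j)" "\<lambda>(k, j). (j, k - j)"])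
         (use sub1 sub2 sub3 sub4 in \<open>auto simp: mult.assoc\<close>)
    also have "\<dots> = mcoeff (F * (G * H)) m"
      by (simp add: times_mfps_def sum_distrib_left sum.Sigma finite_submultisets)
    finally show "mcoeff (F * G * H) m = mcoeff (F * (G * H)) m" .
  qed
qed

end

text \<open>Division is meaningful only by units of the power series ring.\<close>

instantiation mfps :: (type, comm_ring_1) inverse
begin

definition "inverse F = (if \<exists>G. F * G = 1 then THE G. F * G = 1 else 0 :: ('a, 'b) mfps)"
definition "F div G = F * inverse (G :: ('a, 'b) mfps)"

instance ..

end

text \<open>
  The usual topology of a formal power series ring: the product of the discrete topologies on the
  coefficients. It gives the meaning of infinite sums and products.
\<close>

instantiation mfps :: (type, type) t2_space
begin

definition "open U \<longleftrightarrow>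
  (\<forall>F\<in>U. \<exists>M. finite M \<and> (\<forall>G::('a, 'b) mfps. (\<forall>m\<in>M. mcoeff G m = mcoeff F m) \<longrightarrow> G \<in> U))"

instance
proof
  show "open (UNIV :: ('a, 'b) mfps set)"
    by (auto simp: open_mfps_def)
next
  fix S T :: "('a, 'b) mfps set"
  assume ST: "open S" "open T"
  show "open (S \<inter> T)"
    unfolding open_mfps_def
  proof
    fix F assume "F \<in> S \<inter> T"
    with ST obtain M N where
      "finite M" "\<And>G. (\<forall>m\<in>M. mcoeff G m = mcoeff F m) \<Longrightarrow> G \<in> S"
      "finite N" "\<And>G. (\<forall>m\<in>N. mcoeff G m = mcoeff F m) \<Longrightarrow> G \<in> T"
      unfolding open_mfps_def by (metis IntE)
    then show "\<exists>M. finite M \<and> (\<forall>G. (\<forall>m\<in>M. mcoeff G m = mcoeff F m) \<longrightarrow> G \<in> S \<inter> T)"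
      by (intro exI[of _ "M \<union> N"]) auto
  qed
next
  fix K :: "('a, 'b) mfps set set"
  assume "\<forall>S\<in>K. open S"
  then show "open (\<Union>K)"
    unfolding open_mfps_def by (metis Union_iff)
next
  fix F G :: "('a, 'b) mfps"
  assume "F \<noteq> G"
  then obtain m where m: "mcoeff F m \<noteq> mcoeff G m"
    using mfps_eqI by blast
  define nb where "nb X = {Y :: ('a, 'b) mfps. mcoeff Y m = mcoeff X m}" for X
  have "open (nb X)" for X
    unfolding open_mfps_def nb_def by (intro ballI exI[of _ "{m}"]) auto
  then show "\<exists>U V. open U \<and> open V \<and> F \<in> U \<and> G \<in> V \<and> U \<inter> V = {}"
    using m by (intro exI[of _ "nb F"] exI[of _ "nb G"]) (auto simp: nb_def)
qed

end

definition mvar :: "'v \<Rightarrow> ('v, 'a::comm_ring_1) mfps" where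
  "mvar v = Abs_mfps (\<lambda>m. if m = {#v#} then 1 else 0)"

datatype variable = Q | Y nat

abbreviation q :: "(variable, rat) mfps" where "q \<equiv> mvar Q"
abbreviation y :: "nat \<Rightarrow> (variable, rat) mfps" where "y i \<equiv> mvar (Y i)"

definition qpoch :: "(variable, rat) mfps \<Rightarrow> nat \<Rightarrow> (variable, rat) mfps" where
  "qpoch a r = (\<Prod>s=1..r. 1 - a * q ^ (s - 1))"

definition qpoch_inf :: "(variable, rat) mfps \<Rightarrow> (variable, rat) mfps" where
  "qpoch_inf a = (\<Prod>s. 1 - a * q ^ s)"


section \<open>Simple Lie algebras\<close>

text \<open>Finite-dimensional complex Lie algebras; the underlying space is a whole type.\<close>

locale lie_algebra = vector_space scale
  for scale :: "complex \<Rightarrow> 'a::ab_group_add \<Rightarrow> 'a" +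
  fixes bracket :: "'a \<Rightarrow> 'a \<Rightarrow> 'a"
  assumes bracket_linear_left: "Vector_Spaces.linear scale scale (\<lambda>x. bracket x z)"
    and bracket_linear_right: "Vector_Spaces.linear scale scale (bracket x)"
    and bracket_alternating: "bracket x x = 0"
    and jacobi: "bracket x (bracket z w) + bracket z (bracket w x) + bracket w (bracket x z) = 0"
    and finite_dimensional: "\<exists>B. finite B \<and> span B = UNIV"
begin

definition ideal :: "'a set \<Rightarrow> bool" where
  "ideal I \<longleftrightarrow> subspace I \<and> (\<forall>x. \<forall>z\<in>I. bracket x z \<in> I)"

definition simple :: bool where
  "simple \<longleftrightarrow> (\<exists>x z. bracket x z \<noteq> 0) \<and> (\<forall>I. ideal I \<longrightarrow> I = {0} \<or> I = UNIV)"

definition diagonalizable :: "('a \<Rightarrow> 'a) \<Rightarrow> bool" where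
  "diagonalizable f \<longleftrightarrow> span {x. \<exists>c. f x = scale c x} = UNIV"

text \<open>
  Cartan subalgebras of a semisimple Lie algebra: maximal commutative subalgebras whose elements
  act diagonalizably in the adjoint representation.
\<close>

definition cartan_subalgebra :: "'a set \<Rightarrow> bool" where
  "cartan_subalgebra H \<longleftrightarrow> subspace H \<and>
     (\<forall>x\<in>H. \<forall>z\<in>H. bracket x z = 0) \<and>
     (\<forall>x. (\<forall>h\<in>H. bracket h x = 0) \<longrightarrow> x \<in> H) \<and>
     (\<forall>h\<in>H. diagonalizable (bracket h))"

text \<open>
  A linear functional on a subspace \<open>H\<close> is represented by its extension by \<open>0\<close> outside \<open>H\<close>, so
  that equality of functionals is equality of functions.
\<close>

definition dual :: "'a set \<Rightarrow> ('a \<Rightarrow> complex) set" where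
  "dual H = {f. (\<forall>x\<in>H. \<forall>z\<in>H. f (x + z) = f x + f z) \<and> (\<forall>c. \<forall>x\<in>H. f (scale c x) = c * f x) \<and>
     (\<forall>x. x \<notin> H \<longrightarrow> f x = 0)}"

definition root_space :: "'a set \<Rightarrow> ('a \<Rightarrow> complex) \<Rightarrow> 'a set" where
  "root_space H f = {x. \<forall>h\<in>H. bracket h x = scale (f h) x}"

definition roots :: "'a set \<Rightarrow> ('a \<Rightarrow> complex) set" where
  "roots H = {f \<in> dual H. f \<noteq> (\<lambda>_. 0) \<and> root_space H f \<noteq> {0}}"

definition invariant_form :: "('a \<Rightarrow> 'a \<Rightarrow> complex) \<Rightarrow> bool" where
  "invariant_form B \<longleftrightarrow>
     (\<forall>z. Vector_Spaces.linear scale (*) (\<lambda>x. B x z)) \<and>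
     (\<forall>x z. B x z = B z x) \<and>
     (\<forall>x z w. B (bracket x z) w = B x (bracket z w)) \<and>
     (\<forall>x. (\<forall>z. B x z = 0) \<longrightarrow> x = 0)"

end

text \<open>
  The form induced on the dual of \<open>H\<close> through the identification of \<open>H\<close> with its dual given by the
  restriction of \<open>B\<close> to \<open>H\<close> (which is nondegenerate when \<open>B\<close> is invariant and nondegenerate and
  \<open>H\<close> is a Cartan subalgebra).
\<close>

definition representing_vector :: "('a \<Rightarrow> 'a \<Rightarrow> complex) \<Rightarrow> 'a set \<Rightarrow> ('a \<Rightarrow> complex) \<Rightarrow> 'a" where
  "representing_vector B H f = (THE t. t \<in> H \<and> (\<forall>x\<in>H. B t x = f x))"

definition dual_form ::
  "('a \<Rightarrow> 'a \<Rightarrow> complex) \<Rightarrow> 'a set \<Rightarrow> ('a \<Rightarrow> complex) \<Rightarrow> ('a \<Rightarrow> complex) \<Rightarrow> complex" where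
  "dual_form B H f g = B (representing_vector B H f) (representing_vector B H g)"

text \<open>The maximal square length of a root is 2, i.e. \<open>\<langle>\<alpha>,\<alpha>\<rangle> = 2\<close> for long roots.\<close>

definition normalized_on ::
  "('a \<Rightarrow> 'a \<Rightarrow> complex) \<Rightarrow> 'a set \<Rightarrow> ('a \<Rightarrow> complex) set \<Rightarrow> bool" where
  "normalized_on B H R \<longleftrightarrow> (\<exists>\<beta>\<in>R. dual_form B H \<beta> \<beta> = 2) \<and>
     (\<forall>\<beta>\<in>R. \<exists>c::real. c \<le> 2 \<and> dual_form B H \<beta> \<beta> = of_real c)"

definition root_comb :: "nat \<Rightarrow> (nat \<Rightarrow> 'a \<Rightarrow> complex) \<Rightarrow> (nat \<Rightarrow> nat) \<Rightarrow> 'a \<Rightarrow> complex" where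
  "root_comb l \<alpha> a = (\<lambda>x. \<Sum>i=1..l. of_nat (a i) * \<alpha> i x)"

text \<open>Together with \<open>l = dim H\<close>, linear independence makes \<open>\<alpha> 1, \<dots>, \<alpha> l\<close> a basis of the dual of \<open>H\<close>.\<close>

definition simple_roots ::
  "nat \<Rightarrow> (nat \<Rightarrow> 'a \<Rightarrow> complex) \<Rightarrow> ('a \<Rightarrow> complex) set \<Rightarrow> bool" where
  "simple_roots l \<alpha> R \<longleftrightarrow> (\<forall>i\<in>{1..l}. \<alpha> i \<in> R) \<and>
     (\<forall>c::nat \<Rightarrow> complex. (\<forall>x. (\<Sum>i=1..l. c i * \<alpha> i x) = 0) \<longrightarrow> (\<forall>i\<in>{1..l}. c i = 0)) \<and>
     (\<forall>\<beta>\<in>R. \<exists>a. \<beta> = root_comb l \<alpha> a \<or> \<beta> = (\<lambda>x. - root_comb l \<alpha> a x))"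

definition positive_roots ::
  "nat \<Rightarrow> (nat \<Rightarrow> 'a \<Rightarrow> complex) \<Rightarrow> ('a \<Rightarrow> complex) set \<Rightarrow> ('a \<Rightarrow> complex) set" where
  "positive_roots l \<alpha> R = {\<beta> \<in> R. \<exists>a. \<beta> = root_comb l \<alpha> a}"

definition root_coeff :: "nat \<Rightarrow> (nat \<Rightarrow> 'a \<Rightarrow> complex) \<Rightarrow> ('a \<Rightarrow> complex) \<Rightarrow> nat \<Rightarrow> nat" where
  "root_coeff l \<alpha> \<beta> = (THE a. (\<forall>i. i \<notin> {1..l} \<longrightarrow> a i = 0) \<and> \<beta> = root_comb l \<alpha> a)"

definition root_qpoch_inf ::
  "nat \<Rightarrow> (nat \<Rightarrow> 'a \<Rightarrow> complex) \<Rightarrow> ('a \<Rightarrow> complex) \<Rightarrow> (variable, rat) mfps" where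
  "root_qpoch_inf l \<alpha> \<beta> = qpoch_inf (q * (\<Prod>i=1..l. y i ^ root_coeff l \<alpha> \<beta> i))"


section \<open>Labelled Dynkin diagrams\<close>

datatype dynkin_family = Type_A | Type_B | Type_C | Type_D | Type_E | Type_F | Type_G

fun valid_rank :: "dynkin_family \<Rightarrow> nat \<Rightarrow> bool" where
  "valid_rank Type_A l \<longleftrightarrow> 1 \<le> l"
| "valid_rank Type_B l \<longleftrightarrow> 2 \<le> l"
| "valid_rank Type_C l \<longleftrightarrow> 2 \<le> l"
| "valid_rank Type_D l \<longleftrightarrow> 4 \<le> l"
| "valid_rank Type_E l \<longleftrightarrow> l \<in> {6, 7, 8}"
| "valid_rank Type_F l \<longleftrightarrow> l = 4"
| "valid_rank Type_G l \<longleftrightarrow> l = 2"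

text \<open>
  \<open>attach X l i\<close> is the index \<open>i'\<close>. The vertex \<open>i \<ge> 2\<close> is attached to \<open>i'\<close>, and these are all the
  edges of the diagram.
\<close>

definition attach :: "dynkin_family \<Rightarrow> nat \<Rightarrow> nat \<Rightarrow> nat" where
  "attach X l i =
     (if i = l \<and> X = Type_D then l - 2
      else if i = l \<and> X = Type_E then (if l = 8 then 5 else 3)
      else i - 1)"

text \<open>Number of lines in the edge joining \<open>i\<close> and \<open>i'\<close>.\<close>

definition edge_lines :: "dynkin_family \<Rightarrow> nat \<Rightarrow> nat \<Rightarrow> nat" where
  "edge_lines X l i =
     (if X = Type_B \<and> i = l \<or> X = Type_C \<and> i = 2 \<or> X = Type_F \<and> i = 3 then 2
      else if X = Type_G then 3 else 1)"

definition dynkin_lines :: "dynkin_family \<Rightarrow> nat \<Rightarrow> nat \<Rightarrow> nat \<Rightarrow> nat" where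
  "dynkin_lines X l i j =
     (if 2 \<le> i \<and> j = attach X l i then edge_lines X l i
      else if 2 \<le> j \<and> i = attach X l j then edge_lines X l j else 0)"

fun long_nodes :: "dynkin_family \<Rightarrow> nat \<Rightarrow> nat set" where
  "long_nodes Type_B l = {1..<l}"
| "long_nodes Type_C l = {1}"
| "long_nodes Type_F l = {1, 2}"
| "long_nodes Type_G l = {1}"
| "long_nodes _ l = {1..l}"

text \<open>
  Vertices \<open>i\<close> and \<open>j\<close> are joined by \<open>a\<^sub>i\<^sub>j a\<^sub>j\<^sub>i\<close> lines, where
  \<open>a\<^sub>i\<^sub>j = 2\<langle>\<alpha>\<^sub>i,\<alpha>\<^sub>j\<rangle> / \<langle>\<alpha>\<^sub>j,\<alpha>\<^sub>j\<rangle>\<close>; the arrows are encoded by recording which simple roots are long.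
\<close>

definition has_diagram ::
  "('a \<Rightarrow> 'a \<Rightarrow> complex) \<Rightarrow> 'a set \<Rightarrow> dynkin_family \<Rightarrow> nat \<Rightarrow> (nat \<Rightarrow> 'a \<Rightarrow> complex) \<Rightarrow> bool" where
  "has_diagram B H X l \<alpha> \<longleftrightarrow> valid_rank X l \<and>
     (\<forall>i\<in>{1..l}. \<forall>j\<in>{1..l}. i \<noteq> j \<longrightarrow>
        (2 * dual_form B H (\<alpha> i) (\<alpha> j) / dual_form B H (\<alpha> j) (\<alpha> j)) *
        (2 * dual_form B H (\<alpha> j) (\<alpha> i) / dual_form B H (\<alpha> i) (\<alpha> i)) = of_nat (dynkin_lines X l i j)) \<and>
     (\<forall>i\<in>{1..l}. dual_form B H (\<alpha> i) (\<alpha> i) = 2 \<longleftrightarrow> i \<in> long_nodes X l)"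

definition nu :: "('a \<Rightarrow> 'a \<Rightarrow> complex) \<Rightarrow> 'a set \<Rightarrow> (nat \<Rightarrow> 'a \<Rightarrow> complex) \<Rightarrow> nat \<Rightarrow> nat" where
  "nu B H \<alpha> i =
     (if dual_form B H (\<alpha> i) (\<alpha> i) = 2 then 1
      else if dual_form B H (\<alpha> i) (\<alpha> i) = 1 then 2 else 3)"

definition mu ::
  "('a \<Rightarrow> 'a \<Rightarrow> complex) \<Rightarrow> 'a set \<Rightarrow> dynkin_family \<Rightarrow> nat \<Rightarrow> (nat \<Rightarrow> 'a \<Rightarrow> complex) \<Rightarrow> nat \<Rightarrow> nat" where
  "mu B H X l \<alpha> i = nu B H \<alpha> i div nu B H \<alpha> (attach X l i)"


section \<open>The sum side\<close>

text \<open>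
  \<open>r i t\<close> stands for $r_i^{(t)}$ with \<open>1 \<le> i \<le> l\<close> and \<open>1 \<le> t\<close>; all other values are required to be
  \<open>0\<close>, so that every tuple of sequences is represented once.
\<close>

definition descending_tuples :: "nat \<Rightarrow> (nat \<Rightarrow> nat \<Rightarrow> nat) set" where
  "descending_tuples l = {r.
     (\<forall>i t. i \<notin> {1..l} \<or> t = 0 \<longrightarrow> r i t = 0) \<and>
     (\<forall>i\<in>{1..l}. \<forall>t\<ge>1. r i (t + 1) \<le> r i t) \<and>
     (\<forall>i\<in>{1..l}. finite {t. r i t \<noteq> 0})}"

definition seq_supp :: "(nat \<Rightarrow> nat) \<Rightarrow> nat set" where
  "seq_supp s = {t. 1 \<le> t \<and> s t \<noteq> 0}"

definition weight :: "(nat \<Rightarrow> nat \<Rightarrow> nat) \<Rightarrow> nat \<Rightarrow> nat" where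
  "weight r i = (\<Sum>t\<in>seq_supp (r i). r i t)"

text \<open>The exponent of \<open>q\<close>, for given \<open>i \<mapsto> i'\<close> and \<open>i \<mapsto> \<mu>\<^sub>i\<close>. All sums over \<open>t \<ge> 1\<close> are
  restricted to finite sets outside of which the summands vanish.\<close>

definition q_exponent ::
  "nat \<Rightarrow> (nat \<Rightarrow> nat) \<Rightarrow> (nat \<Rightarrow> nat) \<Rightarrow> (nat \<Rightarrow> nat \<Rightarrow> nat) \<Rightarrow> int" where
  "q_exponent l pr m r =
     (\<Sum>i=1..l. \<Sum>t\<in>seq_supp (r i). (int (r i t))\<^sup>2)
     - (\<Sum>i=2..l. \<Sum>t\<in>seq_supp (r (pr i)). \<Sum>p<m i. int (r (pr i) t) * int (r i (m i * t - p)))"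

definition q_denominator :: "nat \<Rightarrow> (nat \<Rightarrow> nat \<Rightarrow> nat) \<Rightarrow> (variable, rat) mfps" where
  "q_denominator l r = (\<Prod>i=1..l. \<Prod>j\<in>seq_supp (r i). qpoch q (r i j - r i (j + 1)))"

text \<open>For the diagrams above \<open>q_exponent\<close> is nonnegative, being a value of half a positive definite
  integral quadratic form, so the conversion \<open>nat\<close> does not truncate.\<close>

definition summand ::
  "nat \<Rightarrow> (nat \<Rightarrow> nat) \<Rightarrow> (nat \<Rightarrow> nat) \<Rightarrow> (nat \<Rightarrow> nat \<Rightarrow> nat) \<Rightarrow> (variable, rat) mfps" where
  "summand l pr m r =
     q ^ nat (q_exponent l pr m r) / q_denominator l r * (\<Prod>i=1..l. y i ^ weight r i)"

end

theory Submission
  imports Defs "HOL-Computational_Algebra.Formal_Laurent_Series"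
begin

text \<open>
  Let \<open>F\<close> be the sum side, a power series in the \<open>y\<^sub>i\<close> over the Laurent series in \<open>q\<close>, and let \<open>s\<^sub>i\<close>
  act on exponents of monomials as simple reflections. Fix all sequences but \<open>r\<^sub>i\<close>. The exponent is then
  \<open>\<Sum>\<^sub>t (r\<^sub>i\<^sup>(\<^sup>t\<^sup>))\<^sup>2 - c\<^sub>t r\<^sub>i\<^sup>(\<^sup>t\<^sup>)\<close> for a partition \<open>c\<close> built from the neighbours of \<open>i\<close>, and the sum over \<open>r\<^sub>i\<close> is
  \<open>1 / (q y\<^sub>i; q)\<^sub>\<infinity>\<close> times a palindromic polynomial in \<open>y\<^sub>i\<close> of degree \<open>|c|\<close>. Since \<open>|c|\<close> is the number that
  occurs in \<open>s\<^sub>i\<close>, the series \<open>F (q y\<^sub>i; q)\<^sub>\<infinity>\<close> is invariant under \<open>s\<^sub>i\<close>. As \<open>s\<^sub>i\<close> permutes the positive roots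
  other than \<open>\<alpha>\<^sub>i\<close>, the product \<open>G\<close> of \<open>F\<close> with all \<open>(\<alpha>; q)\<^sub>\<infinity>\<close> is invariant under every \<open>s\<^sub>i\<close>. Its exponents
  are nonnegative combinations of simple roots, and any such nonzero combination can be lowered by some
  \<open>s\<^sub>i\<close> because the root system carries an invariant positive definite form; hence \<open>G = 1\<close>.

  The exponents of \<open>q\<close> in \<open>F\<close> could a priori be negative; they are not, because the terms of lowest order
  of the summands with given weights cannot cancel, while the product side has no negative powers.
\<close>

section \<open>Palindromic factors of one-vertex sums\<close>

text \<open>The symmetry of the polynomial rests on 1 - (1 + y) u^a + y u^(2a) = (1 - u^a)(1 - u^a
  y): the sums for \<open>c\<close> and for \<open>c\<close> with its last nonzero entry lowered by
  1 and by 2 combine to the sum for \<open>c\<close> with 2 taken from each nonzero entry, and the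
  coefficients 1 + y, y, y^k are symmetric about the right centres. A last entry 1 would leave the
  partitions under this recursion and needs a second one.

  That |c| is the number in the reflection comes from the shape of the exponent: along an edge of
  multiplicity m, row t of \<open>i'\<close> meets the m rows m t - p of \<open>i\<close>. So
  \<open>i'\<close> sees the rows of \<open>i\<close> in blocks, of total n_i, while
  \<open>i\<close> sees each row of \<open>i'\<close> m times, of total m n_(i'); the two Cartan
  integers of the edge are -1 and -m.

  Up to the product formula q is an element \<open>u\<close> of a field, nonzero and not a root of
  unity, so that negative exponents make sense before they are excluded. There 1 / (q y; q)_infinity
  is Euler's series \<open>inverse_poch_fps\<close>; it is matched with the infinite product only
  afterwards, in \<open>qpoch_inf_monom\<close>.\<close>

lemma fps_nth_X_power_mult: "fps_nth (fps_X ^ k * f) n = (if n < k then 0 else fps_nth (f :: 'a::comm_ring_1 fps) (n - k))"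
  by (rule fps_X_power_mult_nth)

text \<open>This is the sum of \<open>fps_X ^ a * g a\<close> over all \<open>a\<close>. Written by
  coefficients it needs no convergence argument, as only \<open>a \<le> n\<close> reach the
  coefficient at \<open>n\<close>.\<close>

definition shift_sum :: "(nat \<Rightarrow> 'a::comm_ring_1 fps) \<Rightarrow> 'a fps" where
  "shift_sum g = Abs_fps (\<lambda>n. \<Sum>a\<le>n. fps_nth (g a) (n - a))"

lemma shift_sum_nth: "fps_nth (shift_sum g) n = (\<Sum>a\<le>n. fps_nth (g a) (n - a))"
  by (simp add: shift_sum_def)

lemma shift_sum_add: "shift_sum (\<lambda>a. g a + h a) = shift_sum g + shift_sum h"
  by (rule fps_ext) (simp add: shift_sum_nth sum.distrib)

lemma shift_sum_diff: "shift_sum (\<lambda>a. g a - h a) = shift_sum g - shift_sum h"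
  by (rule fps_ext) (simp add: shift_sum_nth sum_subtractf)

lemma shift_sum_mult: "shift_sum (\<lambda>a. f * h a) = f * shift_sum h"
proof (rule fps_ext)
  fix m
  have "fps_nth (shift_sum (\<lambda>s. f * h s)) m = (\<Sum>a\<le>m. fps_nth (fps_X ^ a * (f * h a)) m)"
    unfolding shift_sum_nth by (intro sum.cong refl) (simp add: fps_nth_X_power_mult)
  also have "\<dots> = fps_nth (f * (\<Sum>a\<le>m. fps_X ^ a * h a)) m"
    by (simp add: sum_distrib_left mult_ac fps_sum_nth)
  also have "\<dots> = (\<Sum>i\<le>m. fps_nth f i * fps_nth (\<Sum>a\<le>m. fps_X ^ a * h a) (m - i))"
    by (simp add: fps_mult_nth atMost_atLeast0)
  also have "\<dots> = (\<Sum>i\<le>m. fps_nth f i * fps_nth (shift_sum h) (m - i))"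
  proof (intro sum.cong refl)
    fix i assume "i \<in> {..m}"
    have "(\<Sum>a\<le>m. if m - i < a then 0 else fps_nth (h a) (m - i - a)) = (\<Sum>a\<le>m - i. fps_nth (h a) (m - i - a))"
      by (rule sum.mono_neutral_cong_right) auto
    then show "fps_nth f i * fps_nth (\<Sum>a\<le>m. fps_X ^ a * h a) (m - i) = fps_nth f i * fps_nth (shift_sum h) (m - i)"
      by (simp add: fps_sum_nth fps_nth_X_power_mult shift_sum_nth)
  qed
  finally show "fps_nth (shift_sum (\<lambda>s. f * h s)) m = fps_nth (f * shift_sum h) m"
    by (simp add: fps_mult_nth atMost_atLeast0)
qed

lemma shift_sum_Suc: "shift_sum (\<lambda>a. case a of 0 \<Rightarrow> 0 | Suc b \<Rightarrow> g b) = fps_X * shift_sum g"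
proof (rule fps_ext)
  fix n
  show "fps_nth (shift_sum (\<lambda>a. case a of 0 \<Rightarrow> 0 | Suc b \<Rightarrow> g b)) n = fps_nth (fps_X * shift_sum g) n"
    by (cases n) (simp_all add: shift_sum_nth sum.atMost_Suc_shift del: sum.atMost_Suc)
qed

text \<open>The part subtracted at index \<open>a\<close> is
  \<open>fps_X ^ Suc a * g (Suc a)\<close>, which cancels the first part at index
  \<open>Suc a\<close>.\<close>

lemma shift_sum_telescope: "shift_sum (\<lambda>a. g a - fps_X * g (Suc a)) = g 0"
proof -
  have "fps_X * shift_sum (\<lambda>a. g (Suc a)) = shift_sum (\<lambda>a. case a of 0 \<Rightarrow> 0 | Suc b \<Rightarrow> g (Suc b))"
    by (simp add: shift_sum_Suc)
  then have "shift_sum (\<lambda>a. g a - fps_X * g (Suc a)) =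
      shift_sum (\<lambda>a. g a - (case a of 0 \<Rightarrow> 0 | Suc b \<Rightarrow> g (Suc b)))"
    by (simp add: shift_sum_diff shift_sum_mult)
  also have "\<dots> = g 0"
  proof (rule fps_ext)
    fix n
    have "fps_nth (shift_sum (\<lambda>a. g a - (case a of 0 \<Rightarrow> 0 | Suc b \<Rightarrow> g (Suc b)))) n =
        (\<Sum>a\<le>n. if a = 0 then fps_nth (g 0) n else 0)"
      unfolding shift_sum_nth by (intro sum.cong refl) (auto split: nat.splits)
    then show "fps_nth (shift_sum (\<lambda>a. g a - (case a of 0 \<Rightarrow> 0 | Suc b \<Rightarrow> g (Suc b)))) n = fps_nth (g 0) n"
      by simp
  qed
  finally show ?thesis .
qed

lemma shift_sum_finite:
  assumes "\<And>a. a > b \<Longrightarrow> g a = 0"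
  shows "shift_sum g = (\<Sum>a\<le>b. fps_X ^ a * g a)"
proof (rule fps_ext)
  fix n
  have "fps_nth (\<Sum>a\<le>b. fps_X ^ a * g a) n = (\<Sum>a\<le>b. if n < a then 0 else fps_nth (g a) (n - a))"
    by (simp add: fps_sum_nth fps_nth_X_power_mult)
  also have "\<dots> = (\<Sum>a\<in>{..b} \<inter> {..n}. fps_nth (g a) (n - a))"
    by (rule sum.mono_neutral_cong_right) auto
  also have "\<dots> = (\<Sum>a\<le>n. fps_nth (g a) (n - a))"
    by (intro sum.mono_neutral_left) (use assms in \<open>force+\<close>)
  finally show "fps_nth (shift_sum g) n = fps_nth (\<Sum>a\<le>b. fps_X ^ a * g a) n"
    by (simp add: shift_sum_nth)
qed

text \<open>The substitution of \<open>k * fps_X\<close> for \<open>fps_X\<close>; with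
  \<open>k = u\<close> it is the q-shift in y_i.\<close>

definition fps_scale :: "'a::comm_ring_1 \<Rightarrow> 'a fps \<Rightarrow> 'a fps" where
  "fps_scale k f = Abs_fps (\<lambda>n. k ^ n * fps_nth f n)"

lemma fps_scale_nth [simp]: "fps_nth (fps_scale k f) n = k ^ n * fps_nth f n"
  by (simp add: fps_scale_def)

lemma fps_scale_mult: "fps_scale k (f * g) = fps_scale k f * fps_scale k g"
proof (rule fps_ext)
  fix n
  have "k ^ n * (fps_nth f i * fps_nth g (n - i)) = (k ^ i * fps_nth f i) * (k ^ (n - i) * fps_nth g (n - i))"
    if "i \<le> n" for i
  proof -
    have "k ^ n = k ^ i * k ^ (n - i)" using that by (simp flip: power_add)
    then show ?thesis by (simp add: algebra_simps)
  qed
  then show "fps_nth (fps_scale k (f * g)) n = fps_nth (fps_scale k f * fps_scale k g) n"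
    by (auto simp: fps_mult_nth sum_distrib_left intro!: sum.cong)
qed

lemma fps_scale_1 [simp]: "fps_scale k 1 = 1"
  by (rule fps_ext) simp
lemma fps_scale_add: "fps_scale k (f + g) = fps_scale k f + fps_scale k g"
  by (rule fps_ext) (simp add: algebra_simps)
lemma fps_scale_diff: "fps_scale k (f - g) = fps_scale k f - fps_scale k g"
  by (rule fps_ext) (simp add: algebra_simps)
lemma fps_scale_const [simp]: "fps_scale k (fps_const b) = fps_const b"
  by (rule fps_ext) simp
lemma fps_scale_X [simp]: "fps_scale k fps_X = fps_const k * fps_X"
  by (rule fps_ext) (simp add: fps_X_def)
lemma fps_scale_prod: "fps_scale k (\<Prod>i\<in>A. f i) = (\<Prod>i\<in>A. fps_scale k (f i))"
  by (induction A rule: infinite_finite_induct) (simp_all add: fps_scale_mult)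

lemma fps_scale_inverse:
  fixes f :: "'a::field fps"
  assumes "fps_nth f 0 \<noteq> 0"
  shows "fps_scale k (inverse f) = inverse (fps_scale k f)"
proof -
  have "fps_scale k f * fps_scale k (inverse f) = fps_scale k (f * inverse f)"
    by (simp add: fps_scale_mult)
  also have "\<dots> = 1" using assms by (simp add: inverse_mult_eq_1')
  finally have "fps_scale k f * fps_scale k (inverse f) = 1" .
  then show ?thesis using assms
    by (metis fps_inverse_unique)
qed

lemma fps_scale_shift_sum:
  "fps_scale k (shift_sum g) = shift_sum (\<lambda>a. fps_const (k ^ a) * fps_scale k (g a))"
proof (rule fps_ext)
  fix n
  have "k ^ n = k ^ a * k ^ (n - a)" if "a \<le> n" for a
    using that by (simp flip: power_add)
  then show "fps_nth (fps_scale k (shift_sum g)) n = fps_nth (shift_sum (\<lambda>a. fps_const (k ^ a) * fps_scale k (g a))) n"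
    by (auto simp: shift_sum_nth sum_distrib_left mult.assoc intro!: sum.cong)
qed

text \<open>\<open>d\<close> is twice the centre of symmetry and need not be the degree, since the
  end coefficients may vanish. Hence the class for fixed \<open>d\<close> is closed under sums and
  contains 0.\<close>

definition palindromic :: "nat \<Rightarrow> 'a::comm_ring_1 fps \<Rightarrow> bool" where
  "palindromic d p \<longleftrightarrow> (\<forall>n. fps_nth p n = (if n \<le> d then fps_nth p (d - n) else 0))"

lemma palindromicD: "palindromic d p \<Longrightarrow> n \<le> d \<Longrightarrow> fps_nth p n = fps_nth p (d - n)"
  and palindromic_beyond: "palindromic d p \<Longrightarrow> n > d \<Longrightarrow> fps_nth p n = 0"
  unfolding palindromic_def by (metis, metis leD)

lemma palindromic_add: "palindromic d p \<Longrightarrow> palindromic d r \<Longrightarrow> palindromic d (p + r)"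
  unfolding palindromic_def fps_add_nth by (metis (full_types) add_0)

lemma palindromic_diff: "palindromic d p \<Longrightarrow> palindromic d r \<Longrightarrow> palindromic d (p - r)"
  unfolding palindromic_def fps_sub_nth by (metis (full_types) diff_0_right)

lemma palindromic_const: "palindromic d p \<Longrightarrow> palindromic d (fps_const k * p)"
  unfolding palindromic_def fps_mult_left_const_nth by (metis mult_zero_right)

text \<open>The centre \<open>d / 2\<close> of the symmetry moves by \<open>k\<close>.\<close>

lemma palindromic_X_power:
  assumes "palindromic d p"
  shows "palindromic (d + 2 * k) (fps_X ^ k * p)"
  unfolding palindromic_def fps_nth_X_power_mult
proof (intro allI)
  fix n
  show "(if n < k then 0 else fps_nth p (n - k)) =
     (if n \<le> d + 2 * k then if d + 2 * k - n < k then 0 else fps_nth p (d + 2 * k - n - k) else 0)"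
  proof (cases "k \<le> n \<and> n \<le> d + k")
    case True
    have "d + 2 * k - n - k = d - (n - k)" using True by simp
    then show ?thesis using True palindromicD[OF assms, of "n - k"] by auto
  next
    case False
    then show ?thesis
      using palindromic_beyond[OF assms, of "n - k"] palindromic_beyond[OF assms, of "d + 2 * k - n - k"] by auto
  qed
qed

lemma palindromic_one_plus_X:
  assumes "palindromic d p"
  shows "palindromic (Suc d) ((1 + fps_X) * p)"
  unfolding palindromic_def distrib_right fps_add_nth fps_X_mult_nth mult_1
proof (intro allI)
  fix n
  note p = palindromicD[OF assms] palindromic_beyond[OF assms]
  consider "n = 0" | "n = Suc d" | "0 < n" "n \<le> d" | "n > Suc d" by linarith
  then show "fps_nth p n + (if n = 0 then 0 else fps_nth p (n - 1)) =
    (if n \<le> Suc d then fps_nth p (Suc d - n) + (if Suc d - n = 0 then 0 else fps_nth p (Suc d - n - 1)) else 0)"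
  proof cases
    case 3
    then have "fps_nth p n = fps_nth p (Suc d - n - 1)" "fps_nth p (n - 1) = fps_nth p (Suc d - n)"
      using p(1)[of n] p(1)[of "n - 1"] by (auto simp: Suc_diff_le)
    then show ?thesis using 3 by auto
  qed (use p(1)[of 0] p(2) in auto)
qed

lemma palindromic_1: "palindromic 0 1"
  by (simp add: palindromic_def)

text \<open>Conjugate partitions indexed from \<open>0\<close>: \<open>s t\<close> plays the role of \<open>r\<^sup>(\<^sup>t\<^sup>+\<^sup>1\<^sup>)\<close>.\<close>

definition partition_seqs :: "nat \<Rightarrow> (nat \<Rightarrow> nat) set" where
  "partition_seqs n = {s. (\<forall>t. s (Suc t) \<le> s t) \<and> finite {t. s t \<noteq> 0} \<and> (\<Sum>t | s t \<noteq> 0. s t) = n}"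

lemma antimono_zero: "(\<And>t. s (Suc t) \<le> s t) \<Longrightarrow> s 0 = (0::nat) \<Longrightarrow> s = (\<lambda>_. 0)"
proof
  fix t assume "\<And>t. s (Suc t) \<le> s t" "s 0 = 0"
  then show "s t = 0" by (induction t) (simp, metis le_zero_eq)
qed

lemma partition_seqs_0: "partition_seqs 0 = {\<lambda>_. 0}"
  by (auto simp: partition_seqs_def)

lemma supp_case_nat:
  "{t. case_nat (a::nat) s t \<noteq> 0} = (if a = 0 then Suc ` {t. s t \<noteq> 0} else insert 0 (Suc ` {t. s t \<noteq> 0}))"
proof (rule set_eqI)
  fix t
  show "t \<in> {t. case_nat a s t \<noteq> 0} \<longleftrightarrow>
      t \<in> (if a = 0 then Suc ` {t. s t \<noteq> 0} else insert 0 (Suc ` {t. s t \<noteq> 0}))"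
    by (cases t) auto
qed

lemma sum_case_nat:
  assumes "finite {t. s t \<noteq> (0::nat)}"
  shows "(\<Sum>t | case_nat a s t \<noteq> 0. case_nat a s t) = a + (\<Sum>t | s t \<noteq> 0. s t)"
  unfolding supp_case_nat using assms by (simp add: sum.reindex)

lemma partition_seqs_rec:
  "partition_seqs n = (\<Union>a\<le>n. case_nat a ` {s \<in> partition_seqs (n - a). s 0 \<le> a})"
proof (intro equalityI subsetI)
  fix s assume s: "s \<in> partition_seqs n"
  define s' where "s' = s \<circ> Suc"
  have eq: "s = case_nat (s 0) s'" by (auto simp: s'_def fun_eq_iff split: nat.splits)
  have fin: "finite {t. s' t \<noteq> 0}"
  proof -
    have "Suc ` {t. s' t \<noteq> 0} \<subseteq> {t. s t \<noteq> 0}" by (auto simp: s'_def)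
    then show ?thesis using s by (auto simp: partition_seqs_def dest: finite_subset intro: finite_imageD)
  qed
  have "n = s 0 + (\<Sum>t | s' t \<noteq> 0. s' t)"
    using s sum_case_nat[OF fin, of "s 0"] by (simp add: partition_seqs_def flip: eq)
  then have "s' \<in> partition_seqs (n - s 0)" "s 0 \<le> n" "s' 0 \<le> s 0"
    using s fin by (auto simp: partition_seqs_def s'_def)
  then show "s \<in> (\<Union>a\<le>n. case_nat a ` {s \<in> partition_seqs (n - a). s 0 \<le> a})"
    using eq by (auto intro!: bexI[of _ "s 0"])
next
  fix s assume "s \<in> (\<Union>a\<le>n. case_nat a ` {s \<in> partition_seqs (n - a). s 0 \<le> a})"
  then obtain a s' where a: "a \<le> n" "s' \<in> partition_seqs (n - a)" "s' 0 \<le> a" and s: "s = case_nat a s'"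
    by auto
  have fin: "finite {t. s' t \<noteq> 0}" using a by (auto simp: partition_seqs_def)
  then have "finite {t. s t \<noteq> 0}" unfolding s supp_case_nat by simp
  moreover have "(\<Sum>t | s t \<noteq> 0. s t) = n"
    using a sum_case_nat[OF fin, of a] by (auto simp: partition_seqs_def s)
  moreover have "s (Suc t) \<le> s t" for t
    using a by (auto simp: s partition_seqs_def split: nat.splits)
  ultimately show "s \<in> partition_seqs n" by (simp add: partition_seqs_def)
qed

lemma finite_partition_seqs: "finite (partition_seqs n)"
proof (induction n rule: less_induct)
  case (less n)
  have "finite {s \<in> partition_seqs (n - a). s 0 \<le> a}" if "a \<le> n" for a
  \<comment> \<open>For \<open>a = 0\<close> the induction hypothesis says nothing, as
    \<open>n - a = n\<close>; but a decreasing sequence that starts with 0 vanishes.\<close>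
  proof (cases "a = 0")
    case True
    have "{s \<in> partition_seqs (n - a). s 0 \<le> a} \<subseteq> {\<lambda>_. 0}"
      using antimono_zero by (auto simp: True partition_seqs_def)
    then show ?thesis by (rule finite_subset) simp
  next
    case False
    then show ?thesis
    proof (cases "n = 0")
      case True
      then show ?thesis by (simp add: partition_seqs_0)
    next
      case n: False
      then show ?thesis using less.IH[of "n - a"] False by auto
    qed
  qed
  then show ?case by (subst partition_seqs_rec) blast
qed

lemma sum_partition_seqs:
  "(\<Sum>s\<in>partition_seqs n. h s) =
     (\<Sum>a\<le>n. \<Sum>s | s \<in> partition_seqs (n - a) \<and> s 0 \<le> a. h (case_nat a s))"
proof -
  have inj: "inj_on (case_nat a) A" for a :: nat and A
  proof (rule inj_onI)
    fix s s' assume eq: "case_nat a s = case_nat a s'"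
    show "s = s'"
    proof
      fix t
      show "s t = s' t" using fun_cong[OF eq, of "Suc t"] by simp
    qed
  qed
  have "(\<Sum>s\<in>partition_seqs n. h s) = (\<Sum>a\<le>n. \<Sum>s\<in>case_nat a ` {s \<in> partition_seqs (n - a). s 0 \<le> a}. h s)"
    unfolding partition_seqs_rec[of n]
  proof (rule sum.UNION_disjoint)
    show "\<forall>i\<in>{..n}. finite (case_nat i ` {s \<in> partition_seqs (n - i). s 0 \<le> i})"
      by (simp add: finite_partition_seqs)
    have "i = j" if "case_nat i s = case_nat j s'" for i j :: nat and s s'
      using fun_cong[OF that, of 0] by simp
    then show "\<forall>i\<in>{..n}. \<forall>j\<in>{..n}. i \<noteq> j \<longrightarrow>
      case_nat i ` {s \<in> partition_seqs (n - i). s 0 \<le> i} \<inter>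
      case_nat j ` {s \<in> partition_seqs (n - j). s 0 \<le> j} = {}"
      by blast
  qed simp
  then show ?thesis by (simp add: sum.reindex[OF inj])
qed

section \<open>One-vertex sums: \<open>u\<close> is the value of q, the series variable stands for
  y_i\<close>

locale generic_q =
  fixes u :: "'a::field"
  assumes u_nonzero: "u \<noteq> 0" and u_power_neq_1: "n > 0 \<Longrightarrow> u ^ n \<noteq> 1"
begin

definition qp :: "nat \<Rightarrow> 'a" where "qp n = (\<Prod>s=1..n. 1 - u ^ s)"

lemma qp_0 [simp]: "qp 0 = 1" by (simp add: qp_def)
lemma qp_Suc: "qp (Suc n) = qp n * (1 - u ^ Suc n)" by (simp add: qp_def)
lemma qp_nonzero [simp]: "qp n \<noteq> 0"
  using u_power_neq_1 by (fastforce simp: qp_def)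

text \<open>The value 0 for \<open>a > b\<close> encodes the condition that the next entry be at
  most \<open>b\<close>, so that sums over bounded partitions can run over all partitions.\<close>

definition iq :: "nat \<Rightarrow> nat \<Rightarrow> 'a" where "iq b a = (if a \<le> b then inverse (qp (b - a)) else 0)"

lemma u_powi_add: "u powi (a + b) = u powi a * u powi b"
  using u_nonzero by (simp add: power_int_add)

text \<open>For a decreasing \<open>s\<close> the factors outside the support would all be 1;
  leaving them out keeps the product finite.\<close>

definition seq_weight :: "(nat \<Rightarrow> int) \<Rightarrow> (nat \<Rightarrow> nat) \<Rightarrow> 'a" where
  "seq_weight c s = (\<Prod>t | s t \<noteq> 0. u powi ((int (s t))\<^sup>2 - c t * int (s t)) / qp (s t - s (Suc t)))"

text \<open>The weight \<open>\<kappa>\<close> on the first entry makes the family closed under splitting off that entry.\<close>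

definition fermionic :: "(nat \<Rightarrow> 'a) \<Rightarrow> (nat \<Rightarrow> int) \<Rightarrow> 'a fps" where
  "fermionic \<kappa> c = Abs_fps (\<lambda>n. \<Sum>s\<in>partition_seqs n. \<kappa> (s 0) * seq_weight c s)"

lemma seq_weight_case_nat:
  assumes "s \<in> partition_seqs n" "s 0 \<le> a"
  shows "seq_weight c (case_nat a s) =
     u powi ((int a)\<^sup>2 - c 0 * int a) * iq a (s 0) * seq_weight (\<lambda>t. c (Suc t)) s"
proof (cases "a = 0")
  case True
  then have "s = (\<lambda>_. 0)" using assms antimono_zero by (auto simp: partition_seqs_def)
  then show ?thesis using True by (auto simp: seq_weight_def iq_def split: nat.splits intro: prod.neutral)
next
  case False
  have "finite {t. s t \<noteq> 0}" using assms by (auto simp: partition_seqs_def)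
  then show ?thesis unfolding seq_weight_def supp_case_nat using False assms
    by (simp add: prod.reindex iq_def divide_inverse)
qed

text \<open>Once the first entry \<open>a\<close> is fixed, its only trace on the remaining entries
  is the denominator \<open>qp (a - s 0)\<close> together with the bound \<open>s 0 \<le> a\<close>,
  and both are expressed by the weight \<open>iq a\<close>.\<close>

lemma fermionic_rec:
  "fermionic \<kappa> c = shift_sum (\<lambda>a. fps_const (\<kappa> a * u powi ((int a)\<^sup>2 - c 0 * int a)) *
      fermionic (iq a) (\<lambda>t. c (Suc t)))"
proof (rule fps_ext)
  fix n
  have "fps_nth (fermionic \<kappa> c) n = (\<Sum>a\<le>n. \<Sum>s | s \<in> partition_seqs (n - a) \<and> s 0 \<le> a.
      \<kappa> a * seq_weight c (case_nat a s))"
    by (simp add: fermionic_def sum_partition_seqs)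
  also have "\<dots> = (\<Sum>a\<le>n. \<Sum>s | s \<in> partition_seqs (n - a) \<and> s 0 \<le> a.
      \<kappa> a * u powi ((int a)\<^sup>2 - c 0 * int a) * (iq a (s 0) * seq_weight (\<lambda>t. c (Suc t)) s))"
    by (intro sum.cong refl) (auto simp: seq_weight_case_nat mult.assoc)
  also have "\<dots> = (\<Sum>a\<le>n. \<Sum>s\<in>partition_seqs (n - a).
      \<kappa> a * u powi ((int a)\<^sup>2 - c 0 * int a) * (iq a (s 0) * seq_weight (\<lambda>t. c (Suc t)) s))"
    by (intro sum.cong refl sum.mono_neutral_left) (auto simp: finite_partition_seqs iq_def)
  finally show "fps_nth (fermionic \<kappa> c) n = fps_nth (shift_sum (\<lambda>a. fps_const (\<kappa> a * u powi ((int a)\<^sup>2 - c 0 * int a)) *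
      fermionic (iq a) (\<lambda>t. c (Suc t)))) n"
    by (simp add: shift_sum_nth fermionic_def sum_distrib_left)
qed


text \<open>This is 1 / ((q; q)_a (q y; q)_a). By \<open>fermionic_iq_zero\<close> it is the
  weighted sum over all partitions with first entry at most \<open>a\<close> in the absence of a
  linear term.\<close>

definition tail :: "nat \<Rightarrow> 'a fps" where
  "tail a = fps_const (inverse (qp a)) * inverse (\<Prod>j=1..a. 1 - fps_const (u ^ j) * fps_X)"

lemma tail_0 [simp]: "tail 0 = 1" by (simp add: tail_def)

lemma fps_linear_factor: fixes k :: 'a shows "(1 - fps_const k * fps_X) * inverse (1 - fps_const k * fps_X) = 1"
  using inverse_mult_eq_1[of "1 - fps_const k * fps_X"] by (simp add: mult.commute)

lemma tail_Suc:
  "fps_const (1 - u ^ Suc a) * tail (Suc a) * (1 - fps_const (u ^ Suc a) * fps_X) = tail a"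
proof -
  let ?g = "\<lambda>j. 1 - fps_const (u ^ j) * fps_X"
  have *: "inverse (\<Prod>j=1..Suc a. ?g j) = inverse (\<Prod>j=1..a. ?g j) * inverse (?g (Suc a))"
    by (simp add: fps_inverse_mult)
  have "1 - u ^ Suc a \<noteq> 0" using u_power_neq_1[of "Suc a"] by simp
  then have "inverse (qp (Suc a)) * (1 - u ^ Suc a) = inverse (qp a)"
    by (simp add: qp_Suc del: power_Suc)
  then have c: "fps_const (1 - u ^ Suc a) * fps_const (inverse (qp (Suc a))) = fps_const (inverse (qp a))"
    by (simp only: fps_const_mult mult.commute)
  have "fps_const (1 - u ^ Suc a) * tail (Suc a) * ?g (Suc a) =
     (fps_const (1 - u ^ Suc a) * fps_const (inverse (qp (Suc a)))) *
     inverse (\<Prod>j=1..a. ?g j) * (?g (Suc a) * inverse (?g (Suc a)))"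
    unfolding tail_def * by (simp only: mult_ac)
  then show ?thesis by (simp only: c fps_linear_factor tail_def mult_1_right)
qed

text \<open>Where \<open>tail_Suc\<close> removes the last factor of the product, this removes the
  first one: the factors \<open>j = 2, ..., Suc a\<close> are those of \<open>tail a\<close> after
  the substitution of \<open>u * fps_X\<close>.\<close>

lemma tail_Suc_scaled:
  "fps_const (1 - u ^ Suc a) * tail (Suc a) = inverse (1 - fps_const u * fps_X) * fps_scale u (tail a)"
proof -
  let ?g = "\<lambda>j. 1 - fps_const (u ^ j) * fps_X"
  have nz: "fps_nth (\<Prod>j=1..a. ?g j) 0 \<noteq> 0" by (induction a) simp_all
  have "fps_scale u (\<Prod>j=1..a. ?g j) = (\<Prod>j=1..a. ?g (Suc j))"
    by (simp add: fps_scale_prod fps_scale_diff fps_scale_mult mult_ac flip: fps_const_mult)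
  then have s: "fps_scale u (tail a) = fps_const (inverse (qp a)) * inverse (\<Prod>j=1..a. ?g (Suc j))"
    by (simp only: tail_def fps_scale_mult fps_scale_const fps_scale_inverse[OF nz])
  have "(\<Prod>j=1..Suc a. ?g j) = ?g 1 * (\<Prod>j=1..a. ?g (Suc j))"
    unfolding One_nat_def prod.atLeast_Suc_atMost_Suc_shift
    by (subst prod.atLeast_Suc_atMost) (simp_all del: power_Suc)
  then have i: "inverse (\<Prod>j=1..Suc a. ?g j) = inverse (?g 1) * inverse (\<Prod>j=1..a. ?g (Suc j))"
    by (simp only: fps_inverse_mult)
  have "1 - u ^ Suc a \<noteq> 0" using u_power_neq_1[of "Suc a"] by simp
  then have "inverse (qp (Suc a)) * (1 - u ^ Suc a) = inverse (qp a)"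
    by (simp add: qp_Suc del: power_Suc)
  then have c: "fps_const (1 - u ^ Suc a) * fps_const (inverse (qp (Suc a))) = fps_const (inverse (qp a))"
    by (simp only: fps_const_mult mult.commute)
  have "fps_const (1 - u ^ Suc a) * tail (Suc a) =
     (fps_const (1 - u ^ Suc a) * fps_const (inverse (qp (Suc a)))) * (inverse (?g 1) * inverse (\<Prod>j=1..a. ?g (Suc j)))"
    unfolding tail_def i by (simp only: mult_ac)
  then show ?thesis by (simp only: c s power_one_right mult.left_commute)
qed

lemma tail_pred:
  "fps_const (1 - u ^ a) * tail a * (1 - fps_const (u ^ a) * fps_X) = (if a = 0 then 0 else tail (a - 1))"
  by (cases a) (simp_all add: tail_Suc del: power_Suc)

text \<open>Writing \<open>1 - u\<^sup>n = (1 - u\<^sup>n\<^sup>-\<^sup>r) + u\<^sup>n\<^sup>-\<^sup>r (1 - u\<^sup>r)\<close> gives a Pascal-type recursion in \<open>n\<close>.\<close>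

definition tail_sum :: "nat \<Rightarrow> nat \<Rightarrow> 'a fps" where
  "tail_sum j n = shift_sum (\<lambda>r. fps_const (iq n r * u ^ (r\<^sup>2 - j * r)) * tail r)"

lemma tail_sum_0: "tail_sum j 0 = 1"
  unfolding tail_sum_def by (subst shift_sum_finite[where b = 0]) (simp_all add: iq_def)

text \<open>In the second part of the splitting the factor \<open>1 - u ^ Suc s\<close> is absorbed
  by \<open>tail (Suc s)\<close> through \<open>tail_Suc_scaled\<close>. What remains is the sum for
  \<open>n\<close> after a q-shift.\<close>

lemma tail_sum_Suc:
  assumes "j \<le> 1"
  shows "fps_const (1 - u ^ Suc n) * tail_sum j (Suc n) = tail_sum j n +
     fps_X * fps_const (u ^ (Suc n - j)) * inverse (1 - fps_const u * fps_X) * fps_scale u (tail_sum j n)"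
proof -
  let ?i = "inverse (1 - fps_const u * fps_X)"
  let ?e = "\<lambda>r. u ^ (r\<^sup>2 - j * r)"
  define g where "g s = fps_const (iq n s * u ^ (Suc n - j) * ?e s * u ^ s) * ?i * fps_scale u (tail s)" for s
  have e: "fps_const ((1 - u ^ Suc n) * (iq (Suc n) r * ?e r)) * tail r =
      fps_const (iq n r * ?e r) * tail r + (case r of 0 \<Rightarrow> 0 | Suc s \<Rightarrow> g s)" for r
  proof -
    consider "r > Suc n" | "r = 0" | s where "r = Suc s" "s \<le> n" by (cases r) force+
    then show ?thesis
    proof cases
      case 1
      then show ?thesis by (auto simp: iq_def g_def split: nat.splits)
    next
      case 2
      have "(1 - u ^ Suc n) * inverse (qp (Suc n)) = inverse (qp n)"
        using u_power_neq_1[of "Suc n"] by (simp add: qp_Suc del: power_Suc)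
      then show ?thesis using 2 by (simp add: iq_def del: power_Suc)
    next
      case 3
      \<comment> \<open>As \<open>j \<le> 1\<close>, no subtraction truncates. The isolated
        \<open>s\<close> on the right is the power of \<open>u\<close> that
        \<open>fps_scale u\<close> puts on the term of index \<open>s\<close>.\<close>
      have sq: "(Suc s)\<^sup>2 - j * Suc s + (n - s) = (Suc n - j) + ((s\<^sup>2 - j * s) + s)"
        using assms 3(2) by (cases j) (auto simp: power2_eq_square algebra_simps)
      have d: "(1 - u ^ Suc n) * iq (Suc n) (Suc s) = iq n (Suc s) + u ^ (n - s) * iq n s * (1 - u ^ Suc s)"
      proof -
        have p: "u ^ Suc n = u ^ (n - s) * u ^ Suc s" using 3 by (simp flip: power_add)
        have "iq n (Suc s) = (1 - u ^ (n - s)) * iq n s"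
        proof (cases "s = n")
          case False
          then obtain k where "n - s = Suc k" using 3 by (cases "n - s") auto
          then have k: "n - s = Suc k" "n - Suc s = k" "Suc s \<le> n" "s \<le> n" by linarith+
          have "1 - u ^ Suc k \<noteq> 0" using u_power_neq_1[of "Suc k"] by simp
          then show ?thesis by (simp add: iq_def qp_Suc k del: power_Suc)
        qed (simp add: iq_def)
        then show ?thesis using 3 unfolding p by (simp add: iq_def algebra_simps)
      qed
      have "u ^ (n - s) * ?e r = u ^ ((Suc s)\<^sup>2 - j * Suc s + (n - s))"
        unfolding 3(1) power_add by (simp only: mult.commute)
      also have "\<dots> = u ^ (Suc n - j) * ?e s * u ^ s"
        by (simp only: sq power_add mult_ac)
      finally have x: "u ^ (n - s) * ?e r = u ^ (Suc n - j) * ?e s * u ^ s" .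
      have "(1 - u ^ Suc n) * (iq (Suc n) r * ?e r) = ((1 - u ^ Suc n) * iq (Suc n) (Suc s)) * ?e r"
        by (simp only: 3 mult_ac)
      also have "\<dots> = iq n r * ?e r + iq n s * (u ^ (n - s) * ?e r) * (1 - u ^ Suc s)"
        unfolding d 3(1) distrib_right by (simp only: mult_ac)
      also have "\<dots> = iq n r * ?e r + iq n s * u ^ (Suc n - j) * ?e s * u ^ s * (1 - u ^ Suc s)"
        unfolding x by (simp only: mult.assoc)
      finally have "fps_const ((1 - u ^ Suc n) * (iq (Suc n) r * ?e r)) * tail r =
         fps_const (iq n r * ?e r) * tail r +
         fps_const (iq n s * u ^ (Suc n - j) * ?e s * u ^ s * (1 - u ^ Suc s)) * tail (Suc s)"
        by (simp only: fps_const_add[symmetric] distrib_right 3)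
      also have "fps_const (iq n s * u ^ (Suc n - j) * ?e s * u ^ s * (1 - u ^ Suc s)) * tail (Suc s) = g s"
        by (simp only: fps_const_mult[symmetric, of _ "1 - u ^ Suc s"] mult.assoc[of _ _ "tail (Suc s)"]
            tail_Suc_scaled g_def) (simp only: mult.assoc)
      finally show ?thesis by (simp add: 3)
    qed
  qed
  have "fps_const (1 - u ^ Suc n) * tail_sum j (Suc n) =
     shift_sum (\<lambda>r. fps_const ((1 - u ^ Suc n) * (iq (Suc n) r * ?e r)) * tail r)"
    unfolding tail_sum_def shift_sum_mult[symmetric] by (simp only: mult.assoc fps_const_mult[symmetric])
  also have "\<dots> = tail_sum j n + fps_X * shift_sum g"
    by (simp only: e shift_sum_add shift_sum_Suc tail_sum_def)
  also have "shift_sum g = fps_const (u ^ (Suc n - j)) * ?i * fps_scale u (tail_sum j n)"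
  proof -
    have *: "fps_scale u (tail_sum j n) =
        shift_sum (\<lambda>s. fps_const (u ^ s) * (fps_const (iq n s * ?e s) * fps_scale u (tail s)))"
      by (simp add: tail_sum_def fps_scale_shift_sum fps_scale_mult)
    show ?thesis
      unfolding * shift_sum_mult[symmetric] g_def fps_const_mult[symmetric] by (simp only: mult_ac)
  qed
  finally show ?thesis by (simp only: mult.assoc)
qed

lemma fps_const_one_minus_cancel:
  assumes "fps_const (1 - u ^ Suc n) * f = fps_const (1 - u ^ Suc n) * g"
  shows "f = g"
  using assms u_power_neq_1[of "Suc n"] by (metis eq_iff_diff_eq_0 fps_const_eq_0_iff mult_cancel_left zero_less_Suc)

text \<open>A bounded version of Cauchy's identity. In the induction both terms of the recursion
  become multiples of \<open>tail (Suc n)\<close>, one by restoring its last factor and one by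
  restoring its first.\<close>

lemma tail_sum_eq: "tail_sum 0 n = tail n"
proof (induction n)
  case (Suc n)
  let ?c = "fps_const (1 - u ^ Suc n)" and ?v = "fps_const (u ^ Suc n)"
  have "?c * tail_sum 0 (Suc n) = tail n + fps_X * ?v * (inverse (1 - fps_const u * fps_X) * fps_scale u (tail n))"
    using tail_sum_Suc[of 0 n] by (simp add: Suc mult_ac)
  also have "\<dots> = ?c * tail (Suc n) * (1 - ?v * fps_X) + fps_X * ?v * (?c * tail (Suc n))"
    by (simp only: tail_Suc_scaled[symmetric] tail_Suc)
  also have "\<dots> = ?c * tail (Suc n)" by (simp add: algebra_simps del: power_Suc fps_const_mult)
  finally show ?case by (rule fps_const_one_minus_cancel)
qed (simp add: tail_sum_0)

text \<open>The induction is that for \<open>tail_sum 0\<close>; the additional factor is linear in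
  \<open>fps_X\<close>, and the step amounts to a polynomial identity for it.\<close>

lemma tail_sum_1_eq: "tail_sum 1 n = (1 + fps_X - fps_const (u ^ n) * fps_X) * tail n"
proof (induction n)
  case (Suc n)
  let ?c = "fps_const (1 - u ^ Suc n)" and ?v = "fps_const (u ^ n)" and ?u = "fps_const u"
  let ?T = "?c * tail (Suc n)"
  have uv: "fps_const (u ^ Suc n) = ?u * ?v" by simp
  have "?c * tail_sum 1 (Suc n) = tail_sum 1 n + fps_X * fps_const (u ^ (Suc n - 1)) *
      inverse (1 - fps_const u * fps_X) * fps_scale u (tail_sum 1 n)"
    by (rule tail_sum_Suc) simp
  also have "\<dots> = (1 + fps_X - ?v * fps_X) * tail n + fps_X * ?v *
      fps_scale u (1 + fps_X - ?v * fps_X) * (inverse (1 - ?u * fps_X) * fps_scale u (tail n))"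
    unfolding Suc fps_scale_mult diff_Suc_1 by (simp only: mult_ac)
  also have "\<dots> = (1 + fps_X - ?v * fps_X) * (?T * (1 - ?u * ?v * fps_X)) +
      fps_X * ?v * (1 + ?u * fps_X - ?v * (?u * fps_X)) * ?T"
    using tail_Suc[of n] unfolding uv tail_Suc_scaled[symmetric]
    by (simp only: fps_scale_diff fps_scale_add fps_scale_mult fps_scale_1 fps_scale_X fps_scale_const)
  also have "\<dots> = (1 + fps_X - ?u * ?v * fps_X) * ?T"
  proof -
    have "(1 + x - v * x) * (t * (1 - a * v * x)) + x * v * (1 + a * x - v * (a * x)) * t =
        (1 + x - a * v * x) * t" for x v a t :: "'b::comm_ring_1"
      by (simp add: algebra_simps)
    then show ?thesis .
  qed
  also have "\<dots> = ?c * ((1 + fps_X - fps_const (u ^ Suc n) * fps_X) * tail (Suc n))"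
    unfolding uv by (simp only: mult_ac)
  finally show ?case by (rule fps_const_one_minus_cancel)
qed (simp add: tail_sum_0)


text \<open>By \<open>tail_sum_eq\<close>, \<open>tail\<close> solves the recursion
  \<open>fermionic_rec\<close>. At \<open>b\<close> this recursion contains the unknown itself in
  the term \<open>a = b\<close>, but there it carries the factor \<open>fps_X ^ b\<close>, so for
  \<open>b > 0\<close> the solution is unique.\<close>

lemma fermionic_iq_zero: "fermionic (iq b) (\<lambda>_. 0) = tail b"
proof (induction b rule: less_induct)
  case (less b)
  show ?case
  proof (cases "b = 0")
    case True
    have "(\<Sum>s\<in>partition_seqs n. iq 0 (s 0) * seq_weight (\<lambda>_. 0) s) = (if n = 0 then 1 else 0)" for n
    proof (cases "n = 0")
      case False
      have "iq 0 (s 0) = 0" if "s \<in> partition_seqs n" for s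
      proof -
        have "s 0 \<noteq> 0"
        proof
          assume "s 0 = 0"
          then have "s = (\<lambda>_. 0)" using that by (intro antimono_zero) (auto simp: partition_seqs_def)
          then show False using that False by (simp add: partition_seqs_def)
        qed
        then show ?thesis by (simp add: iq_def)
      qed
      then show ?thesis using False by simp
    qed (simp add: partition_seqs_0 iq_def seq_weight_def)
    then show ?thesis using True by (intro fps_ext) (simp add: fermionic_def)
  next
    case False
    let ?g = "\<lambda>f a. fps_const (iq b a * u ^ (a\<^sup>2)) * f a"
    have z: "?g f a = 0" if "a > b" for f and a using that by (simp add: iq_def)
    obtain m where m: "b = Suc m" using False by (cases b) auto
    have "fermionic (iq b) (\<lambda>_. 0) = shift_sum (?g (\<lambda>a. fermionic (iq a) (\<lambda>_. 0)))"
      by (subst fermionic_rec) (simp flip: power_int_of_nat)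
    also have "\<dots> = (\<Sum>a\<le>b. fps_X ^ a * ?g (\<lambda>a. fermionic (iq a) (\<lambda>_. 0)) a)"
      by (rule shift_sum_finite) (rule z)
    finally have 1: "fermionic (iq b) (\<lambda>_. 0) = (\<Sum>a\<le>m. fps_X ^ a * ?g tail a) +
        fps_X ^ b * ?g (\<lambda>a. fermionic (iq a) (\<lambda>_. 0)) b"
      using less.IH by (simp add: m)
    have "tail b = shift_sum (?g tail)"
      using tail_sum_eq[of b] by (simp add: tail_sum_def)
    also have "\<dots> = (\<Sum>a\<le>b. fps_X ^ a * ?g tail a)"
      by (rule shift_sum_finite) (rule z)
    finally have 2: "tail b = (\<Sum>a\<le>m. fps_X ^ a * ?g tail a) + fps_X ^ b * ?g tail b"
      by (simp add: m)
    let ?k = "fps_X ^ b * fps_const (iq b b * u ^ (b\<^sup>2))"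
    have "(fermionic (iq b) (\<lambda>_. 0) - tail b) = ?k * (fermionic (iq b) (\<lambda>_. 0) - tail b)"
    proof -
      have "fermionic (iq b) (\<lambda>_. 0) - tail b =
          (\<Sum>a\<le>m. fps_X ^ a * ?g tail a) + fps_X ^ b * ?g (\<lambda>a. fermionic (iq a) (\<lambda>_. 0)) b -
          ((\<Sum>a\<le>m. fps_X ^ a * ?g tail a) + fps_X ^ b * ?g tail b)"
        by (rule arg_cong2[OF 1 2])
      also have "\<dots> = ?k * (fermionic (iq b) (\<lambda>_. 0) - tail b)"
        by (simp only: add_diff_cancel_left right_diff_distrib mult.assoc)
      finally show ?thesis .
    qed
    then have "(1 - ?k) * (fermionic (iq b) (\<lambda>_. 0) - tail b) = 0"
      by (simp only: left_diff_distrib mult_1 right_minus_eq)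
    moreover have "fps_nth (1 - ?k) 0 \<noteq> 0"
      using False by (simp add: fps_nth_X_power_mult)
    then have "1 - ?k \<noteq> 0" by force
    ultimately show ?thesis by simp
  qed
qed

lemma fermionic_iq_unit:
  "fermionic (iq b) (\<lambda>t. if t = 0 then 1 else 0) = (1 + fps_X - fps_const (u ^ b) * fps_X) * tail b"
proof -
  have "u powi ((int a)\<^sup>2 - int a) = u ^ (a\<^sup>2 - a)" for a
  proof -
    have "(int a)\<^sup>2 - int a = int (a\<^sup>2 - a)"
      by (simp add: of_nat_diff power2_eq_square)
    then show ?thesis by (simp only: power_int_of_nat)
  qed
  then have "fermionic (iq b) (\<lambda>t. if t = 0 then 1 else 0) = tail_sum 1 b"
    by (subst fermionic_rec) (simp add: fermionic_iq_zero tail_sum_def)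
  then show ?thesis by (simp only: tail_sum_1_eq)
qed

section \<open>Two recursions that lower the linear term\<close>

lemma fun_upd_shift: "(\<lambda>t. (c(Suc k := x)) (Suc t)) = (\<lambda>t. c (Suc t))(k := x)"
  by auto

text \<open>For \<open>k = 0\<close> the factorization of 1 - (1 + X) v + X v^2 at v = u^a turns
  \<open>tail a\<close> into \<open>tail (a - 1)\<close>, and re-indexing \<open>a\<close> shifts
  \<open>\<kappa>\<close> and takes 2 from \<open>c 0\<close>. This propagates to longer
  \<open>c\<close>: as \<open>iq a (Suc b)\<close> is \<open>iq (a - 1) b\<close>, the shift in the
  inner sum re-indexes the outer one, which again takes 2 from the first entry, at the cost of a
  factor \<open>fps_X\<close> and a power of \<open>u\<close>.\<close>

lemma fermionic_reduce:
  assumes "\<And>t. t > k \<Longrightarrow> c t = 0"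
  shows "fermionic \<kappa> c = (1 + fps_X) * fermionic \<kappa> (c(k := c k - 1)) - fps_X * fermionic \<kappa> (c(k := c k - 2)) +
    fps_X ^ Suc k * (fps_const (u powi (int (Suc k) - (\<Sum>t\<le>k. c t))) *
      fermionic (\<lambda>a. \<kappa> (Suc a)) (\<lambda>t. if t \<le> k then c t - 2 else 0))"
  using assms
proof (induction k arbitrary: c \<kappa>)
  case 0
  have tl: "(\<lambda>t. c (Suc t)) = (\<lambda>_. 0)" using 0 by auto
  define g where "g m a = u powi ((int a)\<^sup>2 - m * int a)" for m a
  have rec: "fermionic \<mu> (c(0 := m)) = shift_sum (\<lambda>a. fps_const (\<mu> a * g m a) * tail a)" for \<mu> m
    by (subst fermionic_rec) (simp add: tl fermionic_iq_zero g_def)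
  have g1: "g (c 0 - 1) a = g (c 0) a * u ^ a" "g (c 0 - 2) a = g (c 0) a * (u ^ a * u ^ a)" for a
  proof -
    show "g (c 0 - 1) a = g (c 0) a * u ^ a"
      unfolding g_def power_int_of_nat[symmetric] u_powi_add[symmetric] by (simp add: algebra_simps)
    show "g (c 0 - 2) a = g (c 0) a * (u ^ a * u ^ a)"
      unfolding g_def power_int_of_nat[symmetric] u_powi_add[symmetric] by (simp add: algebra_simps)
  qed
  have g2: "g (c 0) (Suc a) = u powi (1 - c 0) * g (c 0 - 2) a" for a
    unfolding g_def u_powi_add[symmetric] by (simp add: algebra_simps power2_eq_square)
  have e0: "(\<lambda>t. if t \<le> 0 then c t - 2 else 0) = c(0 := c 0 - 2)"
    using 0 by auto
  have w0: "int (Suc 0) - (\<Sum>t\<le>0. c t) = 1 - c 0" by simp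
  have r: "x = p - s + z" if "x - p + s = z" for x p s z :: "'a fps"
    using that by (simp add: algebra_simps)
  have "fermionic \<kappa> (c(0 := c 0)) - (1 + fps_X) * fermionic \<kappa> (c(0 := c 0 - 1)) + fps_X * fermionic \<kappa> (c(0 := c 0 - 2)) =
     shift_sum (\<lambda>a. fps_const (\<kappa> a * g (c 0) a) * (fps_const (1 - u ^ a) * tail a * (1 - fps_const (u ^ a) * fps_X)))"
    unfolding rec shift_sum_mult[symmetric] shift_sum_diff[symmetric] shift_sum_add[symmetric]
  proof (intro arg_cong[of _ _ shift_sum] ext)
    fix a
    have r: "x * t - (1 + X) * (x * v * t) + X * (x * (v * v) * t) = x * ((1 - v) * t * (1 - v * X))"
      for x t v X :: "'b::comm_ring_1" by (simp add: algebra_simps)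
    show "fps_const (\<kappa> a * g (c 0) a) * tail a - (1 + fps_X) * (fps_const (\<kappa> a * g (c 0 - 1) a) * tail a) +
         fps_X * (fps_const (\<kappa> a * g (c 0 - 2) a) * tail a) =
         fps_const (\<kappa> a * g (c 0) a) * (fps_const (1 - u ^ a) * tail a * (1 - fps_const (u ^ a) * fps_X))"
      using r[of "fps_const (\<kappa> a * g (c 0) a)" "tail a" fps_X "fps_const (u ^ a)"]
      unfolding g1 fps_const_mult fps_const_1_eq_1[symmetric] fps_const_sub by (simp only: mult.assoc)
  qed
  also have "\<dots> = shift_sum (\<lambda>a. case a of 0 \<Rightarrow> 0 | Suc a \<Rightarrow> fps_const (\<kappa> (Suc a) * g (c 0) (Suc a)) * tail a)"
    unfolding tail_pred by (intro arg_cong[of _ _ shift_sum] ext) (simp split: nat.splits)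
  also have "\<dots> = fps_X * (fps_const (u powi (1 - c 0)) * fermionic (\<lambda>a. \<kappa> (Suc a)) (c(0 := c 0 - 2)))"
    unfolding shift_sum_Suc rec g2 shift_sum_mult[symmetric]
    by (simp add: mult_ac flip: fps_const_mult)
  finally show ?case unfolding e0 w0 fun_upd_triv power_Suc power_0 mult_1_right by (rule r)
next
  case (Suc k)
  define c' where "c' = (\<lambda>t. c (Suc t))"
  have z: "c' t = 0" if "t > k" for t using Suc.prems[of "Suc t"] that by (simp add: c'_def)
  define w where "w = u powi (int (Suc k) - (\<Sum>t\<le>k. c' t))"
  define c2 where "c2 = (\<lambda>t. if t \<le> k then c' t - 2 else 0)"
  define K where "K \<mu> m a = fps_const (\<mu> a * u powi ((int a)\<^sup>2 - m * int a))" for \<mu> m and a :: nat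
  have rec: "fermionic \<mu> (c(Suc k := m)) = shift_sum (\<lambda>a. K \<mu> (c 0) a * fermionic (iq a) (c'(k := m)))" for \<mu> m
    by (subst fermionic_rec, subst fun_upd_shift) (simp add: c'_def K_def)
  have rec2: "fermionic \<mu> (\<lambda>t. if t \<le> Suc k then c t - 2 else 0) = shift_sum (\<lambda>a. K \<mu> (c 0 - 2) a * fermionic (iq a) c2)" for \<mu>
  proof -
    have "(\<lambda>t. if Suc t \<le> Suc k then c (Suc t) - 2 else 0) = c2" by (simp add: c2_def c'_def fun_eq_iff)
    then show ?thesis by (subst fermionic_rec) (simp add: K_def)
  qed
  have iq: "fermionic (\<lambda>b. iq a (Suc b)) e = (case a of 0 \<Rightarrow> 0 | Suc a \<Rightarrow> fermionic (iq a) e)" for a e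
    by (cases a) (auto simp: iq_def fermionic_def intro!: fps_ext cong: if_cong)
  have K2: "K \<kappa> (c 0) (Suc a) = fps_const (u powi (1 - c 0)) * K (\<lambda>a. \<kappa> (Suc a)) (c 0 - 2) a" for a
  proof -
    have "(int (Suc a))\<^sup>2 - c 0 * int (Suc a) = (1 - c 0) + ((int a)\<^sup>2 - (c 0 - 2) * int a)"
      by (simp add: algebra_simps power2_eq_square)
    then show ?thesis by (simp only: K_def u_powi_add fps_const_mult mult_ac)
  qed
  have uw: "u powi (1 - c 0) * w = u powi (int (Suc (Suc k)) - (\<Sum>t\<le>Suc k. c t))"
    unfolding w_def u_powi_add[symmetric] c'_def sum.atMost_Suc_shift by (simp add: algebra_simps)
  have ck: "c' k = c (Suc k)" "c'(k := c (Suc k)) = c'" by (auto simp: c'_def)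
  have IH: "fermionic (iq a) (c'(k := c (Suc k))) = (1 + fps_X) * fermionic (iq a) (c'(k := c (Suc k) - 1)) -
      fps_X * fermionic (iq a) (c'(k := c (Suc k) - 2)) +
      fps_X ^ Suc k * (fps_const w * (case a of 0 \<Rightarrow> 0 | Suc a \<Rightarrow> fermionic (iq a) c2))" for a
    using Suc.IH[of c' "iq a", OF z] unfolding iq ck w_def[symmetric] c2_def[symmetric] .
  have "fermionic \<kappa> c = shift_sum (\<lambda>a. K \<kappa> (c 0) a * fermionic (iq a) (c'(k := c (Suc k))))"
    using rec[of \<kappa> "c (Suc k)"] by simp
  also have "\<dots> = shift_sum (\<lambda>a. (1 + fps_X) * (K \<kappa> (c 0) a * fermionic (iq a) (c'(k := c (Suc k) - 1))) -
      fps_X * (K \<kappa> (c 0) a * fermionic (iq a) (c'(k := c (Suc k) - 2))) +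
      fps_X ^ Suc k * (fps_const w * (case a of 0 \<Rightarrow> 0 | Suc b \<Rightarrow> K \<kappa> (c 0) (Suc b) * fermionic (iq b) c2)))"
  proof (intro arg_cong[of _ _ shift_sum] ext)
    fix a
    have r: "x * ((1 + X) * f - X * g + Y * (v * h)) = (1 + X) * (x * f) - X * (x * g) + Y * (v * (x * h))"
      for x X f g Y v h :: "'b::comm_ring_1" by (simp add: algebra_simps)
    have s: "K \<kappa> (c 0) a * (case a of 0 \<Rightarrow> 0 | Suc a \<Rightarrow> fermionic (iq a) c2) =
       (case a of 0 \<Rightarrow> 0 | Suc b \<Rightarrow> K \<kappa> (c 0) (Suc b) * fermionic (iq b) c2)"
      by (simp split: nat.splits)
    show "K \<kappa> (c 0) a * fermionic (iq a) (c'(k := c (Suc k))) =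
      (1 + fps_X) * (K \<kappa> (c 0) a * fermionic (iq a) (c'(k := c (Suc k) - 1))) -
      fps_X * (K \<kappa> (c 0) a * fermionic (iq a) (c'(k := c (Suc k) - 2))) +
      fps_X ^ Suc k * (fps_const w * (case a of 0 \<Rightarrow> 0 | Suc b \<Rightarrow> K \<kappa> (c 0) (Suc b) * fermionic (iq b) c2))"
      unfolding IH r s ..
  qed
  also have "\<dots> = (1 + fps_X) * fermionic \<kappa> (c(Suc k := c (Suc k) - 1)) - fps_X * fermionic \<kappa> (c(Suc k := c (Suc k) - 2)) +
      fps_X ^ Suc k * (fps_const w * (fps_X * shift_sum (\<lambda>b. K \<kappa> (c 0) (Suc b) * fermionic (iq b) c2)))"
    unfolding shift_sum_add shift_sum_diff shift_sum_mult shift_sum_Suc rec ..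
  also have "fps_X ^ Suc k * (fps_const w * (fps_X * shift_sum (\<lambda>b. K \<kappa> (c 0) (Suc b) * fermionic (iq b) c2))) =
     fps_X ^ Suc (Suc k) * ((fps_const (u powi (1 - c 0)) * fps_const w) *
       fermionic (\<lambda>a. \<kappa> (Suc a)) (\<lambda>t. if t \<le> Suc k then c t - 2 else 0))"
    unfolding K2 rec2 mult.assoc shift_sum_mult by (simp only: mult_ac power_Suc)
  finally show ?case unfolding fps_const_mult uw .
qed

text \<open>Serves a last entry 1, where \<open>fermionic_reduce\<close> would produce the entry -1.
  For \<open>k = 0\<close> it is \<open>fermionic_iq_unit\<close>, whose factor \<open>u ^ a\<close>
  is absorbed by lowering \<open>c 0\<close> by 1; the induction then prepends entries.\<close>

lemma fermionic_reduce_one: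
  assumes "\<And>t. t > Suc k \<Longrightarrow> c t = 0" "c (Suc k) = 1"
  shows "fermionic \<kappa> c = (1 + fps_X) * fermionic \<kappa> (c(Suc k := 0)) - fps_X * fermionic \<kappa> (c(k := c k - 1, Suc k := 0))"
  using assms
proof (induction k arbitrary: c \<kappa>)
  case 0
  define g where "g m a = u powi ((int a)\<^sup>2 - m * int a)" for m a
  have tl: "(\<lambda>t. c (Suc t)) = (\<lambda>t. if t = 0 then 1 else 0)" using 0 by force
  have 1: "fermionic \<kappa> c = shift_sum (\<lambda>a. fps_const (\<kappa> a * g (c 0) a) * ((1 + fps_X - fps_const (u ^ a) * fps_X) * tail a))"
    by (subst fermionic_rec) (simp only: tl fermionic_iq_unit g_def)
  have rec: "fermionic \<kappa> e = shift_sum (\<lambda>a. fps_const (\<kappa> a * g (e 0) a) * tail a)" if "\<And>t. e (Suc t) = 0" for e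
    by (subst fermionic_rec) (simp add: that fermionic_iq_zero g_def)
  have e: "(c(Suc 0 := 0)) (Suc t) = 0" "(c(0 := c 0 - 1, Suc 0 := 0)) (Suc t) = 0" for t
    using 0 by auto
  have g1: "g (c 0 - 1) a = g (c 0) a * u ^ a" for a
    unfolding g_def power_int_of_nat[symmetric] u_powi_add[symmetric] by (simp add: algebra_simps)
  show ?case unfolding 1 rec[of "c(Suc 0 := 0)", OF e(1)] rec[of "c(0 := c 0 - 1, Suc 0 := 0)", OF e(2)] shift_sum_mult[symmetric] shift_sum_diff[symmetric]
  proof (intro arg_cong[of _ _ shift_sum] ext)
    fix a
    have r: "x * ((1 + X - v * X) * t) = (1 + X) * (x * t) - X * (x * v * t)"
      for x t v X :: "'b::comm_ring_1" by (simp add: algebra_simps)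
    show "fps_const (\<kappa> a * g (c 0) a) * ((1 + fps_X - fps_const (u ^ a) * fps_X) * tail a) =
         (1 + fps_X) * (fps_const (\<kappa> a * g ((c(Suc 0 := 0)) 0) a) * tail a) -
         fps_X * (fps_const (\<kappa> a * g ((c(0 := c 0 - 1, Suc 0 := 0)) 0) a) * tail a)"
      unfolding r by (simp add: g1 mult.assoc)
  qed
next
  case (Suc k)
  define c' where "c' = (\<lambda>t. c (Suc t))"
  define K where "K a = fps_const (\<kappa> a * u powi ((int a)\<^sup>2 - c 0 * int a))" for a :: nat
  have rec: "fermionic \<kappa> e = shift_sum (\<lambda>a. K a * fermionic (iq a) (\<lambda>t. e (Suc t)))" if "e 0 = c 0" for e
    by (subst fermionic_rec) (simp add: K_def that)
  have h: "fermionic (iq a) c' = (1 + fps_X) * fermionic (iq a) (c'(Suc k := 0)) -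
      fps_X * fermionic (iq a) (c'(k := c' k - 1, Suc k := 0))" for a
    by (rule Suc.IH) (use Suc.prems in \<open>auto simp: c'_def\<close>)
  then have IH: "K a * fermionic (iq a) c' = (1 + fps_X) * (K a * fermionic (iq a) (c'(Suc k := 0))) -
      fps_X * (K a * fermionic (iq a) (c'(k := c' k - 1, Suc k := 0)))" for a
  proof -
    have r: "x * ((1 + X) * p - X * r) = (1 + X) * (x * p) - X * (x * r)" for x X p r :: "'b::comm_ring_1"
      by (simp add: algebra_simps)
    show ?thesis unfolding h r ..
  qed
  have e0: "(c(Suc (Suc k) := 0)) 0 = c 0" "(c(Suc k := c (Suc k) - 1, Suc (Suc k) := 0)) 0 = c 0"
    by simp_all
  have e: "(\<lambda>t. (c(Suc (Suc k) := 0)) (Suc t)) = c'(Suc k := 0)"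
    "(\<lambda>t. (c(Suc k := c (Suc k) - 1, Suc (Suc k) := 0)) (Suc t)) = c'(k := c' k - 1, Suc k := 0)"
    by (auto simp: c'_def)
  show ?case
    unfolding rec[of c, OF refl] rec[of "c(Suc (Suc k) := 0)", OF e0(1)] e c'_def[symmetric]
      rec[of "c(Suc k := c (Suc k) - 1, Suc (Suc k) := 0)", OF e0(2)] IH shift_sum_diff shift_sum_mult ..
qed

text \<open>Euler's expansion of 1 / (q y; q)_infinity, a purely formal series, since the
  coefficient field carries no topology.\<close>

definition inverse_poch_fps :: "'a fps" where "inverse_poch_fps = Abs_fps (\<lambda>n. u ^ n / qp n)"

text \<open>Cauchy's identity. The sum \<open>\<Phi>\<close> over the first entry satisfies the
  functional equation \<Phi>(u X) = (1 - u X) \<Phi>(X), which determines every coefficient from the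
  constant term 1.\<close>

lemma fermionic_zero: "fermionic (\<lambda>_. 1) (\<lambda>_. 0) = inverse_poch_fps"
proof -
  define \<Phi> where "\<Phi> = shift_sum (\<lambda>a. fps_const (u ^ a\<^sup>2) * tail a)"
  have \<Phi>: "fermionic (\<lambda>_. 1) (\<lambda>_. 0) = \<Phi>"
    by (subst fermionic_rec) (simp add: \<Phi>_def fermionic_iq_zero flip: power_int_of_nat)
  let ?l = "\<lambda>k. 1 - fps_const k * fps_X"
  \<comment> \<open>\<open>S\<close> is the shape in which the q-shift of \<open>\<Phi>\<close> can
    be recognized term by term. The terms of \<open>\<Phi>\<close> and \<open>S\<close> differ by a
    telescoping expression in this \<open>g\<close>, and \<open>g 0 = 0\<close> because
    \<open>1 - u ^ 0 = 0\<close>.\<close>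
  define g where "g a = fps_const (u ^ a\<^sup>2) * (fps_const (1 - u ^ a) * tail a)" for a
  define S where "S = shift_sum (\<lambda>a. fps_const (u ^ (a\<^sup>2)) * (fps_const (u ^ a) * (inverse (?l (u ^ Suc a)) * tail a)))"
  have i: "inverse (?l (u ^ Suc a)) * tail a = fps_const (1 - u ^ Suc a) * tail (Suc a)" for a
  proof -
    have "inverse (?l (u ^ Suc a)) * tail a =
        (fps_const (1 - u ^ Suc a) * tail (Suc a)) * (?l (u ^ Suc a) * inverse (?l (u ^ Suc a)))"
      unfolding tail_Suc[symmetric, of a] by (simp only: mult_ac)
    then show ?thesis unfolding fps_linear_factor mult_1_right .
  qed
  have "\<Phi> - S = shift_sum (\<lambda>a. g a - fps_X * g (Suc a))"
    unfolding \<Phi>_def S_def shift_sum_diff[symmetric]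
  proof (intro arg_cong[of _ _ shift_sum] ext)
    fix a
    let ?t = "inverse (?l (u ^ Suc a)) * tail a"
    have "tail a = (?l (u ^ Suc a) * inverse (?l (u ^ Suc a))) * tail a"
      unfolding fps_linear_factor by (rule mult_1[symmetric])
    also have "\<dots> = ?l (u ^ Suc a) * ?t" by (rule mult.assoc)
    finally have t: "tail a = ?t - fps_const (u ^ Suc a) * fps_X * ?t"
      by (simp only: left_diff_distrib mult_1)
    have p: "u ^ (Suc a)\<^sup>2 = u ^ a\<^sup>2 * u ^ a * u ^ Suc a"
      by (simp add: power2_eq_square algebra_simps flip: power_add)
    have r: "e * tt - e * (v * t) = e * ((1 - v) * tt) - X * (e * v * w * t)" if "tt = t - w * X * t"
      for e t tt v w X :: "'b::comm_ring_1" by (simp add: that algebra_simps)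
    show "fps_const (u ^ a\<^sup>2) * tail a - fps_const (u ^ a\<^sup>2) * (fps_const (u ^ a) * ?t) = g a - fps_X * g (Suc a)"
      using r[OF t, of "fps_const (u ^ a\<^sup>2)" "fps_const (u ^ a)"]
      unfolding g_def p unfolding i[symmetric] unfolding fps_const_mult[symmetric] fps_const_sub[symmetric] fps_const_1_eq_1
      by (simp only: mult.assoc)
  qed
  also have "\<dots> = 0" unfolding shift_sum_telescope by (simp add: g_def)
  finally have "\<Phi> = S" by simp
  have "fps_scale u \<Phi> = shift_sum (\<lambda>a. fps_const (u ^ a) * (fps_const (u ^ a\<^sup>2) * fps_scale u (tail a)))"
    by (simp add: \<Phi>_def fps_scale_shift_sum fps_scale_mult)
  also have "\<dots> = ?l u * S"
    unfolding S_def shift_sum_mult[symmetric]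
  proof (intro arg_cong[of _ _ shift_sum] ext)
    fix a
    have "fps_scale u (tail a) = (?l u * inverse (?l u)) * fps_scale u (tail a)"
      unfolding fps_linear_factor by (rule mult_1[symmetric])
    also have "\<dots> = ?l u * (inverse (?l (u ^ Suc a)) * tail a)"
      unfolding i tail_Suc_scaled by (rule mult.assoc)
    finally have "fps_scale u (tail a) = ?l u * (inverse (?l (u ^ Suc a)) * tail a)" .
    then show "fps_const (u ^ a) * (fps_const (u ^ a\<^sup>2) * fps_scale u (tail a)) =
        ?l u * (fps_const (u ^ a\<^sup>2) * (fps_const (u ^ a) * (inverse (?l (u ^ Suc a)) * tail a)))"
      by (simp only: mult_ac)
  qed
  finally have fe: "fps_scale u \<Phi> = ?l u * \<Phi>" using \<open>\<Phi> = S\<close> by simp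
  have "fps_nth \<Phi> n = u ^ n / qp n" for n
  proof (induction n)
    case 0
    show ?case by (simp add: \<Phi>_def shift_sum_nth)
  next
    case (Suc n)
    have "u ^ Suc n * fps_nth \<Phi> (Suc n) = fps_nth \<Phi> (Suc n) - u * fps_nth \<Phi> n"
      using arg_cong[OF fe, of "\<lambda>f. fps_nth f (Suc n)"] by (simp add: left_diff_distrib mult.assoc)
    then have "(1 - u ^ Suc n) * fps_nth \<Phi> (Suc n) = u * (u ^ n / qp n)"
      unfolding Suc by (simp add: algebra_simps)
    moreover have "1 - u ^ Suc n \<noteq> 0" using u_power_neq_1[of "Suc n"] by simp
    ultimately have "fps_nth \<Phi> (Suc n) = u * (u ^ n / qp n) / (1 - u ^ Suc n)"
      by (metis nonzero_mult_div_cancel_left)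
    then show ?case by (simp add: qp_Suc)
  qed
  then show ?thesis unfolding \<Phi> inverse_poch_fps_def by (intro fps_ext) simp
qed

lemma partition_seqs_bounded:
  assumes "\<And>t. t > k \<Longrightarrow> s t = 0"
  shows "s \<in> partition_seqs n \<longleftrightarrow> (\<forall>t. s (Suc t) \<le> s t) \<and> (\<Sum>t\<le>k. s t) = n"
proof -
  have sub: "{t. s t \<noteq> 0} \<subseteq> {..k}"
  proof
    fix t assume "t \<in> {t. s t \<noteq> 0}"
    then show "t \<in> {..k}" using assms[of t] by (cases "t > k") auto
  qed
  then have "finite {t. s t \<noteq> 0}" by (rule finite_subset) simp
  moreover have "(\<Sum>t | s t \<noteq> 0. s t) = (\<Sum>t\<le>k. s t)"
    using sub by (intro sum.mono_neutral_left) auto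
  ultimately show ?thesis by (simp add: partition_seqs_def)
qed

text \<open>If \<open>1/u\<close> is the order of the residue field of a discrete valuation ring, the coefficients of \<open>p\<close>
  count by length the submodules of a torsion module of type conjugate to \<open>c\<close>, and the symmetry is
  duality. The proof is an induction on \<open>d\<close> by two recursions with visibly symmetric coefficients.\<close>

theorem fermionic_palindromic:
  assumes "c \<in> partition_seqs d"
  shows "\<exists>p. palindromic d p \<and> fermionic (\<lambda>_. 1) (\<lambda>t. int (c t)) = p * inverse_poch_fps"
  using assms
proof (induction d arbitrary: c rule: less_induct)
  case (less d)
  define F where "F e = fermionic (\<lambda>_. 1) e" for e
  have mono: "c (Suc t) \<le> c t" for t using less.prems by (auto simp: partition_seqs_def)
  then have anti: "c t \<le> c s" if "s \<le> t" for s t using that by (rule lift_Suc_antimono_le)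
  show ?case
  proof (cases "d = 0")
    case True
    then show ?thesis using less.prems palindromic_1
      by (intro exI[of _ 1]) (simp add: partition_seqs_0 fermionic_zero)
  next
    case False
    have fin: "finite {t. c t \<noteq> 0}" using less.prems by (auto simp: partition_seqs_def)
    have ne: "{t. c t \<noteq> 0} \<noteq> {}"
    proof
      assume "{t. c t \<noteq> 0} = {}"
      moreover have "(\<Sum>t | c t \<noteq> 0. c t) = d" using less.prems by (simp add: partition_seqs_def)
      ultimately show False using False by (simp only: sum.empty)
    qed
    define k where "k = Max {t. c t \<noteq> 0}"
    have k: "c k \<noteq> 0" using Max_in[OF fin ne] by (simp add: k_def)
    have above: "c t = 0" if "t > k" for t using Max_ge[OF fin, of t] that by (force simp: k_def)
    have d: "(\<Sum>t\<le>k. c t) = d" using partition_seqs_bounded[of k c d, OF above] less.prems by blast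
    have dk: "d = (\<Sum>t<k. c t) + c k" using d by (simp add: lessThan_Suc_atMost[symmetric])
    have red: "F (\<lambda>t. int (c t)) = (1 + fps_X) * F ((\<lambda>t. int (c t))(k := int (c k) - 1)) -
        fps_X * F ((\<lambda>t. int (c t))(k := int (c k) - 2)) +
        fps_X ^ Suc k * (fps_const (u powi (int (Suc k) - (\<Sum>t\<le>k. int (c t)))) *
        F (\<lambda>t. if t \<le> k then int (c t) - 2 else 0))"
      unfolding F_def by (rule fermionic_reduce) (simp add: above)
    consider "c k \<ge> 2" | "c k = 1" "k = 0" | j where "c k = 1" "k = Suc j"
      using k by (cases k; cases "c k \<ge> 2") force+
    then show ?thesis
    proof cases
      case 1
      define c1 where "c1 = c(k := c k - 1)"
      define c2 where "c2 = c(k := c k - 2)"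
      define c3 where "c3 = (\<lambda>t. c t - 2)"
      \<comment> \<open>The entry at \<open>k\<close> is the smallest one up to \<open>k\<close>, so
        2 can be taken from all of them and \<open>c3\<close> is again a partition.\<close>
      have m: "c t \<ge> 2" if "t \<le> k" for t using anti[OF that] 1 by simp
      have s3: "(\<Sum>t\<le>k. c t - 2) + 2 * Suc k = d"
      proof -
        have "(\<Sum>t\<le>k. c t) = (\<Sum>t\<le>k. (c t - 2) + 2)" by (intro sum.cong refl) (metis atMost_iff le_add_diff_inverse2 m)
        also have "\<dots> = (\<Sum>t\<le>k. c t - 2) + (\<Sum>t\<le>k. 2)" by (rule sum.distrib)
        also have "(\<Sum>t\<le>k. 2) = 2 * Suc k" by simp
        finally show ?thesis unfolding d by (rule sym)
      qed
      have dsc: "c1 (Suc t) \<le> c1 t" "c2 (Suc t) \<le> c2 t" "c3 (Suc t) \<le> c3 t" for t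
        using mono[of t] above[of "Suc t"] by (auto simp: c1_def c2_def c3_def)
      have zero: "c1 t = 0" "c2 t = 0" "c3 t = 0" if "t > k" for t
        using above that by (auto simp: c1_def c2_def c3_def)
      have "c1 \<in> partition_seqs (d - 1)"
        using 1 dk by (subst partition_seqs_bounded[where k = k])
          (auto simp: zero dsc, auto simp: c1_def lessThan_Suc_atMost[symmetric])
      from less.IH[OF _ this] obtain p1 where p1: "palindromic (d - 1) p1"
        "F (\<lambda>t. int (c1 t)) = p1 * inverse_poch_fps" using False by (auto simp: F_def)
      have "c2 \<in> partition_seqs (d - 2)"
        using 1 dk by (subst partition_seqs_bounded[where k = k])
          (auto simp: zero dsc, auto simp: c2_def lessThan_Suc_atMost[symmetric])
      from less.IH[OF _ this] obtain p2 where p2: "palindromic (d - 2) p2"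
        "F (\<lambda>t. int (c2 t)) = p2 * inverse_poch_fps" using False by (auto simp: F_def)
      have "c3 \<in> partition_seqs (d - 2 * Suc k)"
        using s3 by (subst partition_seqs_bounded[where k = k]) (auto simp: zero dsc, auto simp: c3_def)
      from less.IH[OF _ this] obtain p3 where p3: "palindromic (d - 2 * Suc k) p3"
        "F (\<lambda>t. int (c3 t)) = p3 * inverse_poch_fps" using False by (auto simp: F_def)
      have e: "(\<lambda>t. int (c t))(k := int (c k) - 1) = (\<lambda>t. int (c1 t))"
        "(\<lambda>t. int (c t))(k := int (c k) - 2) = (\<lambda>t. int (c2 t))"
        "(\<lambda>t. if t \<le> k then int (c t) - 2 else 0) = (\<lambda>t. int (c3 t))"
        using 1 apply (auto simp: c1_def c2_def fun_eq_iff)[2]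
        using m above by (auto simp: c3_def fun_eq_iff)
      have dd: "Suc (d - 1) = d" "d - 2 + 2 * 1 = d" "d - 2 * Suc k + 2 * Suc k = d"
        using 1 dk s3 by linarith+
      let ?p = "(1 + fps_X) * p1 - fps_X ^ 1 * p2 + fps_X ^ Suc k * (fps_const (u powi (int (Suc k) - (\<Sum>t\<le>k. int (c t)))) * p3)"
      have "palindromic d ?p"
        using palindromic_one_plus_X[OF p1(1)] palindromic_X_power[OF p2(1), of 1]
          palindromic_X_power[OF palindromic_const[OF p3(1)], of "Suc k"]
        unfolding dd by (intro palindromic_add palindromic_diff)
      moreover have "F (\<lambda>t. int (c t)) = ?p * inverse_poch_fps"
        unfolding red e p1 p2 p3 by (simp add: algebra_simps)
      ultimately show ?thesis unfolding F_def by blast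
    next
      case 2
      have e: "(\<lambda>t. int (c t))(0 := - 1) = (\<lambda>t. if t = 0 then - 1 else 0)"
        "(\<lambda>t. int (c t))(0 := 0) = (\<lambda>_. 0)"
        using above 2 by (auto simp: fun_eq_iff)
      \<comment> \<open>In \<open>red\<close> the two sums with first entry -1 cancel: the power of
        \<open>u\<close> has exponent 1 - 1 = 0, and the constant weight is unchanged by the
        shift.\<close>
      have "F (\<lambda>t. int (c t)) = (1 + fps_X) * F (\<lambda>_. 0)"
        using red 2 by (simp add: e cong: if_cong)
      moreover have "palindromic d ((1 + fps_X) * 1)"
        using palindromic_one_plus_X[OF palindromic_1] dk 2 by simp
      ultimately show ?thesis unfolding F_def fermionic_zero by (metis mult_1_right)
    next
      case 3
      define c1 where "c1 = c(Suc j := 0)"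
      define c2 where "c2 = c(j := c j - 1, Suc j := 0)"
      have cj: "c j \<ge> 1" using mono[of j] 3 by simp
      have dj: "d = (\<Sum>t<j. c t) + c j + 1" using dk 3 by simp
      have dsc: "c1 (Suc t) \<le> c1 t" "c2 (Suc t) \<le> c2 t" for t
        using mono[of t] above[of "Suc t"] 3 by (auto simp: c1_def c2_def)
      have zero: "c1 t = 0" "c2 t = 0" if "t > j" for t
        using above[of t] that 3 by (auto simp: c1_def c2_def)
      have "c1 \<in> partition_seqs (d - 1)"
        using dj by (subst partition_seqs_bounded[where k = j])
          (auto simp: zero dsc, auto simp: c1_def lessThan_Suc_atMost[symmetric])
      from less.IH[OF _ this] obtain p1 where p1: "palindromic (d - 1) p1"
        "F (\<lambda>t. int (c1 t)) = p1 * inverse_poch_fps" using False by (auto simp: F_def)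
      have "c2 \<in> partition_seqs (d - 2)"
        using dj cj by (subst partition_seqs_bounded[where k = j])
          (auto simp: zero dsc, auto simp: c2_def lessThan_Suc_atMost[symmetric])
      from less.IH[OF _ this] obtain p2 where p2: "palindromic (d - 2) p2"
        "F (\<lambda>t. int (c2 t)) = p2 * inverse_poch_fps" using False by (auto simp: F_def)
      have e: "(\<lambda>t. int (c t))(Suc j := 0) = (\<lambda>t. int (c1 t))"
        "(\<lambda>t. int (c t))(j := int (c j) - 1, Suc j := 0) = (\<lambda>t. int (c2 t))"
        using cj by (auto simp: c1_def c2_def fun_eq_iff)
      have dd: "Suc (d - 1) = d" "d - 2 + 2 * 1 = d" using dj cj by linarith+
      have "F (\<lambda>t. int (c t)) = (1 + fps_X) * F (\<lambda>t. int (c1 t)) - fps_X * F (\<lambda>t. int (c2 t))"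
      proof -
        have 0: "int (c t) = 0" if "t > Suc j" for t using above[of t] that 3(2) by (simp only:)
        have 1: "int (c (Suc j)) = 1" using 3 by (simp only: of_nat_1)
        show ?thesis using fermionic_reduce_one[of j "\<lambda>t. int (c t)" "\<lambda>_. 1", OF 0 1] unfolding e F_def .
      qed
      then have "F (\<lambda>t. int (c t)) = ((1 + fps_X) * p1 - fps_X ^ 1 * p2) * inverse_poch_fps"
        unfolding p1 p2 power_one_right left_diff_distrib mult.assoc .
      moreover have "palindromic d ((1 + fps_X) * p1 - fps_X ^ 1 * p2)"
        using palindromic_one_plus_X[OF p1(1)] palindromic_X_power[OF p2(1), of 1]
        unfolding dd by (intro palindromic_diff)
      ultimately show ?thesis unfolding F_def by blast
    qed
  qed
qed

end

section \<open>Splitting off one sequence\<close>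

lemma seq_supp_case_nat: "seq_supp (case_nat 0 s) = Suc ` {t. s t \<noteq> 0}"
proof (rule set_eqI)
  fix x show "x \<in> seq_supp (case_nat 0 s) \<longleftrightarrow> x \<in> Suc ` {t. s t \<noteq> 0}"
    by (cases x) (auto simp: seq_supp_def)
qed

lemma case_nat_shift: "f 0 = 0 \<Longrightarrow> case_nat 0 (\<lambda>t. f (Suc t)) = f"
  by (rule ext) (simp split: nat.splits)

text \<open>\<open>case_nat 0\<close> is the index shift between sequences that start at 1, extended
  by 0 at index 0, and the sequences of \<open>partition_seqs\<close>, which start at 0.\<close>

lemma descending_tuples_iff:
  "r \<in> descending_tuples l \<and> (\<forall>i\<in>{1..l}. weight r i = n i) \<longleftrightarrow>
   (\<forall>i. if i \<in> {1..l} then r i \<in> case_nat 0 ` partition_seqs (n i) else r i = (\<lambda>_. 0))"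
  (is "?L \<longleftrightarrow> ?R")
proof
  assume L: ?L
  show ?R
  proof (intro allI)
    fix i
    show "if i \<in> {1..l} then r i \<in> case_nat 0 ` partition_seqs (n i) else r i = (\<lambda>_. 0)"
    proof (cases "i \<in> {1..l}")
      case True
      define s where "s = (\<lambda>t. r i (Suc t))"
      have r0: "r i 0 = 0" using L by (auto simp: descending_tuples_def)
      have rs: "r i = case_nat 0 s" unfolding s_def by (rule case_nat_shift[symmetric]) (rule r0)
      have d: "r i (t + 1) \<le> r i t" if "t \<ge> 1" for t
        using L True that unfolding descending_tuples_def by blast
      have "s (Suc t) \<le> s t" for t using d[of "Suc t"] by (simp add: s_def)
      moreover have fin: "finite {t. s t \<noteq> 0}"
      proof -
        have "finite {t. r i t \<noteq> 0}" using L True by (auto simp: descending_tuples_def)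
        moreover have "Suc ` {t. s t \<noteq> 0} \<subseteq> {t. r i t \<noteq> 0}" by (auto simp: s_def)
        ultimately show ?thesis by (meson finite_imageD finite_subset inj_Suc)
      qed
      moreover have "(\<Sum>t | s t \<noteq> 0. s t) = n i"
      proof -
        have "n i = weight r i" using L True by simp
        also have "\<dots> = (\<Sum>t\<in>Suc ` {t. s t \<noteq> 0}. case_nat 0 s t)"
          unfolding weight_def rs seq_supp_case_nat ..
        also have "\<dots> = (\<Sum>t | s t \<noteq> 0. s t)" by (simp add: sum.reindex)
        finally show ?thesis by simp
      qed
      ultimately have "s \<in> partition_seqs (n i)" by (simp add: partition_seqs_def)
      then show ?thesis using True rs by auto
    next
      case False
      then show ?thesis using L by (auto simp: descending_tuples_def)
    qed
  qed
next
  assume R: ?R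
  have z: "r i t = 0" if "i \<notin> {1..l}" for i t using R[rule_format, of i] that by auto
  have s: "\<exists>s. s \<in> partition_seqs (n i) \<and> r i = case_nat 0 s" if "i \<in> {1..l}" for i
    using R[rule_format, of i] that by auto
  have "r i 0 = 0" for i using z[of i] s[of i] by (cases "i \<in> {1..l}") force+
  moreover have "r i (t + 1) \<le> r i t" if "i \<in> {1..l}" "t \<ge> 1" for i t
    using s[OF that(1)] that(2) by (cases t) (auto simp: partition_seqs_def)
  moreover have "finite {t. r i t \<noteq> 0}" "weight r i = n i" if "i \<in> {1..l}" for i
  proof -
    obtain s where s: "s \<in> partition_seqs (n i)" "r i = case_nat 0 s" using s[OF \<open>i \<in> {1..l}\<close>] by blast
    have "{t. r i t \<noteq> 0} \<subseteq> seq_supp (r i)" unfolding seq_supp_def s(2) by (auto split: nat.splits)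
    moreover have "finite (seq_supp (r i))" unfolding s(2) seq_supp_case_nat using s(1) by (auto simp: partition_seqs_def)
    ultimately show "finite {t. r i t \<noteq> 0}" by (rule finite_subset)
    have "weight r i = (\<Sum>t | s t \<noteq> 0. s t)"
      unfolding weight_def s(2) seq_supp_case_nat by (simp add: sum.reindex)
    then show "weight r i = n i" using s(1) by (simp add: partition_seqs_def)
  qed
  ultimately show ?L using z by (auto simp: descending_tuples_def)
qed

definition tuples :: "nat \<Rightarrow> (nat \<Rightarrow> nat) \<Rightarrow> (nat \<Rightarrow> nat \<Rightarrow> nat) set" where
  "tuples l n = {r \<in> descending_tuples l. \<forall>i\<in>{1..l}. weight r i = n i}"

lemma tuples_iff:
  "r \<in> tuples l n \<longleftrightarrow>
    (\<forall>i. if i \<in> {1..l} then r i \<in> case_nat 0 ` partition_seqs (n i) else r i = (\<lambda>_. 0))"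
  unfolding tuples_def mem_Collect_eq by (rule descending_tuples_iff)

lemma tuplesD:
  assumes "r \<in> tuples l n"
  shows "i \<in> {1..l} \<Longrightarrow> r i \<in> case_nat 0 ` partition_seqs (n i)" "i \<notin> {1..l} \<Longrightarrow> r i = (\<lambda>_. 0)"
  using assms[unfolded tuples_iff, rule_format, of i] by (simp_all only: if_True if_False simp_thms)

lemma finite_tuples: "finite (tuples l n)"
proof (rule finite_subset)
  let ?B = "\<Union>i\<in>{1..l}. case_nat 0 ` partition_seqs (n i)"
  show "tuples l n \<subseteq> {r. \<forall>i. (i \<in> {1..l} \<longrightarrow> r i \<in> ?B) \<and> (i \<notin> {1..l} \<longrightarrow> r i = (\<lambda>_. 0))}"
  proof
    fix r assume "r \<in> tuples l n"
    note r = tuplesD[OF this]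
    show "r \<in> {r. \<forall>i. (i \<in> {1..l} \<longrightarrow> r i \<in> ?B) \<and> (i \<notin> {1..l} \<longrightarrow> r i = (\<lambda>_. 0))}"
    proof (intro CollectI allI conjI impI)
      fix i assume i: "i \<in> {1..l}"
      show "r i \<in> ?B" using i r(1)[OF i] by blast
    qed (rule r(2))
  qed
  show "finite {r. \<forall>i. (i \<in> {1..l} \<longrightarrow> r i \<in> ?B) \<and> (i \<notin> {1..l} \<longrightarrow> r i = (\<lambda>_. 0))}"
    by (rule finite_set_of_finite_funs) (auto simp: finite_partition_seqs)
qed

lemma sum_tuples_split:
  assumes i: "i \<in> {1..l}"
  shows "(\<Sum>r\<in>tuples l n. h r) =
    (\<Sum>r\<in>tuples l (n(i := 0)). \<Sum>s\<in>partition_seqs (n i). h (r(i := case_nat 0 s)))"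
proof -
  have z: "r i = (\<lambda>_. 0)" if "r \<in> tuples l (n(i := 0))" for r
  proof -
    have "r i \<in> case_nat 0 ` {\<lambda>_. 0}"
      using tuplesD(1)[OF that i] by (simp add: partition_seqs_0)
    then show ?thesis by (auto split: nat.splits)
  qed
  have "(\<Sum>r\<in>tuples l (n(i := 0)). \<Sum>s\<in>partition_seqs (n i). h (r(i := case_nat 0 s))) =
    (\<Sum>(r, s)\<in>tuples l (n(i := 0)) \<times> partition_seqs (n i). h (r(i := case_nat 0 s)))"
    by (rule sum.cartesian_product)
  also have "\<dots> = (\<Sum>r\<in>tuples l n. h r)"
  proof (rule sum.reindex_bij_witness[where j = "\<lambda>(r, s). r(i := case_nat 0 s)"
        and i = "\<lambda>r. (r(i := (\<lambda>_. 0)), \<lambda>t. r i (Suc t))"], goal_cases)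
    case (1 a)
    then show ?case using z by (auto simp: fun_upd_idem)
  next
    case (2 a)
    then show ?case using i unfolding tuples_iff split_beta mem_Times_iff
      by (auto split: if_splits simp: fun_upd_def)
  next
    case (3 r)
    have "r i 0 = 0" using 3 unfolding tuples_iff by (auto dest!: spec[of _ i] split: if_splits)
    then have "case_nat 0 (\<lambda>t. r i (Suc t)) = r i" by (rule case_nat_shift)
    then show ?case by simp
  next
    case (4 r)
    have "r i \<in> case_nat 0 ` partition_seqs (n i)" using 4 i by (rule tuplesD)
    then have "(\<lambda>t. r i (Suc t)) \<in> partition_seqs (n i)" by auto
    moreover have "r(i := (\<lambda>_. 0)) \<in> tuples l (n(i := 0))"
    proof -
      have "(\<lambda>_. 0) = case_nat 0 (\<lambda>_. 0 :: nat)" by (rule ext) (simp split: nat.splits)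
      then have "(\<lambda>_. 0) \<in> case_nat 0 ` partition_seqs 0" unfolding partition_seqs_0 by blast
      then show ?thesis using 4 unfolding tuples_iff by simp
    qed
    ultimately show ?case by simp
  qed auto
  finally show ?thesis by simp
qed

text \<open>The numbers \<open>m * Suc t - p\<close> with \<open>p < m\<close> fill the block of
  \<open>Suc x\<close> with \<open>x div m = t\<close>. This is how the rows of a vertex that meet a
  given row of its parent are regrouped.\<close>

lemma sum_blocks:
  fixes g :: "nat \<Rightarrow> nat \<Rightarrow> 'b::comm_monoid_add"
  assumes "m \<ge> 1"
  shows "(\<Sum>t<N. \<Sum>p<m. g t (m * Suc t - p)) = (\<Sum>x<N * m. g (x div m) (Suc x))"
proof -
  have "(\<Sum>p<m. g t (m * Suc t - p)) = (\<Sum>x\<in>{t * m..<t * m + m}. g (x div m) (Suc x))" for t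
  proof (rule sum.reindex_bij_witness[where i = "\<lambda>x. m * Suc t - Suc x" and j = "\<lambda>p. m * Suc t - Suc p"])
    fix p assume p: "p \<in> {..<m}"
    then have e: "m * Suc t - Suc p = t * m + (m - Suc p)" by (simp add: mult.commute)
    show "m * Suc t - Suc (m * Suc t - Suc p) = p" using p by (simp add: e mult.commute)
    show "m * Suc t - Suc p \<in> {t * m..<t * m + m}" using p unfolding e by auto
    have "(t * m + (m - Suc p)) div m = t" using p by (subst div_mult_self3) auto
    moreover have "Suc (m * Suc t - Suc p) = m * Suc t - p" using p unfolding e by (simp add: mult.commute)
    ultimately show "g ((m * Suc t - Suc p) div m) (Suc (m * Suc t - Suc p)) = g t (m * Suc t - p)"
      by (simp only: e)
  next
    fix x assume x: "x \<in> {t * m..<t * m + m}"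
    then show "m * Suc t - Suc x \<in> {..<m}" "m * Suc t - Suc (m * Suc t - Suc x) = x"
      by (auto simp: mult.commute)
  qed
  then show ?thesis by (simp add: sum.nat_group)
qed

lemma sum_support:
  fixes f :: "nat \<Rightarrow> 'b::comm_monoid_add" and s :: "nat \<Rightarrow> nat"
  assumes "\<And>t. s t = 0 \<Longrightarrow> f t = 0" "\<And>t. t \<ge> N \<Longrightarrow> s t = 0"
  shows "(\<Sum>t | s t \<noteq> 0. f t) = (\<Sum>t<N. f t)"
proof (rule sum.mono_neutral_left)
  show "{t. s t \<noteq> 0} \<subseteq> {..<N}"
  proof
    fix t assume "t \<in> {t. s t \<noteq> 0}"
    then show "t \<in> {..<N}" using assms(2)[of t] by (cases "t \<ge> N") auto
  qed
qed (use assms(1) in auto)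

lemma finite_support_bound:
  fixes s :: "nat \<Rightarrow> nat"
  assumes "finite {t. s t \<noteq> 0}"
  obtains N where "\<And>t. t \<ge> N \<Longrightarrow> s t = 0"
proof -
  obtain N where "\<forall>t\<in>{t. s t \<noteq> 0}. t < N" using finite_nat_set_iff_bounded[THEN iffD1, OF assms] ..
  then have "s t = 0" if "t \<ge> N" for t using that by (meson leD mem_Collect_eq)
  then show ?thesis by (rule that)
qed

section \<open>The sum over a rooted tree: vertex \<open>i\<close> hangs below \<open>pr i\<close>
  by an edge of multiplicity \<open>m i\<close>\<close>

locale dynkin_sum = generic_q u for u :: "'a::field" +
  fixes l :: nat and pr m :: "nat \<Rightarrow> nat"
  assumes pr: "i \<in> {2..l} \<Longrightarrow> 1 \<le> pr i \<and> pr i < i" and m: "i \<in> {2..l} \<Longrightarrow> m i \<ge> 1"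
begin

definition children :: "nat \<Rightarrow> nat set" where "children i = {j \<in> {2..l}. pr j = i}"

lemma finite_children [simp]: "finite (children i)" by (simp add: children_def)

definition tuple_weight :: "(nat \<Rightarrow> nat \<Rightarrow> nat) \<Rightarrow> 'a" where
  "tuple_weight r = u powi (q_exponent l pr m r) /
     (\<Prod>i=1..l. \<Prod>j\<in>seq_supp (r i). qp (r i j - r i (j + 1)))"

definition sum_coeff :: "(nat \<Rightarrow> nat) \<Rightarrow> 'a" where
  "sum_coeff n = (\<Sum>r\<in>tuples l n. tuple_weight r)"

text \<open>The total contribution of the neighbours of \<open>i\<close> to the linear term of the exponent in \<open>r\<^sub>i\<close>.\<close>

definition neighbours :: "nat \<Rightarrow> (nat \<Rightarrow> nat \<Rightarrow> nat) \<Rightarrow> nat \<Rightarrow> nat" where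
  "neighbours i r t = (\<Sum>j\<in>children i. \<Sum>p<m j. r j (m j * Suc t - p)) +
     (if 2 \<le> i then r (pr i) (Suc (t div m i)) else 0)"

text \<open>The simple reflection at \<open>i\<close> replaces the coefficient \<open>n i\<close> by
  \<open>reflection_degree i n - n i\<close>; for the diagrams at hand this is justified by
  \<open>sum_cartan_int\<close>.\<close>

definition reflection_degree :: "nat \<Rightarrow> (nat \<Rightarrow> nat) \<Rightarrow> nat" where
  "reflection_degree i n = (\<Sum>j\<in>children i. n j) + (if 2 \<le> i then m i * n (pr i) else 0)"

lemma reflection_degree_upd [simp]: "i \<in> {1..l} \<Longrightarrow> reflection_degree i (n(i := x)) = reflection_degree i n"
proof -
  assume i: "i \<in> {1..l}"
  have "(n(i := x)) j = n j" if "j \<in> children i" for j using that pr[of j] by (auto simp: children_def)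
  then have "(\<Sum>j\<in>children i. (n(i := x)) j) = (\<Sum>j\<in>children i. n j)" by (rule sum.cong[OF refl])
  moreover have "(n(i := x)) (pr i) = n (pr i)" if "2 \<le> i" using that i pr[of i] by simp
  ultimately show ?thesis by (simp add: reflection_degree_def)
qed

lemma tuples_seq:
  assumes "r \<in> tuples l n" "i \<in> {1..l}"
  shows "(\<lambda>t. r i (Suc t)) \<in> partition_seqs (n i)" "r i 0 = 0"
proof -
  have "r i \<in> case_nat 0 ` partition_seqs (n i)" using assms by (rule tuplesD)
  then show "(\<lambda>t. r i (Suc t)) \<in> partition_seqs (n i)" "r i 0 = 0" by auto
qed

lemma tuples_antimono:
  assumes "r \<in> tuples l n" "i \<in> {1..l}" "1 \<le> a" "a \<le> b"
  shows "r i b \<le> r i a"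
proof -
  have d: "r i (Suc (Suc t)) \<le> r i (Suc t)" for t
    using tuples_seq(1)[OF assms(1,2)] by (auto simp: partition_seqs_def)
  obtain a' b' where "a = Suc a'" "b = Suc b'" using assms(3,4) by (cases a; cases b) auto
  then show ?thesis using lift_Suc_antimono_le[of "\<lambda>t. r i (Suc t)", OF d, of a' b'] assms(4) by simp
qed

text \<open>A child \<open>j\<close> contributes sums over blocks of \<open>m j\<close> consecutive
  rows, of total \<open>n j\<close>; the parent contributes each of its rows \<open>m i\<close>
  times, of total \<open>m i * n (pr i)\<close>. Both contributions are decreasing.\<close>

lemma neighbours_partition:
  assumes r: "r \<in> tuples l n" and i: "i \<in> {1..l}"
  shows "neighbours i r \<in> partition_seqs (reflection_degree i n)"
proof -
  have ch: "j \<in> {1..l}" "m j \<ge> 1" if "j \<in> children i" for j using that m[of j] by (auto simp: children_def)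
  have pi: "pr i \<in> {1..l}" "m i \<ge> 1" if "2 \<le> i" using that i pr[of i] m[of i] by auto
  have mono: "neighbours i r (Suc t) \<le> neighbours i r t" for t
    unfolding neighbours_def
  proof (intro add_mono sum_mono)
    fix j p assume j: "j \<in> children i" and p: "p \<in> {..<m j}"
    show "r j (m j * Suc (Suc t) - p) \<le> r j (m j * Suc t - p)"
      using p by (intro tuples_antimono[OF r ch(1)[OF j]]) (auto intro!: diff_le_mono)
  next
    show "(if 2 \<le> i then r (pr i) (Suc (Suc t div m i)) else 0) \<le> (if 2 \<le> i then r (pr i) (Suc (t div m i)) else 0)"
      using tuples_antimono[OF r pi(1), of "Suc (t div m i)" "Suc (Suc t div m i)"] by (auto intro: div_le_mono)
  qed
  have "\<exists>N. \<forall>j\<in>{1..l}. \<forall>t\<ge>N. r j (Suc t) = 0"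
  proof -
    have "\<exists>N. \<forall>t\<ge>N. r j (Suc t) = 0" if "j \<in> {1..l}" for j
    proof -
      have "finite {t. r j (Suc t) \<noteq> 0}"
        using tuples_seq(1)[OF r that] by (auto simp: partition_seqs_def)
      then obtain N where "\<And>t. t \<ge> N \<Longrightarrow> r j (Suc t) = 0" by (rule finite_support_bound) blast
      then show ?thesis by blast
    qed
    then have "\<forall>j\<in>{1..l}. \<exists>N. \<forall>t\<ge>N. r j (Suc t) = 0" by blast
    then obtain N where N: "\<And>j t. j \<in> {1..l} \<Longrightarrow> t \<ge> N j \<Longrightarrow> r j (Suc t) = 0"
      unfolding bchoice_iff by blast
    have "N j \<le> (\<Sum>j\<in>{1..l}. N j)" if "j \<in> {1..l}" for j
      using that by (intro member_le_sum) auto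
    then show ?thesis using N by (intro exI[of _ "\<Sum>j\<in>{1..l}. N j"]) (blast intro: order_trans)
  qed
  then obtain N where N: "\<And>j t. j \<in> {1..l} \<Longrightarrow> t \<ge> N \<Longrightarrow> r j (Suc t) = 0" by blast
  have N': "r j t = 0" if "j \<in> {1..l}" "t > N" for j t
    using N[OF that(1), of "t - 1"] that(2) by simp
  have tot: "(\<Sum>t<M. r j (Suc t)) = n j" if "j \<in> {1..l}" "M \<ge> N" for j M
  proof -
    have "(\<Sum>t | r j (Suc t) \<noteq> 0. r j (Suc t)) = (\<Sum>t<M. r j (Suc t))"
      by (rule sum_support) (use N[OF that(1)] that(2) in auto)
    then show ?thesis using tuples_seq(1)[OF r that(1)] by (simp add: partition_seqs_def)
  qed
  \<comment> \<open>The factor \<open>Suc (m i)\<close> guarantees that for \<open>t \<ge> L\<close>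
    the index \<open>t div m i\<close> of the parent row has passed \<open>N\<close> as
    well.\<close>
  define L where "L = Suc N * Suc (m i)"
  have L: "L > N" "i \<ge> 2 \<Longrightarrow> t \<ge> L \<Longrightarrow> t div m i \<ge> N" for t
  proof -
    show "L > N" by (simp add: L_def)
    assume "i \<ge> 2" "t \<ge> L"
    then have "N * m i \<le> t" by (simp add: L_def)
    then show "t div m i \<ge> N" using pi[OF \<open>i \<ge> 2\<close>] by (simp add: less_eq_div_iff_mult_less_eq)
  qed
  have van: "neighbours i r t = 0" if "t \<ge> L" for t
  proof -
    have "r j (m j * Suc t - p) = 0" if "j \<in> children i" "p < m j" for j p
    proof (rule N')
      show "j \<in> {1..l}" using ch that by simp
      have "m j * Suc t - p \<ge> Suc (m j * t)" using that by simp
      moreover have "m j * t \<ge> t" using ch[OF that(1)] by simp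
      ultimately show "m j * Suc t - p > N" using \<open>t \<ge> L\<close> L(1) by linarith
    qed
    moreover have "r (pr i) (Suc (t div m i)) = 0" if "2 \<le> i"
      using N[OF pi(1)[OF that] L(2)[OF that \<open>t \<ge> L\<close>]] .
    ultimately show ?thesis by (simp add: neighbours_def)
  qed
  \<comment> \<open>The bound is a multiple of \<open>m i\<close>, so that the parent rows fill
    complete blocks of length \<open>m i\<close>.\<close>
  have A: "(\<Sum>t<Suc N * m i * Suc (m i). neighbours i r t) = reflection_degree i n" if "2 \<le> i"
  proof -
    let ?L = "Suc N * Suc (m i) * m i"
    have "(\<Sum>t<?L. \<Sum>p<m j. r j (m j * Suc t - p)) = n j" if "j \<in> children i" for j
    proof -
      have "(\<Sum>t<?L. \<Sum>p<m j. r j (m j * Suc t - p)) = (\<Sum>x<?L * m j. r j (Suc x))"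
        by (rule sum_blocks) (use ch that in auto)
      also have "\<dots> = n j"
      proof (rule tot)
        have "Suc N * 1 * 1 * 1 \<le> ?L * m j" using ch(2)[OF that] pi(2)[OF \<open>2 \<le> i\<close>]
          by (intro mult_mono) auto
        then show "?L * m j \<ge> N" by simp
      qed (use ch that in auto)
      finally show ?thesis .
    qed
    moreover have "(\<Sum>t<?L. r (pr i) (Suc (t div m i))) = m i * n (pr i)"
    proof -
      have "(\<Sum>t<Suc N * Suc (m i). \<Sum>p<m i. r (pr i) (Suc t)) = (\<Sum>t<?L. r (pr i) (Suc (t div m i)))"
        by (rule sum_blocks[where g = "\<lambda>t _. r (pr i) (Suc t)"]) (rule pi(2)[OF that])
      moreover have "(\<Sum>t<Suc N * Suc (m i). \<Sum>p<m i. r (pr i) (Suc t)) = m i * (\<Sum>t<Suc N * Suc (m i). r (pr i) (Suc t))"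
        by (simp only: sum_constant card_lessThan sum_distrib_left of_nat_id)
      moreover have "(\<Sum>t<Suc N * Suc (m i). r (pr i) (Suc t)) = n (pr i)"
        by (rule tot) (use pi(1)[OF that] in auto)
      ultimately show ?thesis by (simp only:)
    qed
    ultimately have "(\<Sum>t<?L. neighbours i r t) = reflection_degree i n"
      using that unfolding neighbours_def sum.distrib sum.swap[of _ "children i"] reflection_degree_def by simp
    then show ?thesis by (simp only: mult_ac)
  qed
  have B: "(\<Sum>t<L. neighbours i r t) = reflection_degree i n" if "\<not> 2 \<le> i"
  proof -
    have "(\<Sum>t<L. \<Sum>p<m j. r j (m j * Suc t - p)) = n j" if "j \<in> children i" for j
    proof -
      have "(\<Sum>t<L. \<Sum>p<m j. r j (m j * Suc t - p)) = (\<Sum>x<L * m j. r j (Suc x))"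
        by (rule sum_blocks) (use ch that in auto)
      also have "\<dots> = n j"
      proof (rule tot)
        have "L * 1 \<le> L * m j" using ch(2)[OF that] by (intro mult_mono) auto
        then show "L * m j \<ge> N" using L(1) by linarith
      qed (use ch that in auto)
      finally show ?thesis .
    qed
    then show ?thesis using that
      unfolding neighbours_def sum.distrib sum.swap[of _ "children i"] reflection_degree_def by simp
  qed
  have S: "(\<Sum>t | neighbours i r t \<noteq> 0. neighbours i r t) = (\<Sum>t<M. neighbours i r t)" if "M \<ge> L" for M
    by (rule sum_support) (use van that in auto)
  have "(\<Sum>t | neighbours i r t \<noteq> 0. neighbours i r t) = reflection_degree i n"
  proof (cases "2 \<le> i")
    case True
    have "Suc N * 1 * Suc (m i) \<le> Suc N * m i * Suc (m i)"
      using pi[OF True] by (intro mult_le_mono) auto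
    then have "L \<le> Suc N * m i * Suc (m i)" by (simp only: L_def mult_1_right)
    from S[OF this] show ?thesis unfolding A[OF True] .
  next
    case False
    from S[OF order_refl] show ?thesis unfolding B[OF False] .
  qed
  moreover have "finite {t. neighbours i r t \<noteq> 0}"
  proof (rule finite_subset)
    show "{t. neighbours i r t \<noteq> 0} \<subseteq> {..<L}"
    proof
      fix t assume "t \<in> {t. neighbours i r t \<noteq> 0}"
      then show "t \<in> {..<L}" using van[of t] by (cases "t \<ge> L") auto
    qed
  qed simp
  ultimately show ?thesis using mono by (simp add: partition_seqs_def)
qed

text \<open>The sequence at \<open>i\<close> enters the exponent through its own squares and,
  linearly, through the edges to the parent and to the children of \<open>i\<close>. Collecting the
  linear terms gives \<open>neighbours i r\<close>.\<close>

lemma tuple_weight_split: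
  assumes r: "r \<in> tuples l (n(i := 0))" and i: "i \<in> {1..l}" and s: "s \<in> partition_seqs k"
  shows "tuple_weight (r(i := case_nat 0 s)) = tuple_weight r * seq_weight (\<lambda>t. int (neighbours i r t)) s"
proof -
  define s' where "s' = case_nat 0 s"
  define r' where "r' = r(i := s')"
  have r'_simps: "r' i = s'" "\<And>j. j \<noteq> i \<Longrightarrow> r' j = r j" by (auto simp: r'_def)
  have ri: "r i = (\<lambda>_. 0)"
  proof -
    have "(\<lambda>t. r i (Suc t)) \<in> partition_seqs 0" "r i 0 = 0" using tuples_seq[OF r i] by auto
    then have "\<And>t. r i (Suc t) = 0" "r i 0 = 0" by (auto simp: partition_seqs_0 fun_eq_iff)
    then have "r i t = 0" for t by (cases t) auto
    then show ?thesis by (rule ext)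
  qed
  have supp_i: "seq_supp (r i) = {}" by (simp add: ri seq_supp_def)
  have supp_s: "seq_supp s' = Suc ` {t. s t \<noteq> 0}" unfolding s'_def by (rule seq_supp_case_nat)
  have fin: "finite {t. s t \<noteq> 0}" using s by (auto simp: partition_seqs_def)
  have pri: "pr j \<noteq> j" if "j \<in> {2..l}" for j using pr[OF that] by auto
  let ?X = "\<lambda>r j. \<Sum>t\<in>seq_supp (r (pr j)). \<Sum>p<m j. int (r (pr j) t) * int (r j (m j * t - p))"
  let ?Y = "\<Sum>t | s t \<noteq> 0. int (r (pr i) (Suc (t div m i))) * int (s t)"
  let ?Z = "\<lambda>j. \<Sum>t | s t \<noteq> 0. (\<Sum>p<m j. int (r j (m j * Suc t - p))) * int (s t)"
  \<comment> \<open>The correction \<open>?Y\<close> belongs to the edge from \<open>i\<close> to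
    its parent, and \<open>?Z j\<close> to the edge from a child \<open>j\<close> to
    \<open>i\<close>.\<close>
  have X: "?X r' j = ?X r j + (if j = i then ?Y else 0) + (if pr j = i then ?Z j else 0)" if j: "j \<in> {2..l}" for j
  proof -
    consider "j = i" | "pr j = i" "j \<noteq> i" | "j \<noteq> i" "pr j \<noteq> i" by blast
    then show ?thesis
    proof cases
      case 1
      have p: "pr i \<noteq> i" "pr i \<in> {1..l}" "m i \<ge> 1" using pri[OF j] pr[OF j] m[OF j] j 1 by auto
      define c where "c = (\<lambda>t. r (pr i) (Suc t))"
      have rc: "r (pr i) = case_nat 0 c" unfolding c_def
        by (rule case_nat_shift[symmetric]) (rule tuples_seq(2)[OF r p(2)])
      have "finite {t. c t \<noteq> 0}"
        using tuples_seq(1)[OF r p(2)] by (auto simp: partition_seqs_def c_def)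
      then obtain N where N: "\<And>t. t \<ge> N \<Longrightarrow> c t = 0" by (rule finite_support_bound) blast
      obtain N2 where N2: "\<And>t. t \<ge> N2 \<Longrightarrow> s t = 0" by (rule finite_support_bound[OF fin]) blast
      define M where "M = N + N2"
      have "?X r' j = (\<Sum>t | c t \<noteq> 0. \<Sum>p<m i. int (c t) * int (s' (m i * Suc t - p)))"
        unfolding 1 r'_simps r'_simps(2)[OF p(1)] rc seq_supp_case_nat
        by (subst sum.reindex) simp_all
      also have "\<dots> = (\<Sum>t<M. \<Sum>p<m i. int (c t) * int (s' (m i * Suc t - p)))"
        by (rule sum_support) (use N in \<open>auto simp: M_def\<close>)
      \<comment> \<open>The sum over rows of the parent becomes one over rows of \<open>i\<close>,
        each of which meets the single parent row \<open>x div m i\<close>.\<close>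
      also have "\<dots> = (\<Sum>x<M * m i. int (c (x div m i)) * int (s' (Suc x)))"
        by (rule sum_blocks[where g = "\<lambda>t x. int (c t) * int (s' x)"]) (rule p(3))
      also have "\<dots> = (\<Sum>x<M * m i. int (r (pr i) (Suc (x div m i))) * int (s x))"
        by (simp add: c_def s'_def)
      also have "\<dots> = ?Y"
      proof (rule sum_support[symmetric])
        have "M \<le> M * m i" using p(3) by simp
        moreover have "N2 \<le> M" by (simp add: M_def)
        ultimately have "N2 \<le> M * m i" by (rule order_trans[rotated])
        then show "s t = 0" if "t \<ge> M * m i" for t using that by (intro N2) (rule order_trans)
      qed simp
      finally have "?X r' j = ?Y" .
      moreover have "?X r j = 0" unfolding 1 ri by simp
      ultimately show ?thesis using 1 p(1) by simp
    next
      case 2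
      have "?X r' j = (\<Sum>t | s t \<noteq> 0. \<Sum>p<m j. int (s t) * int (r j (m j * Suc t - p)))"
        unfolding 2(1) r'_simps(1) r'_simps(2)[OF 2(2)] supp_s by (subst sum.reindex) (simp_all add: s'_def)
      also have "\<dots> = ?Z j"
        unfolding sum_distrib_right by (intro sum.cong refl mult.commute)
      finally show ?thesis using 2 by (simp add: supp_i)
    next
      case 3
      then show ?thesis by (simp add: r'_simps(2))
    qed
  qed
  have "(\<Sum>j=2..l. ?X r' j) = (\<Sum>j=2..l. ?X r j + (if j = i then ?Y else 0) + (if pr j = i then ?Z j else 0))"
    by (rule sum.cong[OF refl]) (rule X)
  also have "\<dots> = (\<Sum>j=2..l. ?X r j) + ((if i \<in> {2..l} then ?Y else 0) + (\<Sum>j\<in>children i. ?Z j))"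
    unfolding sum.distrib children_def sum.inter_filter[OF finite_atLeastAtMost] sum.delta[OF finite_atLeastAtMost]
    by (rule add.assoc)
  also have "(if i \<in> {2..l} then ?Y else 0) + (\<Sum>j\<in>children i. ?Z j) = (\<Sum>t | s t \<noteq> 0. int (neighbours i r t) * int (s t))"
  proof -
    have "(\<Sum>t | s t \<noteq> 0. int (neighbours i r t) * int (s t)) =
       (\<Sum>t | s t \<noteq> 0. (\<Sum>j\<in>children i. (\<Sum>p<m j. int (r j (m j * Suc t - p))) * int (s t)) +
          (if 2 \<le> i then int (r (pr i) (Suc (t div m i))) * int (s t) else 0))"
      by (intro sum.cong refl) (simp add: neighbours_def distrib_right sum_distrib_right)
    also have "\<dots> = (\<Sum>j\<in>children i. ?Z j) + (if i \<in> {2..l} then ?Y else 0)"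
      using i unfolding sum.distrib sum.swap[of _ "children i"] by simp
    finally show ?thesis by simp
  qed
  finally have cross: "(\<Sum>j=2..l. ?X r' j) = (\<Sum>j=2..l. ?X r j) + (\<Sum>t | s t \<noteq> 0. int (neighbours i r t) * int (s t))" .
  have split: "(\<Sum>j=1..l. f (r' j)) = (\<Sum>j=1..l. f (r j)) + f s'" if "f (r i) = 0" for f :: "(nat \<Rightarrow> nat) \<Rightarrow> int"
  proof -
    have "(\<Sum>j=1..l. f (r' j)) = f s' + (\<Sum>j\<in>{1..l} - {i}. f (r j))"
      by (subst sum.remove[OF _ i]) (simp_all add: r'_simps)
    moreover have "(\<Sum>j=1..l. f (r j)) = (\<Sum>j\<in>{1..l} - {i}. f (r j))"
      by (subst sum.remove[OF _ i]) (simp_all add: that)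
    ultimately show ?thesis by simp
  qed
  have splitp: "(\<Prod>j=1..l. f (r' j)) = (\<Prod>j=1..l. f (r j)) * f s'" if "f (r i) = 1" for f :: "(nat \<Rightarrow> nat) \<Rightarrow> 'a"
  proof -
    have "(\<Prod>j=1..l. f (r' j)) = f s' * (\<Prod>j\<in>{1..l} - {i}. f (r j))"
      by (subst prod.remove[OF _ i]) (simp_all add: r'_simps)
    moreover have "(\<Prod>j=1..l. f (r j)) = (\<Prod>j\<in>{1..l} - {i}. f (r j))"
      by (subst prod.remove[OF _ i]) (simp_all add: that)
    ultimately show ?thesis by simp
  qed
  have sq: "(\<Sum>j=1..l. \<Sum>t\<in>seq_supp (r' j). (int (r' j t))\<^sup>2) =
      (\<Sum>j=1..l. \<Sum>t\<in>seq_supp (r j). (int (r j t))\<^sup>2) + (\<Sum>t | s t \<noteq> 0. (int (s t))\<^sup>2)"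
  proof -
    have "(\<Sum>t\<in>seq_supp s'. (int (s' t))\<^sup>2) = (\<Sum>t | s t \<noteq> 0. (int (s t))\<^sup>2)"
      unfolding supp_s by (subst sum.reindex) (simp_all add: s'_def)
    then show ?thesis using split[of "\<lambda>x. \<Sum>t\<in>seq_supp x. (int (x t))\<^sup>2"] by (simp add: supp_i)
  qed
  have ex: "q_exponent l pr m r' = q_exponent l pr m r + (\<Sum>t | s t \<noteq> 0. (int (s t))\<^sup>2 - int (neighbours i r t) * int (s t))"
    unfolding q_exponent_def sq cross sum_subtractf by simp
  have up: "u powi (\<Sum>t\<in>A. f t) = (\<Prod>t\<in>A. u powi f t)" for f and A :: "nat set"
    by (induction A rule: infinite_finite_induct) (simp_all add: u_powi_add)
  have den: "(\<Prod>j=1..l. \<Prod>t\<in>seq_supp (r' j). qp (r' j t - r' j (t + 1))) =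
     (\<Prod>j=1..l. \<Prod>t\<in>seq_supp (r j). qp (r j t - r j (t + 1))) * (\<Prod>t | s t \<noteq> 0. qp (s t - s (Suc t)))"
  proof -
    have "(\<Prod>t\<in>seq_supp s'. qp (s' t - s' (t + 1))) = (\<Prod>t | s t \<noteq> 0. qp (s t - s (Suc t)))"
      unfolding supp_s by (subst prod.reindex) (simp_all add: s'_def)
    then show ?thesis using splitp[of "\<lambda>x. \<Prod>t\<in>seq_supp x. qp (x t - x (t + 1))"] by (simp add: supp_i)
  qed
  show ?thesis
    unfolding s'_def[symmetric] r'_def[symmetric] tuple_weight_def ex den u_powi_add up seq_weight_def
      prod_dividef by simp
qed

text \<open>Taking the quotient by Euler's series makes the polynomial of
  \<open>fermionic_palindromic\<close> a function of the tuple without a choice.\<close>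

definition core :: "nat \<Rightarrow> (nat \<Rightarrow> nat \<Rightarrow> nat) \<Rightarrow> 'a fps" where
  "core i r = fermionic (\<lambda>_. 1) (\<lambda>t. int (neighbours i r t)) * inverse inverse_poch_fps"

lemma core:
  assumes "r \<in> tuples l n" "i \<in> {1..l}"
  shows "palindromic (reflection_degree i n) (core i r)"
    "fermionic (\<lambda>_. 1) (\<lambda>t. int (neighbours i r t)) = core i r * inverse_poch_fps"
proof -
  obtain p where p: "palindromic (reflection_degree i n) p"
    "fermionic (\<lambda>_. 1) (\<lambda>t. int (neighbours i r t)) = p * inverse_poch_fps"
    using fermionic_palindromic[OF neighbours_partition[OF assms]] by blast
  have "fps_nth inverse_poch_fps 0 \<noteq> 0" by (simp add: inverse_poch_fps_def)
  then have "inverse_poch_fps * inverse inverse_poch_fps = 1" by (rule inverse_mult_eq_1')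
  then have "core i r = p" unfolding core_def p by (simp add: mult.assoc)
  then show "palindromic (reflection_degree i n) (core i r)"
    "fermionic (\<lambda>_. 1) (\<lambda>t. int (neighbours i r t)) = core i r * inverse_poch_fps"
    using p by auto
qed

text \<open>The coefficient at exponent \<open>n\<close> of the series F times (q y_i; q)_infinity,
  as \<open>sum_coeff_eq\<close> shows.\<close>

definition core_coeff :: "nat \<Rightarrow> (nat \<Rightarrow> nat) \<Rightarrow> 'a" where
  "core_coeff i n = (\<Sum>r\<in>tuples l (n(i := 0)). tuple_weight r * fps_nth (core i r) (n i))"

lemma sum_coeff_eq:
  assumes i: "i \<in> {1..l}"
  shows "sum_coeff n = (\<Sum>k\<le>n i. core_coeff i (n(i := k)) * fps_nth inverse_poch_fps (n i - k))"
proof -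
  have "sum_coeff n = (\<Sum>r\<in>tuples l (n(i := 0)). \<Sum>s\<in>partition_seqs (n i).
      tuple_weight r * seq_weight (\<lambda>t. int (neighbours i r t)) s)"
    unfolding sum_coeff_def sum_tuples_split[OF i, of tuple_weight]
  proof (rule sum.cong[OF refl], rule sum.cong[OF refl])
    fix r s assume "r \<in> tuples l (n(i := 0))" "s \<in> partition_seqs (n i)"
    then show "tuple_weight (r(i := case_nat 0 s)) = tuple_weight r * seq_weight (\<lambda>t. int (neighbours i r t)) s"
      by (rule tuple_weight_split[OF _ i])
  qed
  also have "\<dots> = (\<Sum>r\<in>tuples l (n(i := 0)). tuple_weight r * fps_nth (core i r * inverse_poch_fps) (n i))"
    by (intro sum.cong refl) (simp add: core(2)[OF _ i, symmetric] fermionic_def sum_distrib_left)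
  also have "\<dots> = (\<Sum>r\<in>tuples l (n(i := 0)). \<Sum>k\<le>n i. tuple_weight r * fps_nth (core i r) k * fps_nth inverse_poch_fps (n i - k))"
    by (simp add: fps_mult_nth sum_distrib_left mult.assoc atMost_atLeast0)
  also have "\<dots> = (\<Sum>k\<le>n i. core_coeff i (n(i := k)) * fps_nth inverse_poch_fps (n i - k))"
    by (subst sum.swap) (simp add: core_coeff_def sum_distrib_right)
  finally show ?thesis .
qed

text \<open>\<open>reflection_degree i n\<close> does not involve \<open>n i\<close>, so the
  polynomials of all tuples in the sum have the same centre of symmetry.\<close>

lemma core_coeff_reflect:
  assumes i: "i \<in> {1..l}"
  shows "core_coeff i n =
    (if n i \<le> reflection_degree i n then core_coeff i (n(i := reflection_degree i n - n i)) else 0)"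
proof -
  have p: "palindromic (reflection_degree i n) (core i r)" if "r \<in> tuples l (n(i := 0))" for r
    using core(1)[OF that i] i by simp
  show ?thesis
  proof (cases "n i \<le> reflection_degree i n")
    case True
    then show ?thesis using palindromicD[OF p True] by (simp add: core_coeff_def)
  next
    case False
    then show ?thesis using palindromic_beyond[OF p] by (simp add: core_coeff_def)
  qed
qed

end

section \<open>Invariance under simple reflections\<close>

lemma mcoeff_times: "mcoeff (F * G) M = (\<Sum>K | K \<subseteq># M. mcoeff F K * mcoeff G (M - K))"
  for F :: "('v, 'a::comm_ring_1) mfps"
  by (simp add: times_mfps_def)

lemma mcoeff_one: "mcoeff (1 :: ('v, 'a::comm_ring_1) mfps) M = (if M = {#} then 1 else 0)"
  by (simp add: one_mfps_def)

lemma repeat_mset_inject: "b \<noteq> {#} \<Longrightarrow> repeat_mset j b = repeat_mset k b \<longleftrightarrow> j = k"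
proof
  assume "b \<noteq> {#}" and eq: "repeat_mset j b = repeat_mset k b"
  then obtain x where "count b x \<noteq> 0" by (metis count_empty multiset_eqI)
  then have x: "(count b x = 0) = False" by simp
  show "j = k" using arg_cong[OF eq, of "\<lambda>M. count M x"] by (simp only: count_repeat_mset mult_cancel2 x simp_thms)
qed simp

text \<open>The substitution of the monomial with exponents \<open>b\<close> for the variable of
  \<open>f\<close>. For \<open>b = {#}\<close> the exponent \<open>k\<close> would not be unique,
  hence the condition \<open>b \<noteq> {#}\<close> in what follows.\<close>

definition monomial_fps :: "'v multiset \<Rightarrow> 'a fps \<Rightarrow> ('v, 'a::comm_ring_1) mfps" where
  "monomial_fps b f = Abs_mfps (\<lambda>M. if \<exists>k. M = repeat_mset k b then fps_nth f (THE k. M = repeat_mset k b) else 0)"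

lemma monomial_fps_repeat: "b \<noteq> {#} \<Longrightarrow> mcoeff (monomial_fps b f) (repeat_mset k b) = fps_nth f k"
  by (auto simp: monomial_fps_def repeat_mset_inject)

lemma monomial_fps_other: "(\<And>k. M \<noteq> repeat_mset k b) \<Longrightarrow> mcoeff (monomial_fps b f) M = 0"
  by (simp add: monomial_fps_def)

lemma repeat_mset_add_left: "repeat_mset (j + k) b = repeat_mset j b + repeat_mset k b"
  by (rule multiset_eqI) (simp add: algebra_simps)

lemma monomial_fps_mult:
  assumes b: "b \<noteq> {#}"
  shows "monomial_fps b (f * g) = monomial_fps b f * monomial_fps b g"
proof (rule mfps_eqI)
  fix M
  show "mcoeff (monomial_fps b (f * g)) M = mcoeff (monomial_fps b f * monomial_fps b g) M"
  proof (cases "\<exists>k. M = repeat_mset k b")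
    case True
    then obtain k where M: "M = repeat_mset k b" by blast
    have diff: "M - repeat_mset j b = repeat_mset (k - j) b" if "j \<le> k" for j
      unfolding M using that by (intro multiset_eqI) (simp add: algebra_simps)
    have "mcoeff (monomial_fps b f * monomial_fps b g) M =
        (\<Sum>K\<in>(\<lambda>j. repeat_mset j b) ` {..k}. mcoeff (monomial_fps b f) K * mcoeff (monomial_fps b g) (M - K))"
      unfolding mcoeff_times
    proof (rule sum.mono_neutral_right[OF finite_submultisets])
      show "(\<lambda>j. repeat_mset j b) ` {..k} \<subseteq> {K. K \<subseteq># M}"
        by (auto simp: M subseteq_mset_def)
      show "\<forall>K\<in>{K. K \<subseteq># M} - (\<lambda>j. repeat_mset j b) ` {..k}.
          mcoeff (monomial_fps b f) K * mcoeff (monomial_fps b g) (M - K) = 0"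
      proof
        fix K assume K: "K \<in> {K. K \<subseteq># M} - (\<lambda>j. repeat_mset j b) ` {..k}"
        have "K \<noteq> repeat_mset j b" for j
        proof
          assume Kj: "K = repeat_mset j b"
          obtain x where x: "count b x \<noteq> 0" using b by (metis count_empty multiset_eqI)
          have "count K x \<le> count M x" using K by (simp add: subseteq_mset_def)
          then have "j \<le> k" using x by (simp add: Kj M)
          then show False using K Kj by blast
        qed
        then show "mcoeff (monomial_fps b f) K * mcoeff (monomial_fps b g) (M - K) = 0"
          by (simp add: monomial_fps_other)
      qed
    qed
    also have "\<dots> = (\<Sum>j\<le>k. fps_nth f j * fps_nth g (k - j))"
      by (subst sum.reindex) (auto simp: inj_on_def repeat_mset_inject[OF b] monomial_fps_repeat[OF b] diff)
    finally show ?thesis by (simp add: M monomial_fps_repeat[OF b] fps_mult_nth atMost_atLeast0)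
  next
    case False
    have "mcoeff (monomial_fps b f) K * mcoeff (monomial_fps b g) (M - K) = 0" if "K \<subseteq># M" for K
    proof (rule ccontr)
      assume "mcoeff (monomial_fps b f) K * mcoeff (monomial_fps b g) (M - K) \<noteq> 0"
      then obtain j k where "K = repeat_mset j b" "M - K = repeat_mset k b"
        using monomial_fps_other[of K b f] monomial_fps_other[of "M - K" b g] by (metis mult_zero_left mult_zero_right)
      then have "M = repeat_mset (j + k) b"
        using that by (metis repeat_mset_add_left subset_mset.add_diff_inverse)
      then show False using False by blast
    qed
    then show ?thesis using False by (simp add: mcoeff_times monomial_fps_other)
  qed
qed

lemma monomial_fps_one: "b \<noteq> {#} \<Longrightarrow> monomial_fps b 1 = 1"
proof (rule mfps_eqI)
  fix M assume b: "b \<noteq> {#}"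
  show "mcoeff (monomial_fps b 1) M = mcoeff 1 M"
  proof (cases "\<exists>k. M = repeat_mset k b")
    case True
    then obtain k where M: "M = repeat_mset k b" by blast
    have "M = {#} \<longleftrightarrow> k = 0" unfolding M using repeat_mset_inject[OF b, of k 0] by simp
    then show ?thesis by (simp add: mcoeff_one M monomial_fps_repeat[OF b])
  next
    case False
    then have "M \<noteq> {#}" by (metis repeat_mset_0)
    then show ?thesis using False by (simp add: mcoeff_one monomial_fps_other)
  qed
qed

lemma repeat_single: "repeat_mset k {#i#} = replicate_mset k i"
  by (rule multiset_eqI) simp

section \<open>Simple reflections acting on exponents\<close>

context dynkin_sum
begin

definition mset_degree :: "nat \<Rightarrow> nat multiset \<Rightarrow> nat" where
  "mset_degree i M = reflection_degree i (count M)"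

definition reflectable :: "nat \<Rightarrow> nat multiset \<Rightarrow> bool" where
  "reflectable i M \<longleftrightarrow> count M i \<le> mset_degree i M"

text \<open>The subtraction truncates, so this is the simple reflection only on
  \<open>reflectable\<close> exponents, those whose image has no negative entry.\<close>

definition reflect :: "nat \<Rightarrow> nat multiset \<Rightarrow> nat multiset" where
  "reflect i M = filter_mset (\<lambda>x. x \<noteq> i) M + replicate_mset (mset_degree i M - count M i) i"

lemma count_reflect: "count (reflect i M) x = (if x = i then mset_degree i M - count M i else count M x)"
  by (simp add: reflect_def)

lemma count_reflect_fun: "count (reflect i M) = (count M)(i := mset_degree i M - count M i)"
  by (rule ext) (simp add: count_reflect)

lemma mset_degree_add: "mset_degree i (K + L) = mset_degree i K + mset_degree i L"
  by (simp add: mset_degree_def reflection_degree_def sum.distrib algebra_simps)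

lemma mset_degree_reflect: "i \<in> {1..l} \<Longrightarrow> mset_degree i (reflect i M) = mset_degree i M"
  unfolding mset_degree_def[of i "reflect i M"] count_reflect_fun by (simp add: mset_degree_def)

lemma reflectable_add: "reflectable i K \<Longrightarrow> reflectable i L \<Longrightarrow> reflectable i (K + L)"
  by (simp add: reflectable_def mset_degree_add)

lemma reflect_add: "reflectable i K \<Longrightarrow> reflectable i L \<Longrightarrow> reflect i (K + L) = reflect i K + reflect i L"
  by (rule multiset_eqI) (auto simp: count_reflect reflectable_def mset_degree_add)

lemma reflectable_reflect: "i \<in> {1..l} \<Longrightarrow> reflectable i (reflect i M)"
  by (simp add: reflectable_def mset_degree_reflect count_reflect)

lemma reflect_reflect: "i \<in> {1..l} \<Longrightarrow> reflectable i M \<Longrightarrow> reflect i (reflect i M) = M"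
  by (rule multiset_eqI) (auto simp: count_reflect mset_degree_reflect reflectable_def)

lemma mset_degree_empty: "mset_degree i {#} = 0"
  by (simp add: mset_degree_def reflection_degree_def)

lemma mset_degree_repeat: "mset_degree i (repeat_mset k M) = k * mset_degree i M"
  by (induction k) (simp_all add: mset_degree_add mset_degree_empty)

lemma reflectable_repeat: "k \<noteq> 0 \<Longrightarrow> reflectable i (repeat_mset k M) \<longleftrightarrow> reflectable i M"
  by (simp add: reflectable_def mset_degree_repeat)

lemma reflect_repeat: "reflect i (repeat_mset k M) = repeat_mset k (reflect i M)"
  by (rule multiset_eqI) (simp add: count_reflect mset_degree_repeat diff_mult_distrib2)

text \<open>Each series is the image of the other. The two clauses are not equivalent: the first
  says nothing about coefficients of \<open>G\<close> at exponents that are not reflectable, and the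
  second makes them vanish.\<close>

definition reflected :: "nat \<Rightarrow> (nat, 'a) mfps \<Rightarrow> (nat, 'a) mfps \<Rightarrow> bool" where
  "reflected i F G \<longleftrightarrow>
    (\<forall>M. mcoeff F M = (if reflectable i M then mcoeff G (reflect i M) else 0)) \<and>
    (\<forall>M. mcoeff G M = (if reflectable i M then mcoeff F (reflect i M) else 0))"

lemma reflected_sym: "reflected i F G \<Longrightarrow> reflected i G F"
  by (auto simp: reflected_def)

lemma reflectedD:
  assumes "reflected i F G"
  shows "reflectable i M \<Longrightarrow> mcoeff F M = mcoeff G (reflect i M)"
    and "\<not> reflectable i M \<Longrightarrow> mcoeff F M = 0"
proof -
  have e: "mcoeff F M = (if reflectable i M then mcoeff G (reflect i M) else 0)"
    using assms unfolding reflected_def by blast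
  show "reflectable i M \<Longrightarrow> mcoeff F M = mcoeff G (reflect i M)"
    unfolding e by (rule if_P)
  show "\<not> reflectable i M \<Longrightarrow> mcoeff F M = 0"
    unfolding e by (rule if_not_P)
qed

text \<open>A splitting of \<open>M\<close> with a part that is not reflectable contributes 0. On
  the remaining splittings \<open>reflect i\<close> is additive, so it maps those of
  \<open>M\<close> bijectively to those of \<open>reflect i M\<close>.\<close>

lemma reflected_mult_coeff:
  assumes i: "i \<in> {1..l}" and FG: "reflected i F G" and FG': "reflected i F' G'"
  shows "mcoeff (F * F') M = (if reflectable i M then mcoeff (G * G') (reflect i M) else 0)"
proof -
  define S where "S M = {K. K \<subseteq># M \<and> reflectable i K \<and> reflectable i (M - K)}" for M
  have sumS: "mcoeff (A * A') M = (\<Sum>K\<in>S M. mcoeff A K * mcoeff A' (M - K))"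
    if "reflected i A B" "reflected i A' B'" for A A' B B' M
    unfolding mcoeff_times S_def
  proof (rule sum.mono_neutral_right[OF finite_submultisets])
    show "\<forall>K\<in>{K. K \<subseteq># M} - {K. K \<subseteq># M \<and> reflectable i K \<and> reflectable i (M - K)}.
        mcoeff A K * mcoeff A' (M - K) = 0"
    proof
      fix K assume "K \<in> {K. K \<subseteq># M} - {K. K \<subseteq># M \<and> reflectable i K \<and> reflectable i (M - K)}"
      then consider "\<not> reflectable i K" | "\<not> reflectable i (M - K)" by blast
      then show "mcoeff A K * mcoeff A' (M - K) = 0"
      proof cases
        case 1
        then have "mcoeff A K = 0" by (rule reflectedD(2)[OF that(1)])
        then show ?thesis by simp
      next
        case 2
        then have "mcoeff A' (M - K) = 0" by (rule reflectedD(2)[OF that(2)])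
        then show ?thesis by simp
      qed
    qed
  qed blast
  have S_D: "K \<subseteq># M" "reflectable i K" "reflectable i (M - K)" "M = K + (M - K)" if "K \<in> S M" for K M
    using that by (auto simp: S_def)
  have S_refl: "reflect i K \<in> S (reflect i M)" "reflect i M - reflect i K = reflect i (M - K)"
    "reflectable i M" if "K \<in> S M" for K M
  proof -
    note D = S_D[OF that]
    show "reflectable i M" by (subst D(4)) (rule reflectable_add[OF D(2,3)])
    have e: "reflect i M = reflect i K + reflect i (M - K)"
      by (subst D(4)) (rule reflect_add[OF D(2,3)])
    then show d: "reflect i M - reflect i K = reflect i (M - K)" by simp
    show "reflect i K \<in> S (reflect i M)"
      unfolding S_def mem_Collect_eq d using i by (simp add: e reflectable_reflect)
  qed
  show ?thesis
  proof (cases "reflectable i M")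
    case True
    have "(\<Sum>K\<in>S M. mcoeff F K * mcoeff F' (M - K)) =
        (\<Sum>K\<in>S (reflect i M). mcoeff G K * mcoeff G' (reflect i M - K))"
    proof (rule sum.reindex_bij_witness[where i = "reflect i" and j = "reflect i"])
      fix K assume K: "K \<in> S M"
      show "reflect i (reflect i K) = K" by (rule reflect_reflect[OF i S_D(2)[OF K]])
      show "reflect i K \<in> S (reflect i M)" by (rule S_refl[OF K])
      have "mcoeff F K = mcoeff G (reflect i K)" "mcoeff F' (M - K) = mcoeff G' (reflect i (M - K))"
        by (rule reflectedD(1)[OF FG S_D(2)[OF K]], rule reflectedD(1)[OF FG' S_D(3)[OF K]])
      then show "mcoeff G (reflect i K) * mcoeff G' (reflect i M - reflect i K) = mcoeff F K * mcoeff F' (M - K)"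
        by (simp add: S_refl(2)[OF K])
    next
      fix K assume K: "K \<in> S (reflect i M)"
      show "reflect i (reflect i K) = K" by (rule reflect_reflect[OF i S_D(2)[OF K]])
      show "reflect i K \<in> S M" using S_refl(1)[OF K] by (simp add: reflect_reflect[OF i True])
    qed
    then show ?thesis
      using True sumS[OF FG FG'] sumS[OF reflected_sym[OF FG] reflected_sym[OF FG']] by simp
  next
    case False
    then have "S M = {}" using S_refl(3) by blast
    then show ?thesis using False sumS[OF FG FG'] by simp
  qed
qed

lemma reflected_mult:
  assumes "i \<in> {1..l}" "reflected i F G" "reflected i F' G'"
  shows "reflected i (F * F') (G * G')"
  unfolding reflected_def
  using reflected_mult_coeff[OF assms] reflected_mult_coeff[OF assms(1) reflected_sym[OF assms(2)] reflected_sym[OF assms(3)]]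
  by blast

lemma reflect_empty [simp]: "reflect i {#} = {#}"
  by (rule multiset_eqI) (simp add: count_reflect mset_degree_def reflection_degree_def)

lemma reflectable_empty [simp]: "reflectable i {#}"
  by (simp add: reflectable_def)

lemma reflect_eq_empty: "i \<in> {1..l} \<Longrightarrow> reflectable i M \<Longrightarrow> reflect i M = {#} \<longleftrightarrow> M = {#}"
  by (metis reflect_empty reflect_reflect)

lemma reflected_one: "i \<in> {1..l} \<Longrightarrow> reflected i 1 1"
  by (auto simp: reflected_def mcoeff_one reflect_eq_empty)

lemma reflected_monomial_fps_coeff:
  assumes i: "i \<in> {1..l}" and b: "b \<noteq> {#}" "reflectable i b"
  shows "mcoeff (monomial_fps b f) M = (if reflectable i M then mcoeff (monomial_fps (reflect i b) f) (reflect i M) else 0)"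
proof (cases "\<exists>k. M = repeat_mset k b")
  case True
  then obtain k where M: "M = repeat_mset k b" by blast
  have "reflect i b \<noteq> {#}" using b reflect_eq_empty[OF i b(2)] by simp
  moreover have "reflectable i M" using reflectable_repeat[of k i b] b by (cases "k = 0") (auto simp: M)
  ultimately show ?thesis using b by (simp add: M reflect_repeat monomial_fps_repeat)
next
  case False
  have "mcoeff (monomial_fps (reflect i b) f) (reflect i M) = 0" if "reflectable i M"
  proof (rule monomial_fps_other)
    fix k
    show "reflect i M \<noteq> repeat_mset k (reflect i b)"
    proof
      assume "reflect i M = repeat_mset k (reflect i b)"
      then have "reflect i (reflect i M) = repeat_mset k (reflect i (reflect i b))"
        by (simp add: reflect_repeat)
      then have "M = repeat_mset k b" unfolding reflect_reflect[OF i that] reflect_reflect[OF i b(2)] .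
      then show False using False by blast
    qed
  qed
  then show ?thesis using False by (simp add: monomial_fps_other)
qed

lemma reflected_monomial_fps:
  assumes i: "i \<in> {1..l}" and b: "b \<noteq> {#}" "reflectable i b"
  shows "reflected i (monomial_fps b f) (monomial_fps (reflect i b) f)"
proof -
  have ne: "reflect i b \<noteq> {#}" using b reflect_eq_empty[OF i b(2)] by simp
  show ?thesis
    unfolding reflected_def
    using reflected_monomial_fps_coeff[OF i b, of f]
      reflected_monomial_fps_coeff[OF i ne reflectable_reflect[OF i], of f, unfolded reflect_reflect[OF i b(2)]]
    by blast
qed

lemma reflected_prod:
  assumes "i \<in> {1..l}" "\<And>b. b \<in> S \<Longrightarrow> reflected i (F b) (G b)"
  shows "reflected i (\<Prod>b\<in>S. F b) (\<Prod>b\<in>S. G b)"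
  using assms(2) by (induction S rule: infinite_finite_induct)
    (simp_all add: reflected_one[OF assms(1)] reflected_mult[OF assms(1)])

text \<open>The sum side F as a series in the y_i, over the field that contains
  \<open>u\<close>.\<close>

definition sum_mfps :: "(nat, 'a) mfps" where
  "sum_mfps = Abs_mfps (\<lambda>M. if set_mset M \<subseteq> {1..l} then sum_coeff (count M) else 0)"

definition core_mfps :: "nat \<Rightarrow> (nat, 'a) mfps" where
  "core_mfps i = Abs_mfps (\<lambda>M. if set_mset M \<subseteq> {1..l} then core_coeff i (count M) else 0)"

lemma sum_mfps_eq:
  assumes i: "i \<in> {1..l}"
  shows "sum_mfps = core_mfps i * monomial_fps {#i#} inverse_poch_fps"
proof (rule mfps_eqI)
  fix M
  let ?g = "\<lambda>K. mcoeff (core_mfps i) K * mcoeff (monomial_fps {#i#} inverse_poch_fps) (M - K)"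
  let ?K = "\<lambda>k. M - replicate_mset (count M i - k) i"
  have cK: "count (?K k) = (count M)(i := k)" if "k \<le> count M i" for k
    using that by (auto simp: fun_eq_iff)
  have "mcoeff (core_mfps i * monomial_fps {#i#} inverse_poch_fps) M = (\<Sum>K\<in>?K ` {..count M i}. ?g K)"
    unfolding mcoeff_times
  proof (rule sum.mono_neutral_right[OF finite_submultisets])
    show "?K ` {..count M i} \<subseteq> {K. K \<subseteq># M}" by auto
    show "\<forall>K\<in>{K. K \<subseteq># M} - ?K ` {..count M i}. ?g K = 0"
    proof
      fix K assume K: "K \<in> {K. K \<subseteq># M} - ?K ` {..count M i}"
      have "M - K \<noteq> repeat_mset j {#i#}" for j
      proof
        assume e: "M - K = repeat_mset j {#i#}"
        have KM: "K \<subseteq># M" using K by simp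
        have cj: "count M i - count K i = j" using arg_cong[OF e, of "\<lambda>M. count M i"] by simp
        have "count K i \<le> count M i" using KM by (simp add: subseteq_mset_def)
        then have j: "j = count M i - count K i" "count K i \<le> count M i" using cj by auto
        have "K = M - (M - K)" using KM by (simp add: subset_mset.diff_diff_right double_diff)
        then have "K = ?K (count K i)" unfolding e repeat_single j(1) .
        then show False using K j(2) by blast
      qed
      then show "?g K = 0" by (simp add: monomial_fps_other)
    qed
  qed
  also have "\<dots> = (\<Sum>k\<le>count M i. ?g (?K k))"
  proof (rule sum.reindex_cong[OF _ refl refl])
    show "inj_on ?K {..count M i}"
    proof (rule inj_onI)
      fix j k assume "j \<in> {..count M i}" "k \<in> {..count M i}" "?K j = ?K k"
      then have "((count M)(i := j)) i = ((count M)(i := k)) i" using cK[of j] cK[of k] by (metis atMost_iff)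
      then show "j = k" by simp
    qed
  qed
  also have "\<dots> = (\<Sum>k\<le>count M i. if set_mset M \<subseteq> {1..l} then
      core_coeff i ((count M)(i := k)) * fps_nth inverse_poch_fps (count M i - k) else 0)"
  proof (rule sum.cong[OF refl])
    fix k assume "k \<in> {..count M i}"
    then have k: "k \<le> count M i" by simp
    have e: "M - ?K k = repeat_mset (count M i - k) {#i#}"
      unfolding repeat_single by (rule multiset_eqI) (use k in auto)
    have supp: "set_mset (?K k) \<subseteq> {1..l} \<longleftrightarrow> set_mset M \<subseteq> {1..l}"
    proof -
      have "set_mset M \<subseteq> insert i (set_mset (?K k))"
      proof
        fix x assume "x \<in># M"
        then show "x \<in> insert i (set_mset (?K k))"
          using fun_cong[OF cK[OF k], of x] by (cases "x = i") (auto simp: count_greater_zero_iff[symmetric] simp del: count_greater_zero_iff)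
      qed
      moreover have "set_mset (?K k) \<subseteq> set_mset M" by (auto dest: in_diffD)
      ultimately show ?thesis using i by blast
    qed
    have "mcoeff (monomial_fps {#i#} inverse_poch_fps) (M - ?K k) = fps_nth inverse_poch_fps (count M i - k)"
      unfolding e by (rule monomial_fps_repeat) simp
    then show "?g (?K k) = (if set_mset M \<subseteq> {1..l} then
      core_coeff i ((count M)(i := k)) * fps_nth inverse_poch_fps (count M i - k) else 0)"
      by (simp only: core_mfps_def mcoeff_Abs_mfps cK[OF k] supp) simp
  qed
  also have "\<dots> = mcoeff sum_mfps M"
    using sum_coeff_eq[OF i, of "count M"] by (simp add: sum_mfps_def)
  finally show "mcoeff sum_mfps M = mcoeff (core_mfps i * monomial_fps {#i#} inverse_poch_fps) M" by (rule sym)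
qed

lemma reflected_core_mfps:
  assumes i: "i \<in> {1..l}"
  shows "reflected i (core_mfps i) (core_mfps i)"
proof -
  have "set_mset (reflect i M) \<subseteq> {1..l} \<longleftrightarrow> set_mset M \<subseteq> {1..l}" for M
  proof -
    have "set_mset (reflect i M) - {i} = set_mset M - {i}"
      by (auto simp: reflect_def split: if_splits)
    then show ?thesis using i by blast
  qed
  then show ?thesis
    using core_coeff_reflect[OF i]
    by (simp add: reflected_def core_mfps_def count_reflect_fun reflectable_def mset_degree_def)
qed

lemma sum_coeff_zero: "sum_coeff (\<lambda>_. 0) = 1"
proof -
  have "tuples l (\<lambda>_. 0) = {\<lambda>_ _. 0}"
  proof -
    have 0: "case_nat 0 ` partition_seqs 0 = {\<lambda>_. 0 :: nat}"
      by (auto simp: partition_seqs_0 fun_eq_iff split: nat.splits)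
    show ?thesis
    proof (intro set_eqI iffI)
      fix r assume r: "r \<in> tuples l (\<lambda>_. 0)"
      have "r i = (\<lambda>_. 0)" for i
        using tuplesD[OF r, of i] unfolding 0 by (cases "i \<in> {1..l}") auto
      then show "r \<in> {\<lambda>_ _. 0}" by auto
    next
      fix r :: "nat \<Rightarrow> nat \<Rightarrow> nat" assume "r \<in> {\<lambda>_ _. 0}"
      then show "r \<in> tuples l (\<lambda>_. 0)" unfolding tuples_iff 0 by simp
    qed
  qed
  then show ?thesis
    by (simp add: sum_coeff_def tuple_weight_def q_exponent_def seq_supp_def)
qed

text \<open>\<open>R\<close> stands for the exponents of the positive roots, and \<open>pos\<close>
  is the descent: some simple reflection lowers a given nonzero exponent. The series
  \<open>inverse inverse_poch_fps\<close> is (q y; q)_infinity.\<close>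

theorem sum_mfps_prod:
  assumes fin: "finite R" and ne: "{#} \<notin> R"
    and simple: "\<And>i. i \<in> {1..l} \<Longrightarrow> {#i#} \<in> R"
    and refl: "\<And>i b. i \<in> {1..l} \<Longrightarrow> b \<in> R - {{#i#}} \<Longrightarrow> reflectable i b \<and> reflect i b \<in> R - {{#i#}}"
    and supp: "\<And>b. b \<in> R \<Longrightarrow> set_mset b \<subseteq> {1..l}"
    and pos: "\<And>M. M \<noteq> {#} \<Longrightarrow> set_mset M \<subseteq> {1..l} \<Longrightarrow> \<exists>i\<in>{1..l}. mset_degree i M < 2 * count M i"
  shows "sum_mfps * (\<Prod>b\<in>R. monomial_fps b (inverse inverse_poch_fps)) = 1"
proof -
  let ?E = "inverse inverse_poch_fps"
  define G where "G = sum_mfps * (\<Prod>b\<in>R. monomial_fps b ?E)"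
  have inv: "inverse_poch_fps * ?E = 1"
    by (rule inverse_mult_eq_1') (simp add: inverse_poch_fps_def)
  have G_refl: "reflected i G G" if i: "i \<in> {1..l}" for i
  proof -
    let ?S = "R - {{#i#}}"
    \<comment> \<open>The factor of the simple root \<open>i\<close> cancels Euler's series in
      \<open>sum_mfps_eq\<close>; only the palindromic part of the sum side is left.\<close>
    have "G = core_mfps i * (monomial_fps {#i#} inverse_poch_fps * monomial_fps {#i#} ?E) * (\<Prod>b\<in>?S. monomial_fps b ?E)"
      unfolding G_def sum_mfps_eq[OF i] prod.remove[OF fin simple[OF i]] by (simp only: mult_ac)
    also have "monomial_fps {#i#} inverse_poch_fps * monomial_fps {#i#} ?E = (1 :: (nat, 'a) mfps)"
      by (simp add: inv monomial_fps_one flip: monomial_fps_mult)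
    finally have G: "G = core_mfps i * (\<Prod>b\<in>?S. monomial_fps b ?E)" by simp
    have "reflected i (\<Prod>b\<in>?S. monomial_fps b ?E) (\<Prod>b\<in>?S. monomial_fps (reflect i b) ?E)"
    proof (rule reflected_prod[OF i])
      fix b assume b: "b \<in> ?S"
      then have "b \<noteq> {#}" using ne by blast
      then show "reflected i (monomial_fps b ?E) (monomial_fps (reflect i b) ?E)"
        using refl[OF i b] by (intro reflected_monomial_fps[OF i]) auto
    qed
    also have "(\<Prod>b\<in>?S. monomial_fps (reflect i b) ?E) = (\<Prod>b\<in>?S. monomial_fps b ?E)"
      by (rule prod.reindex_bij_witness[where i = "reflect i" and j = "reflect i"])
        (use refl[OF i] reflect_reflect[OF i] in auto)
    finally show ?thesis unfolding G by (intro reflected_mult[OF i reflected_core_mfps[OF i]])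
  qed
  \<comment> \<open>Needed because \<open>pos\<close> speaks only of monomials in the variables with
    index in \<open>{1..l}\<close>.\<close>
  have supp_closed: "set_mset M \<subseteq> {1..l}" if "mcoeff G M \<noteq> 0" for M
  proof -
    have *: "mcoeff (F * F') M = 0" if "\<not> set_mset M \<subseteq> {1..l}"
      "\<And>M. \<not> set_mset M \<subseteq> {1..l} \<Longrightarrow> mcoeff F M = 0" "\<And>M. \<not> set_mset M \<subseteq> {1..l} \<Longrightarrow> mcoeff F' M = 0"
      for F F' :: "(nat, 'a) mfps" and M
      unfolding mcoeff_times
    proof (rule sum.neutral, rule ballI)
      fix K assume "K \<in> {K. K \<subseteq># M}"
      then have "M = K + (M - K)" by simp
      then have "set_mset M = set_mset K \<union> set_mset (M - K)" by (metis set_mset_union)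
      then show "mcoeff F K * mcoeff F' (M - K) = 0" using that by (metis Un_least mult_zero_left mult_zero_right)
    qed
    have mono: "mcoeff (monomial_fps b ?E) M = 0" if "\<not> set_mset M \<subseteq> {1..l}" "b \<in> R" for M b
    proof (rule monomial_fps_other)
      fix k
      have "set_mset (repeat_mset k b) \<subseteq> set_mset b" by (induction k) auto
      then show "M \<noteq> repeat_mset k b" using that(1) supp[OF that(2)] by blast
    qed
    have p: "mcoeff (\<Prod>b\<in>S. monomial_fps b ?E) M = 0" if "\<not> set_mset M \<subseteq> {1..l}" "S \<subseteq> R" "finite S" for S M
      using that(3,2,1)
    proof (induction S arbitrary: M rule: finite_induct)
      case empty
      then show ?case by (auto simp: mcoeff_one)
    next
      case (insert b S)
      have b: "b \<in> R" and S: "S \<subseteq> R" using insert.prems by auto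
      show ?case unfolding prod.insert[OF insert.hyps]
        by (rule *[OF insert.prems(2) mono[OF _ b] insert.IH[OF S]])
    qed
    show ?thesis
    proof (rule ccontr)
      assume M: "\<not> set_mset M \<subseteq> {1..l}"
      have s: "mcoeff sum_mfps M = 0" if "\<not> set_mset M \<subseteq> {1..l}" for M
        unfolding sum_mfps_def mcoeff_Abs_mfps using that by (rule if_not_P)
      have "mcoeff G M = 0" unfolding G_def
        by (rule *[OF M s p[OF _ order_refl fin]])
      then show False using that by simp
    qed
  qed
  have zero: "mcoeff G M = 0" if "M \<noteq> {#}" for M
    using that
  proof (induction "size M" arbitrary: M rule: less_induct)
    case less
    show ?case
    proof (rule ccontr)
      assume nz: "mcoeff G M \<noteq> 0"
      obtain i where i: "i \<in> {1..l}" "mset_degree i M < 2 * count M i"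
        using pos[OF less.prems supp_closed[OF nz]] by blast
      have r: "reflectable i M" using nz reflectedD(2)[OF G_refl[OF i(1)]] by blast
      have "size (reflect i M) < size M"
      proof -
        have "M = filter_mset (\<lambda>x. x \<noteq> i) M + replicate_mset (count M i) i"
          by (rule multiset_eqI) simp
        then have "size M = size (filter_mset (\<lambda>x. x \<noteq> i) M) + count M i"
          by (metis size_replicate_mset size_union)
        then show ?thesis using i(2) r by (simp add: reflect_def reflectable_def)
      qed
      moreover have "reflect i M \<noteq> {#}" using reflect_eq_empty[OF i(1) r] less.prems by simp
      ultimately have "mcoeff G (reflect i M) = 0" by (rule less.hyps)
      then show False using nz reflectedD(1)[OF G_refl[OF i(1)] r] by simp
    qed
  qed
  have "mcoeff G {#} = 1"
  proof -
    have s: "{K. K \<subseteq># {#}} = {{#}}" by auto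
    have c: "count {#} = (\<lambda>_. 0)" by (rule ext) simp
    have "mcoeff (\<Prod>b\<in>S. monomial_fps b ?E) {#} = 1" if "finite S" "S \<subseteq> R" for S
      using that
    proof (induction S rule: finite_induct)
      case (insert b S)
      have "b \<noteq> {#}" using ne insert.prems by blast
      then have "mcoeff (monomial_fps b ?E) {#} = 1"
        using monomial_fps_repeat[of b ?E 0] by (simp add: inverse_poch_fps_def)
      then show ?case using insert by (simp add: mcoeff_times s)
    qed (simp add: mcoeff_one)
    from this[OF fin order_refl] show ?thesis
      by (simp add: G_def mcoeff_times s sum_mfps_def sum_coeff_zero c)
  qed
  then have "G = 1" using zero by (intro mfps_eqI) (simp add: mcoeff_one)
  then show ?thesis unfolding G_def .
qed

end

section \<open>Passage to power series in all variables\<close>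

text \<open>The monomial q^a y^M.\<close>

definition qy_mset :: "nat \<Rightarrow> nat multiset \<Rightarrow> variable multiset" where
  "qy_mset a M = replicate_mset a Q + image_mset Y M"

text \<open>The value 0 in the branch \<open>Q\<close> is a dummy, since \<open>Q\<close> has been
  filtered out.\<close>

definition y_part :: "variable multiset \<Rightarrow> nat multiset" where
  "y_part Z = image_mset (\<lambda>v. case v of Q \<Rightarrow> 0 | Y i \<Rightarrow> i) (filter_mset (\<lambda>v. v \<noteq> Q) Z)"

lemma count_qy_mset [simp]: "count (qy_mset a M) Q = a" "count (qy_mset a M) (Y i) = count M i"
proof -
  show "count (qy_mset a M) Q = a" by (induction M) (auto simp: qy_mset_def)
  show "count (qy_mset a M) (Y i) = count M i" by (induction M) (auto simp: qy_mset_def)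
qed

lemma count_y_part [simp]: "count (y_part Z) i = count Z (Y i)"
proof (induction Z)
  case (add v Z)
  then show ?case by (cases v) (auto simp: y_part_def)
qed (simp add: y_part_def)

lemma mset_variable_eqI: "count Z Q = count W Q \<Longrightarrow> (\<And>i. count Z (Y i) = count W (Y i)) \<Longrightarrow> Z = W"
  by (rule multiset_eqI) (metis variable.exhaust)

lemma qy_mset_y_part [simp]: "qy_mset (count Z Q) (y_part Z) = Z"
  by (rule mset_variable_eqI) simp_all

lemma y_part_qy_mset [simp]: "y_part (qy_mset a M) = M"
  by (rule multiset_eqI) simp

lemma qy_mset_diff: "qy_mset a M - qy_mset b K = qy_mset (a - b) (M - K)"
  by (rule mset_variable_eqI) simp_all

lemma qy_mset_add: "qy_mset a M + qy_mset b K = qy_mset (a + b) (M + K)"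
  by (rule mset_variable_eqI) simp_all

lemma qy_mset_inject [simp]: "qy_mset a M = qy_mset b K \<longleftrightarrow> a = b \<and> M = K"
  by (metis count_qy_mset(1) y_part_qy_mset)

lemma qy_mset_empty [simp]: "qy_mset 0 {#} = {#}"
  by (simp add: qy_mset_def)

lemma qy_mset_subset: "qy_mset b K \<subseteq># qy_mset a M \<longleftrightarrow> b \<le> a \<and> K \<subseteq># M"
proof
  assume "qy_mset b K \<subseteq># qy_mset a M"
  then have "count (qy_mset b K) v \<le> count (qy_mset a M) v" for v by (simp add: subseteq_mset_def)
  from this[of Q] this[of "Y _"] show "b \<le> a \<and> K \<subseteq># M" by (simp add: subseteq_mset_def)
next
  assume "b \<le> a \<and> K \<subseteq># M"
  then have "count (qy_mset b K) v \<le> count (qy_mset a M) v" for v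
    by (cases v) (simp_all add: subseteq_mset_def)
  then show "qy_mset b K \<subseteq># qy_mset a M" by (simp add: subseteq_mset_def)
qed

text \<open>The coefficient of y^M, as a power series in q.\<close>

definition slice :: "(variable, rat) mfps \<Rightarrow> nat multiset \<Rightarrow> rat fps" where
  "slice F M = Abs_fps (\<lambda>a. mcoeff F (qy_mset a M))"

lemma slice_nth [simp]: "fps_nth (slice F M) a = mcoeff F (qy_mset a M)"
  by (simp add: slice_def)

lemma slice_eqI: "(\<And>M. slice F M = slice G M) \<Longrightarrow> F = G"
proof (rule mfps_eqI)
  fix Z assume "\<And>M. slice F M = slice G M"
  then have "fps_nth (slice F (y_part Z)) (count Z Q) = fps_nth (slice G (y_part Z)) (count Z Q)" by simp
  then show "mcoeff F Z = mcoeff G Z" by simp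
qed

lemma slice_mult: "slice (F * G) M = (\<Sum>K | K \<subseteq># M. slice F K * slice G (M - K))"
proof (rule fps_ext)
  fix a
  have "mcoeff (F * G) (qy_mset a M) =
      (\<Sum>(K, b)\<in>{K. K \<subseteq># M} \<times> {..a}. mcoeff F (qy_mset b K) * mcoeff G (qy_mset (a - b) (M - K)))"
    unfolding mcoeff_times
  proof (rule sum.reindex_bij_witness[where i = "\<lambda>(K, b). qy_mset b K" and j = "\<lambda>Z. (y_part Z, count Z Q)"])
    fix Z assume "Z \<in> {Z. Z \<subseteq># qy_mset a M}"
    then have "qy_mset (count Z Q) (y_part Z) \<subseteq># qy_mset a M" by simp
    then show "(y_part Z, count Z Q) \<in> {K. K \<subseteq># M} \<times> {..a}" unfolding qy_mset_subset by simp
    have "qy_mset a M - Z = qy_mset (a - count Z Q) (M - y_part Z)"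
      using qy_mset_diff[of a M "count Z Q" "y_part Z"] by simp
    then show "(case (y_part Z, count Z Q) of (K, b) \<Rightarrow>
        mcoeff F (qy_mset b K) * mcoeff G (qy_mset (a - b) (M - K))) = mcoeff F Z * mcoeff G (qy_mset a M - Z)"
      by simp
  qed (auto simp: qy_mset_subset)
  also have "\<dots> = (\<Sum>K | K \<subseteq># M. \<Sum>b\<le>a. mcoeff F (qy_mset b K) * mcoeff G (qy_mset (a - b) (M - K)))"
    by (rule sum.cartesian_product[symmetric])
  finally show "fps_nth (slice (F * G) M) a = fps_nth (\<Sum>K | K \<subseteq># M. slice F K * slice G (M - K)) a"
    by (simp add: fps_sum_nth fps_mult_nth atMost_atLeast0)
qed

text \<open>An injective ring homomorphism into the series over Laurent series, through which
  identities proved with \<open>u = fls_X\<close> return to power series in q and y.\<close>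

definition laurent_mfps :: "(variable, rat) mfps \<Rightarrow> (nat, rat fls) mfps" where
  "laurent_mfps F = Abs_mfps (\<lambda>M. fps_to_fls (slice F M))"

lemma mcoeff_laurent_mfps [simp]: "mcoeff (laurent_mfps F) M = fps_to_fls (slice F M)"
  by (simp add: laurent_mfps_def)

lemma laurent_mfps_inject: "laurent_mfps F = laurent_mfps G \<Longrightarrow> F = G"
proof (rule slice_eqI)
  fix M assume "laurent_mfps F = laurent_mfps G"
  then have "mcoeff (laurent_mfps F) M = mcoeff (laurent_mfps G) M" by simp
  then show "slice F M = slice G M" by simp
qed

lemma fps_to_fls_sum: "fps_to_fls (\<Sum>x\<in>A. f x) = (\<Sum>x\<in>A. fps_to_fls (f x))"
  by (induction A rule: infinite_finite_induct) simp_all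

lemma fps_to_fls_prod: "fps_to_fls (\<Prod>x\<in>A. f x) = (\<Prod>x\<in>A. fps_to_fls (f x :: rat fps))"
  by (induction A rule: infinite_finite_induct) (simp_all add: fls_times_fps_to_fls)

lemma laurent_mfps_mult: "laurent_mfps (F * G) = laurent_mfps F * laurent_mfps G"
  by (rule mfps_eqI) (simp add: slice_mult mcoeff_times fps_to_fls_sum fls_times_fps_to_fls)

lemma slice_one: "slice 1 M = (if M = {#} then 1 else 0)"
  using qy_mset_inject[of _ M 0 "{#}"] by (intro fps_ext) (auto simp: mcoeff_one simp del: qy_mset_inject)

lemma laurent_mfps_one: "laurent_mfps 1 = 1"
proof (rule mfps_eqI)
  fix M :: "nat multiset"
  show "mcoeff (laurent_mfps 1) M = mcoeff 1 M" by (simp add: mcoeff_one slice_one)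
qed

lemma laurent_mfps_prod: "laurent_mfps (\<Prod>x\<in>A. F x) = (\<Prod>x\<in>A. laurent_mfps (F x))"
  by (induction A rule: infinite_finite_induct) (simp_all add: laurent_mfps_one laurent_mfps_mult)

text \<open>Describes the image of \<open>laurent_mfps\<close>: no negative power of q occurs in any
  coefficient.\<close>

definition integral_mfps :: "(nat, rat fls) mfps \<Rightarrow> bool" where
  "integral_mfps G \<longleftrightarrow> (\<forall>M. \<exists>f. mcoeff G M = fps_to_fls f)"

lemma integral_mfps_mult: "integral_mfps F \<Longrightarrow> integral_mfps G \<Longrightarrow> integral_mfps (F * G)"
proof -
  assume "integral_mfps F" "integral_mfps G"
  then obtain f g where "\<And>M. mcoeff F M = fps_to_fls (f M)" "\<And>M. mcoeff G M = fps_to_fls (g M)"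
    unfolding integral_mfps_def by metis
  then have "mcoeff (F * G) M = fps_to_fls (\<Sum>K | K \<subseteq># M. f K * g (M - K))" for M
    by (simp add: mcoeff_times fps_to_fls_sum fls_times_fps_to_fls)
  then show ?thesis unfolding integral_mfps_def by blast
qed

lemma integral_mfps_prod: "(\<And>x. x \<in> A \<Longrightarrow> integral_mfps (F x)) \<Longrightarrow> integral_mfps (\<Prod>x\<in>A. F x)"
proof (induction A rule: infinite_finite_induct)
  case empty
  have "mcoeff (1 :: (nat, rat fls) mfps) M = fps_to_fls (if M = {#} then 1 else 0)" for M by (simp add: mcoeff_one)
  then show ?case unfolding integral_mfps_def by (metis prod.empty)
next
  case (infinite A)
  have "mcoeff (1 :: (nat, rat fls) mfps) M = fps_to_fls (if M = {#} then 1 else 0)" for M by (simp add: mcoeff_one)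
  then show ?case unfolding integral_mfps_def using infinite by (metis prod.infinite)
qed (simp add: integral_mfps_mult)

lemma integral_mfps_preimage: "integral_mfps G \<Longrightarrow> \<exists>F. laurent_mfps F = G"
proof -
  assume "integral_mfps G"
  then obtain g where g: "\<And>M. mcoeff G M = fps_to_fls (g M)" unfolding integral_mfps_def by metis
  have "slice (Abs_mfps (\<lambda>Z. fps_nth (g (y_part Z)) (count Z Q))) M = g M" for M
    by (rule fps_ext) simp
  then have "laurent_mfps (Abs_mfps (\<lambda>Z. fps_nth (g (y_part Z)) (count Z Q))) = G"
    by (intro mfps_eqI) (simp add: g)
  then show ?thesis by blast
qed

section \<open>Monomials, inverses, and series in q alone\<close>

definition monom_mfps :: "'v multiset \<Rightarrow> ('v, 'a::comm_ring_1) mfps" where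
  "monom_mfps K = Abs_mfps (\<lambda>M. if M = K then 1 else 0)"

lemma mcoeff_mult_monom: "mcoeff (F * monom_mfps K) M = (if K \<subseteq># M then mcoeff F (M - K) else 0)"
proof -
  have "mcoeff (F * monom_mfps K) M = mcoeff (monom_mfps K * F) M" by (simp add: mult.commute)
  also have "\<dots> = (\<Sum>L | L \<subseteq># M. if L = K then mcoeff F (M - K) else 0)"
    unfolding mcoeff_times by (intro sum.cong refl) (simp add: monom_mfps_def)
  also have "\<dots> = (if K \<subseteq># M then mcoeff F (M - K) else 0)"
    by (simp add: sum.delta[OF finite_submultisets])
  finally show ?thesis .
qed

lemma monom_mfps_empty: "monom_mfps {#} = 1"
  by (rule mfps_eqI) (simp add: monom_mfps_def mcoeff_one)

lemma monom_mfps_mult: "monom_mfps K * monom_mfps L = monom_mfps (K + L)"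
proof (rule mfps_eqI)
  fix M
  show "mcoeff (monom_mfps K * monom_mfps L) M = mcoeff (monom_mfps (K + L)) M"
    unfolding mcoeff_mult_monom by (auto simp: monom_mfps_def)
qed

lemma mvar_monom: "mvar v = monom_mfps {#v#}"
  by (simp add: mvar_def monom_mfps_def)

lemma monom_mfps_power: "monom_mfps K ^ n = monom_mfps (repeat_mset n K)"
  by (induction n) (simp_all add: monom_mfps_empty monom_mfps_mult)

lemma monom_mfps_prod: "finite A \<Longrightarrow> (\<Prod>x\<in>A. monom_mfps (f x)) = monom_mfps (\<Sum>x\<in>A. f x)"
  by (induction A rule: finite_induct) (simp_all add: monom_mfps_empty monom_mfps_mult)

lemma q_power_monom: "q ^ n = monom_mfps (qy_mset n {#})"
  unfolding mvar_monom monom_mfps_power by (simp add: qy_mset_def repeat_single)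

lemma y_monomial:
  assumes "set_mset b \<subseteq> {1..l}"
  shows "(\<Prod>i=1..l. y i ^ count b i) = monom_mfps (qy_mset 0 b)"
proof -
  have "(\<Prod>i=1..l. y i ^ count b i) = monom_mfps (\<Sum>i=1..l. repeat_mset (count b i) {#Y i#})"
    unfolding mvar_monom monom_mfps_power by (rule monom_mfps_prod) simp
  also have "(\<Sum>i=1..l. repeat_mset (count b i) {#Y i#}) = qy_mset 0 b"
  proof (rule mset_variable_eqI)
    show "count (\<Sum>i=1..l. repeat_mset (count b i) {#Y i#}) Q = count (qy_mset 0 b) Q"
      by (simp add: count_sum)
    fix j
    have "count (\<Sum>i=1..l. repeat_mset (count b i) {#Y i#}) (Y j) = (\<Sum>i=1..l. if i = j then count b j else 0)"
      unfolding count_sum by (intro sum.cong refl) auto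
    also have "\<dots> = count b j" using assms by (auto simp: not_in_iff)
    finally show "count (\<Sum>i=1..l. repeat_mset (count b i) {#Y i#}) (Y j) = count (qy_mset 0 b) (Y j)" by simp
  qed
  finally show ?thesis .
qed

lemma mfps_inverse_eqI: "F * G = 1 \<Longrightarrow> inverse F = (G :: ('v, 'a::comm_ring_1) mfps)"
proof -
  assume FG: "F * G = 1"
  have "G' = G" if "F * G' = 1" for G'
  proof -
    have "G' = (F * G) * G'" by (simp add: FG)
    also have "\<dots> = G * (F * G')" by (simp only: mult_ac)
    finally show ?thesis by (simp add: that)
  qed
  then have "(THE G. F * G = 1) = G" using FG by blast
  then show ?thesis using FG by (auto simp: inverse_mfps_def)
qed

definition q_series :: "rat fps \<Rightarrow> (variable, rat) mfps" where
  "q_series f = Abs_mfps (\<lambda>Z. if y_part Z = {#} then fps_nth f (count Z Q) else 0)"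

lemma slice_q_series: "slice (q_series f) M = (if M = {#} then f else 0)"
  by (rule fps_ext) (simp add: q_series_def)

lemma slice_q_series_mult: "slice (q_series f * G) M = f * slice G M"
proof -
  have "slice (q_series f * G) M = (\<Sum>K | K \<subseteq># M. if K = {#} then f * slice G M else 0)"
    unfolding slice_mult slice_q_series by (intro sum.cong refl) simp
  then show ?thesis by (simp add: sum.delta[OF finite_submultisets])
qed

lemma q_series_mult: "q_series f * q_series g = q_series (f * g)"
  by (rule slice_eqI) (simp add: slice_q_series_mult slice_q_series)

lemma q_series_one: "q_series 1 = 1"
  by (rule slice_eqI) (simp add: slice_q_series slice_one)

lemma q_series_diff: "q_series (f - g) = q_series f - q_series g"
  by (rule mfps_eqI) (simp add: q_series_def minus_mfps_def)

lemma q_series_X: "q_series fps_X = q"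
proof (rule slice_eqI, rule fps_ext)
  fix M n
  show "fps_nth (slice (q_series fps_X) M) n = fps_nth (slice q M) n"
    using qy_mset_inject[of n M 1 "{#}"]
    by (auto simp: slice_q_series mvar_def qy_mset_def[of "Suc 0" "{#}"] simp del: qy_mset_inject)
qed

lemma q_series_power: "q_series (f ^ n) = q_series f ^ n"
  by (induction n) (simp_all add: q_series_one flip: q_series_mult)

lemma q_series_prod: "q_series (\<Prod>x\<in>A. f x) = (\<Prod>x\<in>A. q_series (f x))"
  by (induction A rule: infinite_finite_induct) (simp_all add: q_series_one flip: q_series_mult)

lemma q_series_inverse: "fps_nth f 0 \<noteq> 0 \<Longrightarrow> inverse (q_series f) = q_series (inverse f)"
  by (rule mfps_inverse_eqI) (simp add: q_series_mult inverse_mult_eq_1' q_series_one)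

definition poch_fps :: "nat \<Rightarrow> rat fps" where "poch_fps n = (\<Prod>s=1..n. 1 - fps_X ^ s)"

lemma qpoch_q: "qpoch q n = q_series (poch_fps n)"
proof -
  have "q * q ^ (s - 1) = q ^ s" if "s \<in> {1..n}" for s using that by (cases s) auto
  then show ?thesis
    by (simp add: qpoch_def poch_fps_def q_series_prod q_series_diff q_series_one q_series_power q_series_X)
qed

lemma poch_fps_nth_0: "fps_nth (poch_fps n) 0 = 1"
  unfolding poch_fps_def by (induction n) simp_all

text \<open>From here on \<open>u\<close> is q itself, made invertible.\<close>

interpretation laurent: generic_q "fls_X :: rat fls"
proof
  show "fls_X ^ n \<noteq> (1 :: rat fls)" if "n > 0" for n
  proof
    assume "fls_X ^ n = (1 :: rat fls)"
    then have "fls_nth (fls_X ^ n) 0 = (fls_nth 1 0 :: rat)" by simp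
    then show False using that by simp
  qed
qed simp

lemma fps_to_fls_poch: "fps_to_fls (poch_fps n) = laurent.qp n"
  by (simp add: poch_fps_def laurent.qp_def fps_to_fls_prod fps_to_fls_power)

lemma fps_to_fls_inverse: "fps_nth f 0 \<noteq> 0 \<Longrightarrow> fps_to_fls (inverse f) = inverse (fps_to_fls (f :: rat fps))"
  by (metis fls_times_fps_to_fls fps_one_to_fls inverse_mult_eq_1 inverse_unique mult.commute)

lemma integral_monomial_fps:
  assumes "b \<noteq> {#}" "\<And>n. \<exists>g. fps_nth f n = fps_to_fls g"
  shows "integral_mfps (monomial_fps b f)"
  unfolding integral_mfps_def
proof
  fix M
  show "\<exists>g. mcoeff (monomial_fps b f) M = fps_to_fls g"
  proof (cases "\<exists>k. M = repeat_mset k b")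
    case True
    then show ?thesis using assms by (auto simp: monomial_fps_repeat)
  next
    case False
    then have "mcoeff (monomial_fps b f) M = fps_to_fls 0" by (simp add: monomial_fps_other)
    then show ?thesis by blast
  qed
qed

lemma inverse_poch_fps_nth: "fps_nth laurent.inverse_poch_fps n = fps_to_fls (fps_X ^ n * inverse (poch_fps n))"
  by (simp add: laurent.inverse_poch_fps_def fls_times_fps_to_fls fps_to_fls_inverse poch_fps_nth_0
      fps_to_fls_poch fps_to_fls_power divide_inverse)

lemma q_monom_mult: "q ^ n * monom_mfps (qy_mset a M) = monom_mfps (qy_mset (n + a) M)"
  by (simp add: q_power_monom monom_mfps_mult qy_mset_add)

lemma laurent_one_minus_monom:
  assumes b: "b \<noteq> {#}"
  shows "laurent_mfps (1 - monom_mfps (qy_mset s b)) = monomial_fps b (1 - fps_const (fls_X ^ s) * fps_X)"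
proof (rule mfps_eqI)
  fix M
  have s: "slice (1 - monom_mfps (qy_mset s b)) M = (if M = {#} then 1 else 0) - (if M = b then fps_X ^ s else 0)"
  proof (rule fps_ext)
    fix a
    have "mcoeff 1 (qy_mset a M) = (if a = 0 \<and> M = {#} then 1 else (0::rat))"
      using qy_mset_inject[of a M 0 "{#}"] by (auto simp: mcoeff_one simp del: qy_mset_inject)
    then show "fps_nth (slice (1 - monom_mfps (qy_mset s b)) M) a =
        fps_nth ((if M = {#} then 1 else 0) - (if M = b then fps_X ^ s else 0)) a"
      by (auto simp: minus_mfps_def monom_mfps_def)
  qed
  show "mcoeff (laurent_mfps (1 - monom_mfps (qy_mset s b))) M = mcoeff (monomial_fps b (1 - fps_const (fls_X ^ s) * fps_X)) M"
  proof (cases "\<exists>k. M = repeat_mset k b")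
    case True
    then obtain k where M: "M = repeat_mset k b" by blast
    have "M = {#} \<longleftrightarrow> k = 0" "M = b \<longleftrightarrow> k = 1"
      unfolding M using repeat_mset_inject[OF b, of k 0] repeat_mset_inject[OF b, of k 1] by simp_all
    then show ?thesis
      unfolding M monomial_fps_repeat[OF b] mcoeff_laurent_mfps s[unfolded M]
      by (cases k) (auto simp: fps_to_fls_power M)
  next
    case False
    then have "M \<noteq> {#}" "M \<noteq> b" using repeat_mset_0[of b] repeat_mset_inject[OF b] by (metis, metis repeat_mset_Suc repeat_mset_0 add.right_neutral)
    then show ?thesis using False by (simp add: s monomial_fps_other)
  qed
qed

text \<open>Multiplying Euler's series for 1 / (q y; q)_infinity by the partial product
  \<open>p N\<close> gives the series for 1 / (q^(N+2) y; q)_infinity, which agrees with 1 to an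
  order that grows with \<open>N\<close>.\<close>

lemma qpoch_inf_monom:
  assumes b: "b \<noteq> {#}"
  shows "laurent_mfps (qpoch_inf (q * monom_mfps (qy_mset 0 b))) * monomial_fps b laurent.inverse_poch_fps = 1"
proof -
  define f where "f s = 1 - q * monom_mfps (qy_mset 0 b) * q ^ s" for s
  define p where "p N = (\<Prod>s\<le>N. f s)" for N
  have f: "f s = 1 - monom_mfps (qy_mset (Suc s) b)" for s
  proof -
    have "q * monom_mfps (qy_mset 0 b) * q ^ s = q ^ Suc s * monom_mfps (qy_mset 0 b)"
      by (simp add: mult_ac)
    then show ?thesis unfolding f_def q_monom_mult by simp
  qed
  have pSuc: "mcoeff (p (Suc N)) Z = mcoeff (p N) Z" if "size Z \<le> N" for N Z
  proof -
    have "\<not> qy_mset (Suc (Suc N)) b \<subseteq># Z"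
    proof
      assume "qy_mset (Suc (Suc N)) b \<subseteq># Z"
      then have "Suc (Suc N) \<le> count Z Q" by (metis count_qy_mset(1) mset_subset_eq_count)
      also have "count Z Q \<le> size Z" by (rule count_le_size)
      finally show False using that by simp
    qed
    then have "mcoeff (p N * monom_mfps (qy_mset (Suc (Suc N)) b)) Z = 0" by (simp add: mcoeff_mult_monom)
    moreover have "p (Suc N) = p N - p N * monom_mfps (qy_mset (Suc (Suc N)) b)"
      by (simp add: p_def f[of "Suc N"] right_diff_distrib)
    ultimately show ?thesis by (simp add: minus_mfps_def)
  qed
  \<comment> \<open>By \<open>pSuc\<close> the coefficient at \<open>Z\<close> is final once
    \<open>N \<ge> size Z\<close>: later factors differ from 1 only by monomials with too high a
    power of q.\<close>
  define L where "L = Abs_mfps (\<lambda>Z. mcoeff (p (size Z)) Z)"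
  have pL: "mcoeff (p N) Z = mcoeff L Z" if "size Z \<le> N" for N Z
    using that
  proof (induction N rule: dec_induct)
    case base
    show ?case by (simp add: L_def)
  next
    case (step N)
    then show ?case by (simp add: pSuc)
  qed
  have lim: "p \<longlonglongrightarrow> L"
  proof (rule topological_tendstoI)
    fix U assume "open U" "L \<in> U"
    then obtain S where S: "finite S" "\<And>G. (\<forall>m\<in>S. mcoeff G m = mcoeff L m) \<Longrightarrow> G \<in> U"
      unfolding open_mfps_def by blast
    have "\<forall>N\<ge>Max (insert 0 (size ` S)). p N \<in> U"
    proof (intro allI impI S(2) ballI)
      fix N Z assume "N \<ge> Max (insert 0 (size ` S))" "Z \<in> S"
      then have "size Z \<le> N" using S(1) by (meson Max_ge finite_imageI finite_insert imageI insertI2 order_trans)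
      then show "mcoeff (p N) Z = mcoeff L Z" by (rule pL)
    qed
    then show "\<forall>\<^sub>F N in sequentially. p N \<in> U" unfolding eventually_sequentially by blast
  qed
  have f0: "mcoeff (f s) {#} = 1" for s
    unfolding f using qy_mset_inject[of "Suc s" b 0 "{#}"]
    by (auto simp: minus_mfps_def mcoeff_one monom_mfps_def simp del: qy_mset_inject)
  have "mcoeff L {#} = 1"
    unfolding L_def p_def by (simp add: f0)
  then have L0: "L \<noteq> 0" by (auto simp: zero_mfps_def)
  \<comment> \<open>\<open>has_prod\<close> asks for a nonzero limit and treats vanishing factors
    separately; both points are settled by the constant coefficients, which are 1.\<close>
  have "prodinf f = L"
    unfolding prodinf_def
  proof (rule the_equality)
    show "f has_prod L" using lim L0 by (simp add: has_prod_def raw_has_prod_def p_def[abs_def])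
  next
    fix L' assume "f has_prod L'"
    moreover have "f i \<noteq> 0" for i using f0[of i] by (auto simp: zero_mfps_def)
    ultimately have "p \<longlonglongrightarrow> L'" by (auto simp: has_prod_def raw_has_prod_def p_def[abs_def])
    then show "L' = L" using lim LIMSEQ_unique by blast
  qed
  then have L: "qpoch_inf (q * monom_mfps (qy_mset 0 b)) = L"
    by (simp add: qpoch_inf_def f_def[abs_def])
  let ?I = "laurent.inverse_poch_fps"
  \<comment> \<open>Euler's expansion of 1 / (q^(N+1) y; q)_infinity. Multiplication by the factor
    with q^(N+1) y moves from \<open>N\<close> to \<open>Suc N\<close>.\<close>
  define I where "I N = Abs_fps (\<lambda>k. fps_to_fls (fps_X ^ (Suc N * k) * inverse (poch_fps k)))" for N
  have I0: "I 0 = ?I" by (rule fps_ext) (simp add: I_def inverse_poch_fps_nth)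
  have IS: "I N * (1 - fps_const (fls_X ^ Suc N) * fps_X) = I (Suc N)" for N
  proof (rule fps_ext)
    fix k
    show "fps_nth (I N * (1 - fps_const (fls_X ^ Suc N) * fps_X)) k = fps_nth (I (Suc N)) k"
    proof (cases k)
      case 0
      then show ?thesis by (simp add: I_def)
    next
      case (Suc j)
      have pj: "poch_fps (Suc j) = poch_fps j * (1 - fps_X ^ Suc j)" by (simp add: poch_fps_def)
      have ij: "inverse (poch_fps j) = inverse (poch_fps (Suc j)) * (1 - fps_X ^ Suc j)"
      proof -
        have "(1 - fps_X ^ Suc j) * inverse (1 - fps_X ^ Suc j) = (1 :: rat fps)"
          by (rule inverse_mult_eq_1') simp
        then show ?thesis unfolding pj fps_inverse_mult by (simp only: mult.assoc mult.left_commute mult.commute[of _ "inverse (1 - fps_X ^ Suc j)"] mult_1_right)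
      qed
      have "fps_nth (I N * (1 - fps_const (fls_X ^ Suc N) * fps_X)) k =
          fps_nth (I N) (Suc j) - fls_X ^ Suc N * fps_nth (I N) j"
        unfolding Suc right_diff_distrib by (simp add: mult.left_commute[of "I N"] mult.assoc[symmetric] mult.commute[of _ "fps_const _"])
      also have "\<dots> = fps_to_fls (fps_X ^ (Suc N * Suc j) * inverse (poch_fps (Suc j)) -
          fps_X ^ Suc N * (fps_X ^ (Suc N * j) * inverse (poch_fps j)))"
        by (simp only: I_def fps_nth_Abs_fps fps_to_fls_minus fls_times_fps_to_fls fps_to_fls_power fps_X_to_fls)
      also have "fps_X ^ (Suc N * Suc j) * inverse (poch_fps (Suc j)) -
          fps_X ^ Suc N * (fps_X ^ (Suc N * j) * inverse (poch_fps j)) =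
          fps_X ^ (Suc (Suc N) * Suc j) * inverse (poch_fps (Suc j))"
      proof -
        have r: "x * i - x * (i * (1 - z)) = x * z * i" for x z i :: "'b::comm_ring_1" by (simp add: algebra_simps)
        have "fps_X ^ Suc N * (fps_X ^ (Suc N * j) * inverse (poch_fps j)) = fps_X ^ (Suc N * Suc j) * inverse (poch_fps j)"
          by (simp only: mult.assoc[symmetric] power_add[symmetric] mult_Suc_right)
        moreover have "fps_X ^ (Suc (Suc N) * Suc j) = (fps_X ^ (Suc N * Suc j) * fps_X ^ Suc j :: rat fps)"
          by (simp only: power_add[symmetric] mult_Suc add.commute)
        ultimately show ?thesis unfolding ij using r by metis
      qed
      finally show ?thesis by (simp add: Suc I_def)
    qed
  qed
  have Ip: "laurent_mfps (p N) * monomial_fps b ?I = monomial_fps b (I (Suc N))" for N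
  proof (induction N)
    case 0
    show ?case
      unfolding p_def atMost_0 prod.insert[OF finite.emptyI empty_iff[THEN iffD1, THEN notI]] f
      by (simp add: laurent_one_minus_monom[OF b] IS[symmetric] I0[symmetric] monomial_fps_mult[OF b, symmetric] mult.commute)
  next
    case (Suc N)
    have "laurent_mfps (p (Suc N)) * monomial_fps b ?I = (laurent_mfps (p N) * monomial_fps b ?I) * laurent_mfps (f (Suc N))"
      by (simp add: p_def laurent_mfps_mult mult_ac)
    also have "\<dots> = monomial_fps b (I (Suc (Suc N)))"
      unfolding Suc f laurent_one_minus_monom[OF b] monomial_fps_mult[OF b, symmetric] IS ..
    finally show ?case .
  qed
  have "integral_mfps (monomial_fps b ?I)"
    by (rule integral_monomial_fps[OF b]) (use inverse_poch_fps_nth in blast)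
  then obtain J where J: "laurent_mfps J = monomial_fps b ?I" using integral_mfps_preimage by blast
  \<comment> \<open>For \<open>k > 0\<close> the coefficient at \<open>k\<close> of
    \<open>I (Suc N)\<close> is divisible by \<open>fps_X ^ Suc (Suc N)\<close>, hence invisible at
    powers of q up to \<open>N\<close>.\<close>
  have Jp: "mcoeff (p N * J) Z = mcoeff 1 Z" if "size Z \<le> N" for N Z
  proof -
    define M where "M = y_part Z"
    define a where "a = count Z Q"
    have a: "a \<le> N" using count_le_size[of Z Q] that by (simp add: a_def)
    have Z: "Z = qy_mset a M" by (simp add: a_def M_def)
    have e: "fps_to_fls (slice (p N * J) M) = mcoeff (monomial_fps b (I (Suc N))) M"
      using Ip[of N] J by (metis laurent_mfps_mult mcoeff_laurent_mfps)
    have one: "mcoeff 1 Z = (fps_nth (if M = {#} then 1 else 0) a :: rat)"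
      unfolding Z slice_one[symmetric] by simp
    show ?thesis
    proof (cases "\<exists>k. M = repeat_mset k b")
      case True
      then obtain k where M: "M = repeat_mset k b" by blast
      have sl: "slice (p N * J) M = fps_X ^ (Suc (Suc N) * k) * inverse (poch_fps k)"
        using e unfolding M monomial_fps_repeat[OF b] by (simp only: I_def fps_nth_Abs_fps fps_to_fls_eq_iff)
      show ?thesis
      proof (cases "k = 0")
        case True
        then have M0: "M = {#}" by (simp add: M)
        have "slice (p N * J) M = 1" unfolding sl by (simp add: True poch_fps_def)
        then show ?thesis unfolding one by (simp only: Z slice_nth[symmetric] M0 if_True simp_thms)
      next
        case False
        then have "M \<noteq> {#}" using repeat_mset_inject[OF b, of k 0] by (simp add: M)
        moreover have "Suc (Suc N) \<le> Suc (Suc N) * k" using False by (cases k) auto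
        then have "a < Suc (Suc N) * k" by (rule less_le_trans[rotated]) (rule le_imp_less_Suc[OF le_SucI[OF a]])
        then have "fps_nth (slice (p N * J) M) a = 0" unfolding sl fps_nth_X_power_mult by simp
        ultimately show ?thesis unfolding one by (simp add: Z)
      qed
    next
      case False
      then have "M \<noteq> {#}" by (metis repeat_mset_0)
      moreover have "slice (p N * J) M = 0" using e False by (simp add: monomial_fps_other)
      then have "fps_nth (slice (p N * J) M) a = 0" by simp
      ultimately show ?thesis unfolding one by (simp add: Z)
    qed
  qed
  have "L * J = 1"
  proof (rule mfps_eqI)
    fix Z
    have "mcoeff (L * J) Z = (\<Sum>K | K \<subseteq># Z. mcoeff (p (size Z)) K * mcoeff J (Z - K))"
      unfolding mcoeff_times by (intro sum.cong refl) (simp add: pL size_mset_mono)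
    then show "mcoeff (L * J) Z = mcoeff 1 Z" using Jp[of Z "size Z"] by (simp add: mcoeff_times)
  qed
  then show ?thesis unfolding L J[symmetric] laurent_mfps_mult[symmetric] by (simp add: laurent_mfps_one)
qed


section \<open>The sum side in the ring of power series in q and y\<close>

locale laurent_sum = dynkin_sum "fls_X :: rat fls" l pr m for l pr m
begin

definition denominator_fps :: "(nat \<Rightarrow> nat \<Rightarrow> nat) \<Rightarrow> rat fps" where
  "denominator_fps r = (\<Prod>i=1..l. \<Prod>j\<in>seq_supp (r i). poch_fps (r i j - r i (j + 1)))"

lemma denominator_fps_nth_0: "fps_nth (denominator_fps r) 0 = 1"
proof -
  have p: "fps_nth (\<Prod>x\<in>A. f x) 0 = 1" if "\<And>x. fps_nth (f x) 0 = 1" for f :: "nat \<Rightarrow> rat fps" and A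
    by (induction A rule: infinite_finite_induct) (simp_all add: that)
  show ?thesis unfolding denominator_fps_def by (intro p poch_fps_nth_0)
qed

lemma tuple_weight_eq:
  "tuple_weight r = fls_X powi (q_exponent l pr m r) * fps_to_fls (inverse (denominator_fps r))"
proof -
  have "fps_to_fls (denominator_fps r) = (\<Prod>i=1..l. \<Prod>j\<in>seq_supp (r i). qp (r i j - r i (j + 1)))"
    by (simp add: denominator_fps_def fps_to_fls_prod fps_to_fls_poch)
  then show ?thesis
    by (simp only: tuple_weight_def divide_inverse fps_to_fls_inverse denominator_fps_nth_0 one_neq_zero simp_thms)
qed

lemma fls_X_powi_mult_nth: "fls_nth (fls_X powi e * fps_to_fls f) k = (if k < e then 0 else fps_nth f (nat (k - e)))"
  for f :: "rat fps"
  by (simp add: fls_X_intpow_times_conv_shift)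

text \<open>The denominators have constant term 1, so every summand starts with coefficient 1 at its
  exponent of q. The coefficient at the least exponent \<open>e0\<close> therefore counts the
  minimizing tuples, and it could not be positive in a power series if \<open>e0\<close> were
  negative.\<close>

lemma q_exponent_nonneg:
  assumes int: "fps_to_fls f = sum_coeff n" and r: "r \<in> tuples l n"
  shows "q_exponent l pr m r \<ge> 0"
proof -
  let ?e = "q_exponent l pr m"
  define e0 where "e0 = Min (?e ` tuples l n)"
  have fin: "finite (?e ` tuples l n)" by (simp add: finite_tuples)
  have le: "e0 \<le> ?e r" if "r \<in> tuples l n" for r
    unfolding e0_def by (rule Min_le[OF fin]) (use that in blast)
  have "e0 \<in> ?e ` tuples l n" unfolding e0_def by (rule Min_in[OF fin]) (use r in blast)
  then obtain r0 where r0: "r0 \<in> tuples l n" "?e r0 = e0" by blast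
  have "fls_nth (tuple_weight r) e0 = (if ?e r = e0 then 1 else 0)" if "r \<in> tuples l n" for r
    using le[OF that] unfolding tuple_weight_eq fls_X_powi_mult_nth by (auto simp: denominator_fps_nth_0)
  then have "fls_nth (sum_coeff n) e0 = (\<Sum>r\<in>tuples l n. if ?e r = e0 then 1 else 0)"
    unfolding sum_coeff_def fls_nth_sum by (intro sum.cong refl)
  also have "\<dots> > 0" by (rule sum_pos2[OF finite_tuples r0(1)]) (auto simp: r0(2))
  finally have "fls_nth (fps_to_fls f) e0 \<noteq> 0" unfolding int by simp
  then have "e0 \<ge> 0" by (auto split: if_splits)
  then show ?thesis using le[OF r] by linarith
qed

definition tuple_fps :: "(nat \<Rightarrow> nat \<Rightarrow> nat) \<Rightarrow> rat fps" where
  "tuple_fps r = fps_X ^ nat (q_exponent l pr m r) * inverse (denominator_fps r)"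

definition tuple_degree :: "(nat \<Rightarrow> nat \<Rightarrow> nat) \<Rightarrow> nat multiset" where
  "tuple_degree r = (\<Sum>i=1..l. replicate_mset (weight r i) i)"

lemma count_tuple_degree: "count (tuple_degree r) j = (if j \<in> {1..l} then weight r j else 0)"
proof -
  have "count (tuple_degree r) j = (\<Sum>i=1..l. if i = j then weight r j else 0)"
    unfolding tuple_degree_def count_sum by (intro sum.cong refl) auto
  then show ?thesis by simp
qed

lemma set_tuple_degree: "set_mset (tuple_degree r) \<subseteq> {1..l}"
proof
  fix x assume "x \<in># tuple_degree r"
  then have "count (tuple_degree r) x \<noteq> 0" by simp
  then show "x \<in> {1..l}" unfolding count_tuple_degree by (rule contrapos_np) (rule if_not_P)
qed

lemma tuples_iff_degree:
  "r \<in> descending_tuples l \<and> M = tuple_degree r \<longleftrightarrow> set_mset M \<subseteq> {1..l} \<and> r \<in> tuples l (count M)"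
proof
  assume "r \<in> descending_tuples l \<and> M = tuple_degree r"
  then show "set_mset M \<subseteq> {1..l} \<and> r \<in> tuples l (count M)"
    using set_tuple_degree[of r] unfolding tuples_def by (auto simp: count_tuple_degree)
next
  assume M: "set_mset M \<subseteq> {1..l} \<and> r \<in> tuples l (count M)"
  have "M = tuple_degree r"
  proof (rule multiset_eqI)
    fix j show "count M j = count (tuple_degree r) j"
      using M by (auto simp: count_tuple_degree tuples_def not_in_iff)
  qed
  then show "r \<in> descending_tuples l \<and> M = tuple_degree r" using M by (simp add: tuples_def)
qed

lemma slice_summand: "slice (summand l pr m r) M = (if M = tuple_degree r then tuple_fps r else 0)"
proof -
  have d: "q_denominator l r = q_series (denominator_fps r)"
    by (simp add: q_denominator_def denominator_fps_def q_series_prod qpoch_q)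
  have "(\<Prod>i=1..l. y i ^ weight r i) = (\<Prod>i=1..l. y i ^ count (tuple_degree r) i)"
    by (intro prod.cong refl) (simp add: count_tuple_degree)
  also have "\<dots> = monom_mfps (qy_mset 0 (tuple_degree r))" by (rule y_monomial[OF set_tuple_degree])
  finally have "summand l pr m r = q_series (tuple_fps r) * monom_mfps (qy_mset 0 (tuple_degree r))"
    unfolding summand_def divide_mfps_def d q_series_X[symmetric] q_series_power[symmetric] tuple_fps_def
    by (simp only: q_series_inverse denominator_fps_nth_0 q_series_mult one_neq_zero simp_thms)
  moreover have "slice (monom_mfps (qy_mset 0 (tuple_degree r))) M = (if M = tuple_degree r then 1 else 0)"
    by (rule fps_ext) (auto simp: monom_mfps_def)
  ultimately show ?thesis by (simp add: slice_q_series_mult)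
qed

text \<open>In the product topology it suffices to watch finitely many coefficients, and the one at
  \<open>Z\<close> is affected only by the finitely many tuples in \<open>T Z\<close>.\<close>

lemma summand_has_sum_aux:
  assumes V: "\<And>M. slice V M = (if set_mset M \<subseteq> {1..l} then \<Sum>r\<in>tuples l (count M). tuple_fps r else 0)"
  shows "(summand l pr m has_sum V) (descending_tuples l)"
  unfolding has_sum_def
proof (rule topological_tendstoI)
  fix U assume "open U" "V \<in> U"
  then obtain S where S: "finite S" "\<And>G. (\<forall>Z\<in>S. mcoeff G Z = mcoeff V Z) \<Longrightarrow> G \<in> U"
    unfolding open_mfps_def by blast
  define T where "T Z = {r \<in> descending_tuples l. y_part Z = tuple_degree r}" for Z
  have T: "T Z = (if set_mset (y_part Z) \<subseteq> {1..l} then tuples l (count (y_part Z)) else {})" for Z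
    unfolding T_def tuples_iff_degree by auto
  have finT: "finite (T Z)" for Z unfolding T by (simp add: finite_tuples)
  have coeff: "mcoeff (summand l pr m r) Z = (if y_part Z = tuple_degree r then fps_nth (tuple_fps r) (count Z Q) else 0)" for r Z
  proof -
    have "mcoeff (summand l pr m r) Z = fps_nth (slice (summand l pr m r) (y_part Z)) (count Z Q)" by simp
    then show ?thesis unfolding slice_summand by simp
  qed
  have "sum (summand l pr m) A \<in> U" if A: "finite A" "(\<Union>Z\<in>S. T Z) \<subseteq> A" "A \<subseteq> descending_tuples l" for A
  proof (rule S(2), rule ballI)
    fix Z assume Z: "Z \<in> S"
    have "mcoeff (sum (summand l pr m) A) Z = (\<Sum>r\<in>A. mcoeff (summand l pr m r) Z)"
      using A(1) by (induction A rule: finite_induct) (simp_all add: zero_mfps_def plus_mfps_def)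
    also have "\<dots> = (\<Sum>r\<in>T Z. fps_nth (tuple_fps r) (count Z Q))"
    proof (rule sum.mono_neutral_cong_right[OF A(1)])
      show "T Z \<subseteq> A" using A(2) Z by blast
      show "\<forall>r\<in>A - T Z. mcoeff (summand l pr m r) Z = 0" using A(3) by (auto simp: T_def coeff)
      show "mcoeff (summand l pr m r) Z = fps_nth (tuple_fps r) (count Z Q)" if "r \<in> T Z" for r
        using that by (simp add: T_def coeff)
    qed
    also have "\<dots> = fps_nth (slice V (y_part Z)) (count Z Q)"
      unfolding V T by (simp add: fps_sum_nth)
    finally show "mcoeff (sum (summand l pr m) A) Z = mcoeff V Z" by simp
  qed
  then show "\<forall>\<^sub>F A in finite_subsets_at_top (descending_tuples l). sum (summand l pr m) A \<in> U"
    unfolding eventually_finite_subsets_at_top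
    using S(1) finT by (intro exI[of _ "\<Union>Z\<in>S. T Z"]) (auto simp: T_def)
qed

theorem summand_has_sum:
  assumes fin: "finite R" and ne: "{#} \<notin> R" and supp: "\<And>b. b \<in> R \<Longrightarrow> set_mset b \<subseteq> {1..l}"
    and prod: "sum_mfps * (\<Prod>b\<in>R. monomial_fps b (inverse inverse_poch_fps)) = 1"
  shows "(summand l pr m has_sum (1 / (\<Prod>b\<in>R. qpoch_inf (q * (\<Prod>i=1..l. y i ^ count b i))))) (descending_tuples l)"
proof -
  let ?I = "\<Prod>b\<in>R. monomial_fps b inverse_poch_fps" and ?E = "\<Prod>b\<in>R. monomial_fps b (inverse inverse_poch_fps)"
  have b0: "b \<noteq> {#}" if "b \<in> R" for b using ne that by blast
  have "inverse_poch_fps * inverse inverse_poch_fps = 1"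
    by (rule inverse_mult_eq_1') (simp add: inverse_poch_fps_def)
  then have "?I * ?E = 1"
    unfolding prod.distrib[symmetric]
    by (intro prod.neutral ballI) (simp add: b0 monomial_fps_one flip: monomial_fps_mult)
  then have sum_eq: "sum_mfps = ?I"
  proof -
    have "sum_mfps = sum_mfps * (?I * ?E)" using \<open>?I * ?E = 1\<close> by simp
    also have "\<dots> = (sum_mfps * ?E) * ?I" by (simp only: mult_ac)
    finally show ?thesis unfolding prod by simp
  qed
  \<comment> \<open>Integrality is visible on the product side; transported to the sum side it is
    what \<open>q_exponent_nonneg\<close> asks for.\<close>
  have "integral_mfps ?I"
    by (intro integral_mfps_prod integral_monomial_fps b0) (assumption, rule exI, rule inverse_poch_fps_nth)
  then have int: "\<exists>f. mcoeff sum_mfps M = fps_to_fls f" for M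
    unfolding sum_eq integral_mfps_def by blast
  define V where "V = Abs_mfps (\<lambda>Z. fps_nth (if set_mset (y_part Z) \<subseteq> {1..l}
      then \<Sum>r\<in>tuples l (count (y_part Z)). tuple_fps r else 0) (count Z Q))"
  have V: "slice V M = (if set_mset M \<subseteq> {1..l} then \<Sum>r\<in>tuples l (count M). tuple_fps r else 0)" for M
    by (rule fps_ext) (simp add: V_def)
  have "laurent_mfps V = sum_mfps"
  proof (rule mfps_eqI)
    fix M
    show "mcoeff (laurent_mfps V) M = mcoeff sum_mfps M"
    proof (cases "set_mset M \<subseteq> {1..l}")
      case True
      then have s: "mcoeff sum_mfps M = sum_coeff (count M)" by (simp only: sum_mfps_def mcoeff_Abs_mfps if_True simp_thms)
      obtain f where f: "fps_to_fls f = sum_coeff (count M)" using int[of M] s by metis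
      have "tuple_weight r = fps_to_fls (tuple_fps r)" if "r \<in> tuples l (count M)" for r
      proof -
        have "fls_X powi (q_exponent l pr m r) = (fls_X :: rat fls) ^ nat (q_exponent l pr m r)"
          using q_exponent_nonneg[OF f that] by (simp only: power_int_def if_True simp_thms)
        then show ?thesis
          unfolding tuple_weight_eq tuple_fps_def fls_times_fps_to_fls by (simp add: fps_to_fls_power)
      qed
      then have "sum_coeff (count M) = fps_to_fls (\<Sum>r\<in>tuples l (count M). tuple_fps r)"
        unfolding sum_coeff_def fps_to_fls_sum by (rule sum.cong[OF refl])
      then show ?thesis unfolding s mcoeff_laurent_mfps V using True by (simp only: if_True simp_thms)
    next
      case False
      then show ?thesis unfolding mcoeff_laurent_mfps V sum_mfps_def mcoeff_Abs_mfps
        by (simp only: if_False fps_zero_to_fls)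
    qed
  qed
  let ?P = "\<Prod>b\<in>R. qpoch_inf (q * (\<Prod>i=1..l. y i ^ count b i))"
  have "laurent_mfps ?P * ?I = 1"
    unfolding laurent_mfps_prod prod.distrib[symmetric]
  proof (rule prod.neutral, rule ballI)
    fix b assume b: "b \<in> R"
    show "laurent_mfps (qpoch_inf (q * (\<Prod>i=1..l. y i ^ count b i))) * monomial_fps b inverse_poch_fps = 1"
      unfolding y_monomial[OF supp[OF b]] by (rule qpoch_inf_monom[OF b0[OF b]])
  qed
  then have "laurent_mfps (?P * V) = laurent_mfps 1"
    unfolding laurent_mfps_mult \<open>laurent_mfps V = sum_mfps\<close> sum_eq laurent_mfps_one .
  then have "?P * V = 1" by (rule laurent_mfps_inject)
  then have "1 / ?P = V" by (simp add: divide_mfps_def mfps_inverse_eqI)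
  then show ?thesis using summand_has_sum_aux[OF V] by simp
qed

end

section \<open>Roots of simple Lie algebras\<close>

context lie_algebra
begin

lemma bracket_add_right: "bracket x (w + z) = bracket x w + bracket x z"
  and bracket_scale_right: "bracket x (scale c z) = scale c (bracket x z)"
  and bracket_add_left: "bracket (w + z) x = bracket w x + bracket z x"
  and bracket_scale_left: "bracket (scale c z) x = scale c (bracket z x)"
proof -
  interpret r: Vector_Spaces.linear scale scale "bracket x" by (rule bracket_linear_right)
  interpret l: Vector_Spaces.linear scale scale "\<lambda>z. bracket z x" by (rule bracket_linear_left)
  show "bracket x (w + z) = bracket x w + bracket x z" by (rule r.add)
  show "bracket x (scale c z) = scale c (bracket x z)" by (rule r.scale)
  show "bracket (w + z) x = bracket w x + bracket z x" by (rule l.add)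
  show "bracket (scale c z) x = scale c (bracket z x)" by (rule l.scale)
qed

lemma bracket_zero_right [simp]: "bracket x 0 = 0"
  using bracket_scale_right[of x 0 0] by simp

lemma bracket_zero_left [simp]: "bracket 0 x = 0"
  using bracket_scale_left[of 0 0 x] by simp

lemma bracket_minus_right: "bracket x (- z) = - bracket x z"
  using bracket_scale_right[of x "-1" z] by simp

lemma bracket_minus_left: "bracket (- z) x = - bracket z x"
  using bracket_scale_left[of "-1" z x] by simp

lemma bracket_diff_right: "bracket x (w - z) = bracket x w - bracket x z"
  using bracket_add_right[of x w "- z"] by (simp add: bracket_minus_right)

lemma bracket_sum_right: "bracket x (\<Sum>i\<in>I. f i) = (\<Sum>i\<in>I. bracket x (f i))"
  by (induction I rule: infinite_finite_induct) (simp_all add: bracket_add_right)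

lemma bracket_swap: "bracket x z = - bracket z x"
proof -
  have "bracket x z + bracket z x = bracket (x + z) (x + z)"
    unfolding bracket_add_left bracket_add_right by (simp add: bracket_alternating)
  then have "bracket x z + bracket z x = 0" by (simp only: bracket_alternating)
  then show ?thesis by (simp add: eq_neg_iff_add_eq_0)
qed

lemma bracket_bracket: "bracket x (bracket z w) = bracket (bracket x z) w + bracket z (bracket x w)"
proof -
  have "bracket x (bracket z w) + bracket z (bracket w x) + bracket w (bracket x z) = 0" by (rule jacobi)
  moreover have "bracket z (bracket w x) = - bracket z (bracket x w)"
    by (subst bracket_swap[of w x]) (rule bracket_minus_right)
  moreover have "bracket w (bracket x z) = - bracket (bracket x z) w" by (rule bracket_swap)
  ultimately show ?thesis by (simp add: algebra_simps)
qed

text \<open>Applying \<open>bracket h\<close> minus \<open>f k h\<close> to the relation removes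
  \<open>x k\<close> and multiplies \<open>x i\<close> by a scalar that is nonzero if
  \<open>h\<close> separates \<open>i\<close> from \<open>k\<close>.\<close>

lemma joint_eigenvectors_independent:
  assumes "finite I"
    and "\<And>i j. i \<in> I \<Longrightarrow> j \<in> I \<Longrightarrow> i \<noteq> j \<Longrightarrow> \<exists>h\<in>S. f i h \<noteq> f j h"
    and "\<And>i h. i \<in> I \<Longrightarrow> h \<in> S \<Longrightarrow> bracket h (x i) = scale (f i h) (x i)"
    and "(\<Sum>i\<in>I. x i) = 0"
  shows "\<forall>i\<in>I. x i = 0"
  using assms
proof (induction I arbitrary: x rule: finite_induct)
  case empty
  then show ?case by simp
next
  case (insert k I)
  have "x i = 0" if i: "i \<in> I" for i
  proof -
    have "i \<noteq> k" using insert.hyps i by blast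
    then obtain h where h: "h \<in> S" "f i h \<noteq> f k h" using insert.prems(1)[of i k] i by blast
    have "\<forall>j\<in>I. scale (f j h - f k h) (x j) = 0"
    proof (rule insert.IH)
      fix j g assume j: "j \<in> I" "g \<in> S"
      show "bracket g (scale (f j h - f k h) (x j)) = scale (f j g) (scale (f j h - f k h) (x j))"
        using insert.prems(2)[of j g] j by (simp add: bracket_scale_right mult.commute)
    next
      have "0 = bracket h (\<Sum>j\<in>insert k I. x j) - scale (f k h) (\<Sum>j\<in>insert k I. x j)"
        using insert.prems(3) by simp
      also have "\<dots> = (\<Sum>j\<in>insert k I. bracket h (x j) - scale (f k h) (x j))"
        by (simp only: bracket_sum_right scale_sum_right sum_subtractf)
      also have "\<dots> = (\<Sum>j\<in>insert k I. scale (f j h - f k h) (x j))"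
        by (intro sum.cong refl) (simp add: insert.prems(2) h scale_left_diff_distrib)
      finally show "(\<Sum>j\<in>I. scale (f j h - f k h) (x j)) = 0"
        using insert.hyps by simp
    qed (use insert.prems(1) in blast)
    then have "scale (f i h - f k h) (x i) = 0" using i by blast
    then show ?thesis using h by simp
  qed
  moreover from this have "x k = 0" using insert.prems(3) insert.hyps by simp
  ultimately show ?case by simp
qed

text \<open>The finite dimension is exploited through this lemma in two places: sl2-strings end, and
  there are finitely many roots.\<close>

lemma joint_eigenvectors_finite:
  assumes "\<And>i j. i \<in> I \<Longrightarrow> j \<in> I \<Longrightarrow> i \<noteq> j \<Longrightarrow> \<exists>h\<in>S. f i h \<noteq> f j h"
    and "\<And>i h. i \<in> I \<Longrightarrow> h \<in> S \<Longrightarrow> bracket h (x i) = scale (f i h) (x i)"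
    and "\<And>i. i \<in> I \<Longrightarrow> x i \<noteq> 0"
  shows "finite I"
proof -
  have inj: "inj_on x I"
  proof (rule inj_onI, rule ccontr)
    fix i j assume ij: "i \<in> I" "j \<in> I" "x i = x j" "i \<noteq> j"
    then obtain h where h: "h \<in> S" "f i h \<noteq> f j h" using assms(1) by blast
    have "scale (f i h) (x i) = scale (f j h) (x i)"
      using assms(2)[OF ij(1) h(1)] assms(2)[OF ij(2) h(1)] unfolding ij(3) by (rule trans[OF sym])
    then show False using h(2) assms(3)[OF ij(1)] by simp
  qed
  have "independent (x ` I)"
  proof
    assume "dependent (x ` I)"
    then obtain t u where t: "finite t" "t \<subseteq> x ` I" "(\<Sum>v\<in>t. scale (u v) v) = 0" "\<exists>v\<in>t. u v \<noteq> 0"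
      unfolding dependent_explicit by blast
    then obtain J where J: "J \<subseteq> I" "t = x ` J" by (meson subset_imageE)
    have injJ: "inj_on x J" using inj J(1) by (rule inj_on_subset)
    have "\<forall>i\<in>J. scale (u (x i)) (x i) = 0"
    proof (rule joint_eigenvectors_independent[where S = S and f = f])
      show "finite J" using t(1) J(2) injJ by (metis finite_imageD)
      show "(\<Sum>i\<in>J. scale (u (x i)) (x i)) = 0" using t(3) unfolding J(2) by (simp add: sum.reindex[OF injJ])
      fix i h assume "i \<in> J" "h \<in> S"
      then show "bracket h (scale (u (x i)) (x i)) = scale (f i h) (scale (u (x i)) (x i))"
        using assms(2)[of i h] J(1) by (simp add: bracket_scale_right mult.commute subsetD)
    qed (use assms(1) J(1) in blast)
    then show False using t(4) assms(3) J by auto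
  qed
  moreover obtain B where "finite B" "span B = UNIV" using finite_dimensional by blast
  ultimately have "finite (x ` I)" using independent_span_bound[of B "x ` I"] by simp
  then show ?thesis using inj by (rule finite_imageD)
qed

definition sl2 :: "'a \<Rightarrow> 'a \<Rightarrow> 'a \<Rightarrow> bool" where
  "sl2 e f h \<longleftrightarrow> bracket e f = h \<and> bracket h e = scale 2 e \<and> bracket h f = scale (- 2) f"

lemma sl2_swap: "sl2 e f h \<Longrightarrow> sl2 f e (- h)"
  using bracket_swap[of f e] by (simp add: sl2_def bracket_minus_left)

lemma sl2_raise:
  assumes "bracket h e = scale d e" "bracket h x = scale c x"
  shows "bracket h ((bracket e ^^ k) x) = scale (c + of_nat k * d) ((bracket e ^^ k) x)"
proof (induction k)
  case (Suc k)
  let ?v = "(bracket e ^^ k) x"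
  have "bracket h (bracket e ?v) = bracket (bracket h e) ?v + bracket e (bracket h ?v)"
    by (rule bracket_bracket)
  also have "\<dots> = scale d (bracket e ?v) + scale (c + of_nat k * d) (bracket e ?v)"
    unfolding Suc assms by (simp only: bracket_scale_left bracket_scale_right)
  also have "\<dots> = scale (c + of_nat (Suc k) * d) (bracket e ?v)"
  proof -
    have "d + (c + of_nat k * d) = c + of_nat (Suc k) * d" by (simp add: algebra_simps)
    then show ?thesis by (simp only: scale_left_distrib[symmetric])
  qed
  finally show ?case by simp
qed (simp add: assms)

lemma sl2_lower:
  assumes s: "sl2 e f h" and v: "bracket e v = 0" "bracket h v = scale c v"
  shows "bracket e ((bracket f ^^ Suc j) v) = scale (of_nat (Suc j) * (c - of_nat j)) ((bracket f ^^ j) v)"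
proof (induction j)
  case 0
  have "bracket e (bracket f v) = bracket (bracket e f) v + bracket f (bracket e v)" by (rule bracket_bracket)
  then show ?case using s v by (simp add: sl2_def)
next
  case (Suc j)
  let ?w = "(bracket f ^^ Suc j) v"
  have h: "bracket h ?w = scale (c + of_nat (Suc j) * (- 2)) ?w"
    by (rule sl2_raise) (use s v in \<open>simp_all add: sl2_def\<close>)
  have "bracket e (bracket f ?w) = bracket (bracket e f) ?w + bracket f (bracket e ?w)" by (rule bracket_bracket)
  also have "bracket e f = h" using s by (simp add: sl2_def)
  also have "bracket f (bracket e ?w) = scale (of_nat (Suc j) * (c - of_nat j)) ?w"
    unfolding Suc by (simp add: bracket_scale_right)
  finally have "bracket e (bracket f ?w) =
      scale (c + of_nat (Suc j) * (- 2) + of_nat (Suc j) * (c - of_nat j)) ?w"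
    unfolding h by (simp only: scale_left_distrib)
  also have "c + of_nat (Suc j) * (- 2) + of_nat (Suc j) * (c - of_nat j) = of_nat (Suc (Suc j)) * (c - of_nat (Suc j))"
    by (simp add: algebra_simps)
  finally show ?case by simp
qed

text \<open>The vectors obtained by raising \<open>x\<close> have distinct eigenvalues
  \<open>c + 2 k\<close> under \<open>h\<close>, so they cannot all be nonzero.\<close>

lemma sl2_top:
  assumes s: "sl2 e f h" and x: "x \<noteq> 0" "bracket h x = scale c x"
  obtains k where "(bracket e ^^ k) x \<noteq> 0" "bracket e ((bracket e ^^ k) x) = 0"
proof -
  have "\<exists>k. (bracket e ^^ k) x = 0"
  proof (rule ccontr)
    assume n: "\<nexists>k. (bracket e ^^ k) x = 0"
    have "finite (UNIV :: nat set)"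
    proof (rule joint_eigenvectors_finite[where S = "{h}" and f = "\<lambda>k _. c + of_nat k * 2" and x = "\<lambda>k. (bracket e ^^ k) x"])
      fix k g assume "g \<in> {h}"
      then show "bracket g ((bracket e ^^ k) x) = scale (c + of_nat k * 2) ((bracket e ^^ k) x)"
        using sl2_raise[of h e 2 x c k] s x by (simp add: sl2_def)
    qed (use n in auto)
    then show False by simp
  qed
  define m where "m = (LEAST k. (bracket e ^^ k) x = 0)"
  have m: "(bracket e ^^ m) x = 0" unfolding m_def using \<open>\<exists>k. _\<close> by (rule LeastI_ex)
  then obtain k where k: "m = Suc k" using x by (cases m) auto
  have "(bracket e ^^ k) x \<noteq> 0" using not_less_Least[of k "\<lambda>k. (bracket e ^^ k) x = 0"] k by (simp add: m_def)
  then show thesis using m unfolding k by (intro that[of k]) simp_all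
qed

text \<open>If f^N v is the last nonzero vector, then 0 = e f^(N+1) v = (N + 1) (c - N) f^N v forces
  c = N.\<close>

lemma sl2_primitive:
  assumes s: "sl2 e f h" and v: "v \<noteq> 0" "bracket e v = 0" "bracket h v = scale c v"
  obtains N where "c = of_nat N" "\<And>j. j \<le> N \<Longrightarrow> (bracket f ^^ j) v \<noteq> 0"
proof -
  have hv: "bracket (- h) v = scale (- c) v" using v(3) by (simp add: bracket_minus_left)
  obtain N where N: "(bracket f ^^ N) v \<noteq> 0" "bracket f ((bracket f ^^ N) v) = 0"
    by (rule sl2_top[OF sl2_swap[OF s] v(1) hv])
  have "scale (of_nat (Suc N) * (c - of_nat N)) ((bracket f ^^ N) v) = bracket e ((bracket f ^^ Suc N) v)"
    by (rule sl2_lower[OF s v(2,3), symmetric])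
  also have "\<dots> = 0" using N(2) by simp
  finally have "c = of_nat N" using N(1) by (simp del: of_nat_Suc)
  moreover have "(bracket f ^^ j) v \<noteq> 0" if "j \<le> N" for j
  proof
    assume "(bracket f ^^ j) v = 0"
    moreover have "(bracket f ^^ N) v = (bracket f ^^ (N - j)) ((bracket f ^^ j) v)"
      using that by (simp flip: funpow_add comp_apply[of "bracket f ^^ (N - j)"])
    moreover have "(bracket f ^^ i) 0 = 0" for i by (induction i) simp_all
    ultimately show False using N(1) by simp
  qed
  ultimately show thesis by (rule that)
qed

lemma sl2_string:
  assumes s: "sl2 e f h" and x: "x \<noteq> 0" "bracket h x = scale c x"
  obtains k N where "c + 2 * of_nat k = of_nat N" "\<And>j. j \<le> N \<Longrightarrow> (bracket f ^^ j) ((bracket e ^^ k) x) \<noteq> 0"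
proof -
  obtain k where k: "(bracket e ^^ k) x \<noteq> 0" "bracket e ((bracket e ^^ k) x) = 0"
    by (rule sl2_top[OF s x])
  have hk: "bracket h ((bracket e ^^ k) x) = scale (c + of_nat k * 2) ((bracket e ^^ k) x)"
    by (rule sl2_raise) (use s x in \<open>simp_all add: sl2_def\<close>)
  obtain N where "c + of_nat k * 2 = of_nat N" "\<And>j. j \<le> N \<Longrightarrow> (bracket f ^^ j) ((bracket e ^^ k) x) \<noteq> 0"
    using sl2_primitive[OF s k hk] by blast
  then show thesis by (intro that[of k N]) (simp_all add: mult.commute)
qed

end

section \<open>Root spaces relative to a Cartan subalgebra and an invariant form\<close>

locale lie_algebra_cartan = lie_algebra scale bracket
  for scale :: "complex \<Rightarrow> 'a::ab_group_add \<Rightarrow> 'a" and bracket :: "'a \<Rightarrow> 'a \<Rightarrow> 'a" +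
  fixes H :: "'a set" and B :: "'a \<Rightarrow> 'a \<Rightarrow> complex"
  assumes cartan: "cartan_subalgebra H" and form: "invariant_form B"
begin

lemma H_subspace: "subspace H" and H_commute: "x \<in> H \<Longrightarrow> z \<in> H \<Longrightarrow> bracket x z = 0"
  and H_centralizer: "(\<And>h. h \<in> H \<Longrightarrow> bracket h x = 0) \<Longrightarrow> x \<in> H"
  and H_diagonalizable: "h \<in> H \<Longrightarrow> span {x. \<exists>c. bracket h x = scale c x} = UNIV"
  using cartan unfolding cartan_subalgebra_def diagonalizable_def by blast+

lemma B_sym: "B x z = B z x" and B_invariant: "B (bracket x z) w = B x (bracket z w)"
  and B_nondegenerate: "(\<And>z. B x z = 0) \<Longrightarrow> x = 0"
  using form unfolding invariant_form_def by blast+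

lemma B_add_left: "B (x + w) z = B x z + B w z" and B_scale_left: "B (scale c x) z = c * B x z"
proof -
  interpret Vector_Spaces.linear scale "(*)" "\<lambda>x. B x z"
    using form unfolding invariant_form_def by blast
  show "B (x + w) z = B x z + B w z" by (rule add)
  show "B (scale c x) z = c * B x z" by (rule scale)
qed

lemma B_add_right: "B z (x + w) = B z x + B z w"
  unfolding B_sym[of z] by (rule B_add_left)

lemma B_scale_right: "B z (scale c x) = c * B z x"
  unfolding B_sym[of z] by (rule B_scale_left)

lemma B_zero_left: "B 0 z = 0" using B_scale_left[of 0 0 z] by simp

lemma B_sum_left: "B (\<Sum>i\<in>I. f i) z = (\<Sum>i\<in>I. B (f i) z)"
  by (induction I rule: infinite_finite_induct) (simp_all add: B_add_left B_zero_left)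

lemma B_minus_left: "B (- x) z = - B x z" using B_scale_left[of "-1" x z] by simp

text \<open>Split a joint eigenvector for \<open>S\<close> into its components \<open>X c\<close> in
  the eigenspaces of \<open>h\<close>. As \<open>g\<close> commutes with \<open>h\<close>, it
  respects these eigenspaces, and their independence makes every component an eigenvector of
  \<open>g\<close> with the old eigenvalue.\<close>

lemma commuting_eigenspaces:
  assumes "finite S" "S \<subseteq> H"
  shows "span {x. \<exists>f. \<forall>h\<in>S. bracket h x = scale (f h) x} = UNIV"
  using assms
proof (induction S rule: finite_induct)
  case empty
  then show ?case by simp
next
  case (insert h S)
  let ?E = "\<lambda>S. {x. \<exists>f. \<forall>h\<in>S. bracket h x = scale (f h) x}"
  have "?E S \<subseteq> span (?E (insert h S))"
  proof
    fix x assume "x \<in> ?E S"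
    then obtain f where f: "\<And>g. g \<in> S \<Longrightarrow> bracket g x = scale (f g) x" by blast
    have "x \<in> span {x. \<exists>c. bracket h x = scale c x}" using H_diagonalizable[of h] insert.prems by simp
    then obtain t r where t: "finite t" "t \<subseteq> {x. \<exists>c. bracket h x = scale c x}" "x = (\<Sum>v\<in>t. scale (r v) v)"
      unfolding span_explicit by blast
    have "\<forall>v\<in>t. \<exists>c. bracket h v = scale c v" using t(2) by blast
    from bchoice[OF this] obtain ev where ev: "\<And>v. v \<in> t \<Longrightarrow> bracket h v = scale (ev v) v"
      by blast
    define X where "X c = (\<Sum>v\<in>{v\<in>t. ev v = c}. scale (r v) v)" for c
    have hX: "bracket h (X c) = scale c (X c)" for c
      unfolding X_def bracket_sum_right scale_sum_right
    proof (rule sum.cong[OF refl])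
      fix v assume "v \<in> {v \<in> t. ev v = c}"
      then have "bracket h v = scale c v" using ev by blast
      then show "bracket h (scale (r v) v) = scale c (scale (r v) v)"
        by (simp only: bracket_scale_right scale_scale mult.commute)
    qed
    have xX: "x = (\<Sum>c\<in>ev ` t. X c)"
      unfolding t(3) X_def using sum.group[OF t(1) finite_imageI[OF t(1)], of ev ev "\<lambda>v. scale (r v) v"] by simp
    have gX: "bracket g (X c) = scale (f g) (X c)" if g: "g \<in> S" and c: "c \<in> ev ` t" for g c
    proof -
      have "\<forall>c\<in>ev ` t. bracket g (X c) - scale (f g) (X c) = 0"
      proof (rule joint_eigenvectors_independent[where S = "{h}" and f = "\<lambda>c _. c"])
        show "finite (ev ` t)" using t(1) by simp
        fix c g' assume "g' \<in> {h}"
        have "bracket h (bracket g (X c)) = bracket (bracket h g) (X c) + bracket g (bracket h (X c))"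
          by (rule bracket_bracket)
        also have "bracket h g = 0" using H_commute insert.prems g by blast
        finally have "bracket h (bracket g (X c)) = scale c (bracket g (X c))"
          by (simp add: hX bracket_scale_right)
        then show "bracket g' (bracket g (X c) - scale (f g) (X c)) = scale c (bracket g (X c) - scale (f g) (X c))"
          using \<open>g' \<in> {h}\<close> by (simp add: bracket_diff_right bracket_scale_right hX scale_right_diff_distrib mult.commute)
      next
        have "(\<Sum>c\<in>ev ` t. bracket g (X c) - scale (f g) (X c)) = bracket g x - scale (f g) x"
          unfolding xX by (simp only: bracket_sum_right scale_sum_right sum_subtractf)
        then show "(\<Sum>c\<in>ev ` t. bracket g (X c) - scale (f g) (X c)) = 0" using f[OF g] by simp
      qed auto
      then have "bracket g (X c) - scale (f g) (X c) = 0" using c by blast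
      then show ?thesis by (simp only: right_minus_eq)
    qed
    have "X c \<in> ?E (insert h S)" if "c \<in> ev ` t" for c
    proof -
      have "\<forall>g\<in>insert h S. bracket g (X c) = scale ((f(h := c)) g) (X c)"
        using gX[OF _ that] hX[of c] by auto
      then show ?thesis by blast
    qed
    then show "x \<in> span (?E (insert h S))" unfolding xX by (intro span_sum span_base)
  qed
  then have "span (?E S) \<subseteq> span (?E (insert h S))" by (rule span_minimal) (rule subspace_span)
  then show ?case using insert by auto
qed

lemma root_space_decomposition: "span (\<Union>f\<in>dual H. root_space H f) = UNIV"
proof -
  obtain S where S: "S \<subseteq> H" "independent S" "H \<subseteq> span S"
    using maximal_independent_subset[of H] by blast
  obtain C where "finite C" "span C = UNIV" using finite_dimensional by blast
  then have "finite S" using independent_span_bound[of C S] S(2) by simp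
  have "{x. \<exists>f. \<forall>h\<in>S. bracket h x = scale (f h) x} \<subseteq> span (\<Union>f\<in>dual H. root_space H f)"
  proof
    fix x assume "x \<in> {x. \<exists>f. \<forall>h\<in>S. bracket h x = scale (f h) x}"
    then obtain f where f: "\<And>h. h \<in> S \<Longrightarrow> bracket h x = scale (f h) x" by blast
    show "x \<in> span (\<Union>f\<in>dual H. root_space H f)"
    proof (cases "x = 0")
      case True
      then show ?thesis by (simp add: span_zero)
    next
      case False
      have ex: "\<exists>c. bracket h x = scale c x" if "h \<in> span S" for h
        using that
      proof (induction rule: span_induct_alt)
        case base
        show ?case by (intro exI[of _ 0]) simp
      next
        case (step c h g)
        then obtain d where "bracket g x = scale d x" by blast
        then have "bracket (scale c h + g) x = scale (c * f h + d) x"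
          using f[OF step(1)] by (simp add: bracket_add_left bracket_scale_left scale_left_distrib)
        then show ?case by blast
      qed
      \<comment> \<open>The eigenvalue of \<open>h\<close> on \<open>x\<close>, which is unique
        because \<open>x\<close> is nonzero. The value 0 outside \<open>H\<close> is the convention
        of \<open>dual\<close>.\<close>
      define g where "g h = (if h \<in> H then THE c. bracket h x = scale c x else 0)" for h
      have g: "bracket h x = scale (g h) x" if "h \<in> H" for h
      proof -
        have "h \<in> span S" using S(3) that by blast
        then obtain c where "bracket h x = scale c x" using ex by blast
        then have "(THE c. bracket h x = scale c x) = c" using False by (intro the_equality) auto
        then show ?thesis using \<open>bracket h x = scale c x\<close> that by (simp add: g_def)
      qed
      have "g (h + h') = g h + g h'" if "h \<in> H" "h' \<in> H" for h h'
      proof -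
        have "scale (g (h + h')) x = scale (g h + g h') x"
          using g[OF that(1)] g[OF that(2)] g[OF subspace_add[OF H_subspace that]]
          by (simp add: bracket_add_left scale_left_distrib)
        then show ?thesis using False by simp
      qed
      moreover have "g (scale c h) = c * g h" if "h \<in> H" for c h
      proof -
        have "scale (g (scale c h)) x = bracket (scale c h) x"
          by (rule g[OF subspace_scale[OF H_subspace that], symmetric])
        also have "\<dots> = scale (c * g h) x"
          unfolding bracket_scale_left g[OF that] by (rule scale_scale)
        finally show ?thesis using False by simp
      qed
      ultimately have "g \<in> dual H" by (auto simp: dual_def g_def)
      moreover have "x \<in> root_space H g" using g by (simp add: root_space_def)
      ultimately show ?thesis by (intro span_base) blast
    qed
  qed
  then have "span {x. \<exists>f. \<forall>h\<in>S. bracket h x = scale (f h) x} \<subseteq> span (\<Union>f\<in>dual H. root_space H f)"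
    by (rule span_minimal) (rule subspace_span)
  then show ?thesis using commuting_eigenspaces[OF \<open>finite S\<close> S(1)] by auto
qed

lemma root_spaceD: "x \<in> root_space H f \<Longrightarrow> h \<in> H \<Longrightarrow> bracket h x = scale (f h) x"
  by (simp add: root_space_def)

lemma root_space_bracket:
  assumes "x \<in> root_space H f" "z \<in> root_space H g" "\<And>h. h \<in> H \<Longrightarrow> k h = f h + g h"
  shows "bracket x z \<in> root_space H k"
  unfolding root_space_def
proof (intro CollectI ballI)
  fix h assume h: "h \<in> H"
  have "bracket h (bracket x z) = bracket (bracket h x) z + bracket x (bracket h z)" by (rule bracket_bracket)
  then show "bracket h (bracket x z) = scale (k h) (bracket x z)"
    using root_spaceD[OF assms(1) h] root_spaceD[OF assms(2) h]
    by (simp add: assms(3)[OF h] bracket_scale_left bracket_scale_right scale_left_distrib)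
qed

lemma root_space_zero: "root_space H (\<lambda>_. 0) = H"
  using H_commute H_centralizer by (auto simp: root_space_def)

lemma B_root_space:
  assumes "x \<in> root_space H f" "z \<in> root_space H g" "h \<in> H" "B x z \<noteq> 0"
  shows "g h = - f h"
proof -
  have "B (bracket h x) z = f h * B x z" using root_spaceD[OF assms(1,3)] by (simp add: B_scale_left)
  moreover have "B (bracket h x) z = - (g h * B x z)"
    using root_spaceD[OF assms(2,3)] by (subst bracket_swap) (simp add: B_minus_left B_invariant B_scale_right)
  ultimately have e: "f h * B x z = - (g h * B x z)" by (rule trans[OF sym])
  have "(f h + g h) * B x z = 0" unfolding distrib_right e by (rule left_minus)
  then have "f h + g h = 0" using assms(4) by simp
  then show ?thesis by (simp add: eq_neg_iff_add_eq_0 add.commute)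
qed

lemma root_space_pairing:
  assumes "x \<in> root_space H f" "x \<noteq> 0"
  obtains z where "z \<in> root_space H (\<lambda>h. - f h)" "B x z = 1"
proof -
  have "\<exists>g\<in>dual H. \<exists>z\<in>root_space H g. B x z \<noteq> 0"
  proof (rule ccontr)
    assume n: "\<not> (\<exists>g\<in>dual H. \<exists>z\<in>root_space H g. B x z \<noteq> 0)"
    have "B x z = 0" for z
    proof -
      have "z \<in> span (\<Union>f\<in>dual H. root_space H f)" using root_space_decomposition by simp
      then show ?thesis
      proof (induction rule: span_induct_alt)
        case base
        show ?case using B_zero_left by (subst B_sym)
      next
        case (step c w z)
        then show ?case using n by (auto simp: B_add_right B_scale_right)
      qed
    qed
    then show False using B_nondegenerate assms(2) by blast
  qed
  then obtain g z where z: "z \<in> root_space H g" "B x z \<noteq> 0" by blast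
  then have "z \<in> root_space H (\<lambda>h. - f h)"
    using B_root_space[OF assms(1) z(1) _ z(2)] by (simp add: root_space_def)
  then have "scale (inverse (B x z)) z \<in> root_space H (\<lambda>h. - f h)"
    by (simp add: root_space_def bracket_scale_right mult.commute)
  moreover have "B x (scale (inverse (B x z)) z) = 1" using z(2) by (simp add: B_scale_right)
  ultimately show thesis by (rule that)
qed

lemma H_nondegenerate:
  assumes "t \<in> H" "\<And>h. h \<in> H \<Longrightarrow> B t h = 0"
  shows "t = 0"
proof (rule ccontr)
  assume "t \<noteq> 0"
  then obtain z where "z \<in> root_space H (\<lambda>h. - 0)" "B t z = 1"
    using root_space_pairing[of t "\<lambda>_. 0"] assms(1) unfolding root_space_zero by blast
  then show False using assms(2) root_space_zero by simp
qed

lemma representing_vector_eqI: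
  assumes "t \<in> H" "\<And>x. x \<in> H \<Longrightarrow> B t x = f x"
  shows "representing_vector B H f = t"
  unfolding representing_vector_def
proof (rule the_equality)
  fix t' assume t': "t' \<in> H \<and> (\<forall>x\<in>H. B t' x = f x)"
  have "t' - t = 0"
  proof (rule H_nondegenerate)
    show "t' - t \<in> H" using t' assms(1) H_subspace by (simp add: subspace_diff)
    fix h assume "h \<in> H"
    then show "B (t' - t) h = 0"
      using t' assms(2) B_add_left[of t' "- t" h] by (simp add: B_minus_left)
  qed
  then show "t' = t" by simp
qed (use assms in blast)

lemma root_space_nontrivial: "f \<in> roots H \<Longrightarrow> \<exists>x. x \<in> root_space H f \<and> x \<noteq> 0"
proof -
  assume "f \<in> roots H"
  moreover have "0 \<in> root_space H f" by (simp add: root_space_def)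
  ultimately show ?thesis unfolding roots_def by blast
qed

text \<open>The bracket of \<open>x\<close> and \<open>z\<close> has weight 0, so it lies in
  \<open>H\<close>, and invariance gives its pairing with \<open>h\<close> as
  \<open>B x z * f h\<close>, that is \<open>f h\<close>. For a root this provides the existence
  behind \<open>representing_vector\<close>.\<close>

lemma root_vectors:
  assumes "f \<in> roots H"
  obtains x z where "x \<in> root_space H f" "z \<in> root_space H (\<lambda>h. - f h)" "x \<noteq> 0"
    "bracket x z = representing_vector B H f" "bracket x z \<in> H" "\<And>h. h \<in> H \<Longrightarrow> B (bracket x z) h = f h"
proof -
  obtain x where x: "x \<in> root_space H f" "x \<noteq> 0" using root_space_nontrivial[OF assms] by blast
  obtain z where z: "z \<in> root_space H (\<lambda>h. - f h)" "B x z = 1" by (rule root_space_pairing[OF x])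
  have "bracket x z \<in> root_space H (\<lambda>_. 0)" by (rule root_space_bracket[OF x(1) z(1)]) simp
  then have t: "bracket x z \<in> H" unfolding root_space_zero .
  have Bt: "B (bracket x z) h = f h" if "h \<in> H" for h
  proof -
    have "bracket z h = scale (f h) z"
      using root_spaceD[OF z(1) that] by (subst bracket_swap) simp
    then show ?thesis by (simp add: B_invariant B_scale_right z(2))
  qed
  show thesis by (rule that[OF x(1) z(1) x(2) representing_vector_eqI[OF t Bt, symmetric] t Bt])
qed

lemma representing_vector:
  assumes "f \<in> roots H"
  shows "representing_vector B H f \<in> H" "h \<in> H \<Longrightarrow> B (representing_vector B H f) h = f h"
proof -
  obtain x z where "bracket x z = representing_vector B H f" "bracket x z \<in> H" "\<And>h. h \<in> H \<Longrightarrow> B (bracket x z) h = f h"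
    by (rule root_vectors[OF assms]) blast
  then show "representing_vector B H f \<in> H" "h \<in> H \<Longrightarrow> B (representing_vector B H f) h = f h" by auto
qed

lemma dual_form_eq: "f \<in> roots H \<Longrightarrow> g \<in> roots H \<Longrightarrow> dual_form B H f g = f (representing_vector B H g)"
  unfolding dual_form_def using representing_vector by blast

lemma dual_form_sym: "dual_form B H f g = dual_form B H g f"
  unfolding dual_form_def by (rule B_sym)

lemma roots_dual: "f \<in> roots H \<Longrightarrow> f \<in> dual H" by (simp add: roots_def)

lemma dual_scale: "f \<in> dual H \<Longrightarrow> h \<in> H \<Longrightarrow> f (scale c h) = c * f h" by (simp add: dual_def)

lemma finite_roots: "finite (roots H)"
proof -
  have "\<forall>f\<in>roots H. \<exists>x. x \<in> root_space H f \<and> x \<noteq> 0" using root_space_nontrivial by blast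
  from bchoice[OF this] obtain x where x: "\<And>f. f \<in> roots H \<Longrightarrow> x f \<in> root_space H f \<and> x f \<noteq> 0"
    by blast
  show ?thesis
  proof (rule joint_eigenvectors_finite[where S = H and f = "\<lambda>f. f" and x = x])
    fix f g assume fg: "f \<in> roots H" "g \<in> roots H" "f \<noteq> g"
    show "\<exists>h\<in>H. f h \<noteq> g h"
    proof (rule ccontr)
      assume "\<not> (\<exists>h\<in>H. f h \<noteq> g h)"
      then have "f h = g h" for h using fg(1,2) by (cases "h \<in> H") (auto simp: roots_def dual_def)
      then show False using fg(3) by blast
    qed
  qed (use x root_spaceD in blast)+
qed

text \<open>Such an element commutes with all root spaces and with \<open>H\<close>, so it is
  central, and the centre is an ideal.\<close>

lemma center_trivial:
  assumes simple: simple and t: "t \<in> H" "\<And>f. f \<in> roots H \<Longrightarrow> f t = 0"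
  shows "t = 0"
proof -
  define Z where "Z = {t. \<forall>x. bracket t x = 0}"
  have "bracket t x = 0" for x
  proof -
    have "x \<in> span (\<Union>f\<in>dual H. root_space H f)" using root_space_decomposition by simp
    then show ?thesis
    proof (induction rule: span_induct_alt)
      case (step c w z)
      then obtain f where f: "f \<in> dual H" "w \<in> root_space H f" by blast
      have "bracket t w = 0"
      proof (cases "f \<in> roots H")
        case True
        then show ?thesis using root_spaceD[OF f(2) t(1)] t(2) by simp
      next
        case False
        then have "f = (\<lambda>_. 0) \<or> w = 0" using f unfolding roots_def by blast
        then show ?thesis using root_spaceD[OF f(2) t(1)] by auto
      qed
      then show ?case using step by (simp add: bracket_add_right bracket_scale_right)
    qed simp
  qed
  then have "t \<in> Z" by (simp add: Z_def)
  have "ideal Z"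
    unfolding ideal_def subspace_def
  proof (intro conjI allI ballI)
    fix x z assume "z \<in> Z"
    then have "bracket x z = 0" by (subst bracket_swap) (simp add: Z_def)
    then show "bracket x z \<in> Z" by (simp add: Z_def)
  qed (auto simp: Z_def bracket_add_left bracket_scale_left)
  then have "Z = {0} \<or> Z = UNIV" using simple by (simp add: simple_def)
  moreover have "Z \<noteq> UNIV" using simple by (auto simp: simple_def Z_def)
  ultimately show ?thesis using \<open>t \<in> Z\<close> by blast
qed

section \<open>Root strings\<close>

lemma sl2_root:
  assumes f: "f \<in> roots H" and n: "f (representing_vector B H f) \<noteq> 0"
  obtains e v where "sl2 e v (scale (2 / f (representing_vector B H f)) (representing_vector B H f))"
    "e \<in> root_space H f" "v \<in> root_space H (\<lambda>h. - f h)" "e \<noteq> 0"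
proof -
  let ?t = "representing_vector B H f" and ?n = "f (representing_vector B H f)"
  obtain x z where xz: "x \<in> root_space H f" "z \<in> root_space H (\<lambda>h. - f h)" "x \<noteq> 0"
    "bracket x z = ?t" "bracket x z \<in> H" by (rule root_vectors[OF f])
  have t: "?t \<in> H" using xz by simp
  have "bracket ?t x = scale ?n x" "bracket ?t z = scale (- ?n) z"
    using root_spaceD[OF xz(1) t] root_spaceD[OF xz(2) t] by auto
  then have "sl2 x (scale (2 / ?n) z) (scale (2 / ?n) ?t)"
    using n by (simp add: sl2_def bracket_scale_left bracket_scale_right xz(4))
  moreover have "scale (2 / ?n) z \<in> root_space H (\<lambda>h. - f h)"
    using root_spaceD[OF xz(2)] by (simp add: root_space_def bracket_scale_right mult.commute)
  ultimately show thesis using xz by (intro that)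
qed

lemma root_space_funpow:
  assumes "e \<in> root_space H f" "x \<in> root_space H g" "\<And>h. h \<in> H \<Longrightarrow> k h = g h + of_nat n * f h"
  shows "(bracket e ^^ n) x \<in> root_space H k"
  using assms(3)
proof (induction n arbitrary: k)
  case 0
  then show ?case using assms(2) by (simp add: root_space_def)
next
  case (Suc n)
  have "(bracket e ^^ n) x \<in> root_space H (\<lambda>h. g h + of_nat n * f h)" by (rule Suc.IH) simp
  then show ?case
    by (auto intro!: root_space_bracket[OF assms(1)] simp: Suc.prems algebra_simps)
qed

text \<open>The integer \<open>c\<close> is the eigenvalue of the coroot \<open>h\<close> on the
  root space of \<open>g\<close>. The weight \<open>g - c f\<close> is reached inside the string:
  raise \<open>k\<close> times to the top, then lower \<open>N - k\<close> times, where
  \<open>c = N - 2 k\<close>.\<close>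

lemma root_reflection:
  assumes f: "f \<in> roots H" and n: "f (representing_vector B H f) \<noteq> 0" and g: "g \<in> roots H"
  obtains c :: int where "2 * g (representing_vector B H f) / f (representing_vector B H f) = of_int c"
    "(\<lambda>x. g x - of_int c * f x) \<in> roots H"
proof -
  let ?t = "representing_vector B H f" and ?n = "f (representing_vector B H f)"
  define h where "h = scale (2 / ?n) ?t"
  obtain e v where ev: "sl2 e v h" "e \<in> root_space H f" "v \<in> root_space H (\<lambda>h. - f h)"
    unfolding h_def by (rule sl2_root[OF f n])
  have t: "?t \<in> H" using representing_vector(1)[OF f] .
  then have hH: "h \<in> H" unfolding h_def by (rule subspace_scale[OF H_subspace])
  have "f h = 2" unfolding h_def using dual_scale[OF roots_dual[OF f] t] n by simp
  have gh: "g h = 2 * g ?t / ?n" unfolding h_def using dual_scale[OF roots_dual[OF g] t] by simp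
  obtain x where x: "x \<in> root_space H g" "x \<noteq> 0" using root_space_nontrivial[OF g] by blast
  have hx: "bracket h x = scale (g h) x" by (rule root_spaceD[OF x(1) hH])
  obtain k N where kN: "g h + 2 * of_nat k = of_nat N"
    "\<And>j. j \<le> N \<Longrightarrow> (bracket v ^^ j) ((bracket e ^^ k) x) \<noteq> 0"
    using sl2_string[OF ev(1) x(2) hx] by blast
  define c where "c = int N - 2 * int k"
  have c: "g h = of_int c" using kN(1) by (simp add: c_def algebra_simps)
  have ek: "(bracket e ^^ k) x \<in> root_space H (\<lambda>h. g h + of_nat k * f h)" for k
    by (rule root_space_funpow[OF ev(2) x(1)]) simp
  have vk: "(bracket v ^^ k) x \<in> root_space H (\<lambda>h. g h + of_nat k * - f h)" for k
    by (rule root_space_funpow[OF ev(3) x(1)]) simp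
  have ex: "\<exists>w. w \<noteq> 0 \<and> w \<in> root_space H (\<lambda>x. g x - of_int c * f x)"
  proof (cases "k \<le> N")
    case True
    have "(bracket v ^^ (N - k)) ((bracket e ^^ k) x) \<in> root_space H (\<lambda>x. g x - of_int c * f x)"
      by (rule root_space_funpow[OF ev(3) ek]) (use True in \<open>simp add: c_def of_nat_diff algebra_simps\<close>)
    then show ?thesis using kN(2)[of "N - k"] by auto
  next
    \<comment> \<open>Here \<open>c < 0\<close>. The same walk is made with \<open>e\<close> and
      \<open>v\<close> exchanged: down \<open>k'\<close> steps to the bottom, then up
      \<open>N' - k'\<close> steps.\<close>
    case False
    then have "c < 0" by (simp add: c_def)
    have "bracket (- h) x = scale (- g h) x" using hx by (simp add: bracket_minus_left)
    then obtain k' N' where kN': "- g h + 2 * of_nat k' = of_nat N'"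
      "\<And>j. j \<le> N' \<Longrightarrow> (bracket e ^^ j) ((bracket v ^^ k') x) \<noteq> 0"
      using sl2_string[OF sl2_swap[OF ev(1)] x(2)] by blast
    have "of_int (int N') = (of_int (2 * int k' - c) :: complex)" using kN'(1) c by (simp add: algebra_simps)
    then have c': "int N' = 2 * int k' - c" by (simp only: of_int_eq_iff)
    then have "k' \<le> N'" using \<open>c < 0\<close> by linarith
    have "of_nat (N' - k') = (of_nat N' - of_nat k' :: complex)" using \<open>k' \<le> N'\<close> by (rule of_nat_diff)
    also have "of_nat N' = (of_int (2 * int k' - c) :: complex)" using c' by (metis of_int_of_nat_eq)
    finally have e: "of_nat (N' - k') = (of_nat k' - of_int c :: complex)" by simp
    have "(bracket e ^^ (N' - k')) ((bracket v ^^ k') x) \<in> root_space H (\<lambda>x. g x - of_int c * f x)"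
      by (rule root_space_funpow[OF ev(2) vk]) (simp add: e algebra_simps)
    then show ?thesis using kN'(2)[of "N' - k'"] by auto
  qed
  have dual: "(\<lambda>x. g x - of_int c * f x) \<in> dual H"
    using roots_dual[OF f] roots_dual[OF g] by (simp add: dual_def algebra_simps)
  have "(\<lambda>x. g x - of_int c * f x) \<noteq> (\<lambda>_. 0)"
  proof
    assume z: "(\<lambda>x. g x - of_int c * f x) = (\<lambda>_. 0)"
    \<comment> \<open>The value at \<open>h\<close> is c - 2 c, so \<open>c\<close> would be 0 and
      \<open>g\<close> itself would vanish.\<close>
    have "g h - of_int c * f h = 0" using fun_cong[OF z, of h] .
    then have "c = 0" using c \<open>f h = 2\<close> by simp
    then have "g = (\<lambda>_. 0)" using z by simp
    then show False using g by (simp add: roots_def)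
  qed
  then have "(\<lambda>x. g x - of_int c * f x) \<in> roots H" using dual ex unfolding roots_def by blast
  then show thesis using c gh by (intro that[of c]) simp_all
qed

text \<open>Otherwise there is a vector \<open>w\<close> of some weight K f with K \<ge> 2 that is
  killed by \<open>e\<close>. Lowering it K times lands in \<open>H\<close>, and applying
  \<open>e\<close> to the result gives a multiple of \<open>e\<close>; by \<open>sl2_lower\<close>
  this is also a nonzero multiple of v^(K-1) w. Hence \<open>e\<close> kills v^(K-1) w, whereas
  \<open>sl2_lower\<close> gives a nonzero multiple of v^(K-2) w.\<close>

lemma root_multiple:
  assumes f: "f \<in> roots H" and n: "f (representing_vector B H f) \<noteq> 0" and k: "k \<ge> 2"
  shows "(\<lambda>x. of_nat k * f x) \<notin> roots H"
proof
  assume g: "(\<lambda>x. of_nat k * f x) \<in> roots H"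
  let ?t = "representing_vector B H f" and ?n = "f (representing_vector B H f)"
  define h where "h = scale (2 / ?n) ?t"
  obtain e v where ev: "sl2 e v h" "e \<in> root_space H f" "v \<in> root_space H (\<lambda>h. - f h)"
    unfolding h_def by (rule sl2_root[OF f n])
  have t: "?t \<in> H" using representing_vector(1)[OF f] .
  then have hH: "h \<in> H" unfolding h_def by (rule subspace_scale[OF H_subspace])
  have fh: "f h = 2" unfolding h_def using dual_scale[OF roots_dual[OF f] t] n by simp
  obtain x where x: "x \<in> root_space H (\<lambda>x. of_nat k * f x)" "x \<noteq> 0"
    using root_space_nontrivial[OF g] by blast
  obtain i where i: "(bracket e ^^ i) x \<noteq> 0" "bracket e ((bracket e ^^ i) x) = 0"
    by (rule sl2_top[OF ev(1) x(2) root_spaceD[OF x(1) hH]])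
  define K where "K = k + i"
  define w where "w = (bracket e ^^ i) x"
  have w: "w \<in> root_space H (\<lambda>x. of_nat K * f x)" "w \<noteq> 0" "bracket e w = 0"
    using i root_space_funpow[OF ev(2) x(1), of "\<lambda>x. of_nat K * f x" i] by (simp_all add: w_def K_def algebra_simps)
  have hw: "bracket h w = scale (of_nat (2 * K)) w" using root_spaceD[OF w(1) hH] by (simp add: fh)
  obtain N where N: "of_nat (2 * K) = (of_nat N :: complex)" "\<And>j. j \<le> N \<Longrightarrow> (bracket v ^^ j) w \<noteq> 0"
    using sl2_primitive[OF ev(1) w(2,3) hw] by blast
  have "N = 2 * K" using N(1) by (simp only: of_nat_eq_iff)
  obtain p where p: "K = Suc (Suc p)" using k by (cases K; cases "K - 1") (auto simp: K_def)
  note low = sl2_lower[OF ev(1) w(3) hw]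
  have "(bracket v ^^ K) w \<in> root_space H (\<lambda>_. 0)"
    by (rule root_space_funpow[OF ev(3) w(1)]) simp
  then have vH: "(bracket v ^^ K) w \<in> H" unfolding root_space_zero .
  have "bracket e ((bracket v ^^ K) w) = scale (- f ((bracket v ^^ K) w)) e"
    using root_spaceD[OF ev(2) vH] by (subst bracket_swap) simp
  then have "scale (of_nat K * (of_nat (2 * K) - of_nat (Suc p))) ((bracket v ^^ Suc p) w) = scale (- f ((bracket v ^^ K) w)) e"
    using low[of "Suc p"] unfolding p by metis
  moreover define d :: complex where "d = of_nat K * (of_nat (2 * K) - of_nat (Suc p))"
  moreover have "d \<noteq> 0"
  proof -
    have "d = of_nat (K * (p + 3))" unfolding d_def p by (simp add: algebra_simps)
    then show ?thesis unfolding p by (simp only: of_nat_eq_0_iff) simp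
  qed
  ultimately have "(bracket v ^^ Suc p) w = scale (inverse d * - f ((bracket v ^^ K) w)) e"
    by (metis scale_scale left_inverse scale_one)
  then have "bracket e ((bracket v ^^ Suc p) w) = 0"
    by (simp only: bracket_scale_right bracket_alternating scale_zero_right)
  then have "scale (of_nat (Suc p) * (of_nat (2 * K) - of_nat p)) ((bracket v ^^ p) w) = 0"
    by (simp only: low[of p])
  moreover have "of_nat (Suc p) * (of_nat (2 * K) - of_nat p) \<noteq> (0 :: complex)"
  proof -
    have "of_nat (Suc p) * (of_nat (2 * K) - of_nat p) = (of_nat (Suc p * (p + 4)) :: complex)"
      unfolding p by (simp add: algebra_simps)
    then show ?thesis by (simp only: of_nat_eq_0_iff) simp
  qed
  moreover have "(bracket v ^^ p) w \<noteq> 0" using N(2)[of p] \<open>N = 2 * K\<close> p by simp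
  ultimately show False by simp
qed

end

section \<open>The positive roots and the sum side\<close>

lemma attach_bounds: "valid_rank X l \<Longrightarrow> i \<in> {2..l} \<Longrightarrow> 1 \<le> attach X l i \<and> attach X l i < i"
  by (cases X) (auto simp: attach_def)

lemma attach_2: "valid_rank X l \<Longrightarrow> 2 \<le> l \<Longrightarrow> attach X l 2 = 1"
  by (cases X) (auto simp: attach_def)

text \<open>The labelling is such that every multiple edge has its long end at \<open>i'\<close> and
  its short end at \<open>i\<close>; this fixes the orientation of the Cartan integers
  later.\<close>

lemma edge_lines_cases:
  assumes "valid_rank X l" "i \<in> {2..l}"
  shows "edge_lines X l i = 1 \<or>
    (edge_lines X l i = 2 \<or> edge_lines X l i = 3) \<and> attach X l i \<in> long_nodes X l \<and> i \<notin> long_nodes X l"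
  using assms by (cases X) (auto simp: edge_lines_def attach_def)

lemma dynkin_lines_attach:
  assumes "valid_rank X l" "i \<in> {2..l}"
  shows "dynkin_lines X l i (attach X l i) = edge_lines X l i"
    "dynkin_lines X l (attach X l i) i = edge_lines X l i"
proof -
  have i: "2 \<le> i" "attach X l i < i" using attach_bounds[OF assms] assms(2) by auto
  show "dynkin_lines X l i (attach X l i) = edge_lines X l i" using i by (simp add: dynkin_lines_def)
  have n: "\<not> (2 \<le> attach X l i \<and> i = attach X l (attach X l i))"
  proof
    assume a: "2 \<le> attach X l i \<and> i = attach X l (attach X l i)"
    then have "attach X l (attach X l i) < attach X l i"
      using attach_bounds[OF assms(1), of "attach X l i"] i assms(2) by auto
    then show False using a i by linarith
  qed
  show "dynkin_lines X l (attach X l i) i = edge_lines X l i"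
    unfolding dynkin_lines_def if_not_P[OF n] using i by simp
qed

lemma nonpos_int_factors:
  fixes a b :: int
  assumes "a \<le> 0" "b \<le> 0" "a * b = e" "e = 1 \<or> e = 2 \<or> e = 3"
  shows "a = - 1 \<and> b = - e \<or> a = - e \<and> b = - 1"
proof -
  have n: "a \<noteq> 0" "b \<noteq> 0" using assms by auto
  then have "a \<le> - 1" "b \<le> - 1" using assms by auto
  then have "(- a) * 1 \<le> (- a) * (- b)" "1 * (- b) \<le> (- a) * (- b)"
    by (intro mult_left_mono mult_right_mono; simp)+
  then have "a \<ge> - 3" "b \<ge> - 3" using assms by auto
  then have "a = - 1 \<or> a = - 2 \<or> a = - 3" "b = - 1 \<or> b = - 2 \<or> b = - 3"
    using \<open>a \<le> - 1\<close> \<open>b \<le> - 1\<close> by auto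
  then show ?thesis using assms(3,4) by auto
qed

section \<open>Cartan integers of the diagram\<close>

locale simple_lie_algebra_roots = lie_algebra_cartan scale bracket H B
  for scale :: "complex \<Rightarrow> 'a::ab_group_add \<Rightarrow> 'a" and bracket H B +
  fixes X :: dynkin_family and l :: nat and \<alpha> :: "nat \<Rightarrow> 'a \<Rightarrow> complex"
  assumes simple_algebra: simple and normalized: "normalized_on B H (roots H)"
    and simple_roots: "simple_roots l \<alpha> (roots H)" and diagram: "has_diagram B H X l \<alpha>"
begin

abbreviation tv :: "nat \<Rightarrow> 'a" where "tv i \<equiv> representing_vector B H (\<alpha> i)"
abbreviation sqlen :: "nat \<Rightarrow> complex" where "sqlen i \<equiv> \<alpha> i (tv i)"

lemma rank: "valid_rank X l"
  using diagram by (simp add: has_diagram_def)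

lemma alpha_root: "i \<in> {1..l} \<Longrightarrow> \<alpha> i \<in> roots H"
  using simple_roots by (simp add: simple_roots_def)

lemma alpha_independent: "(\<And>x. (\<Sum>i=1..l. c i * \<alpha> i x) = 0) \<Longrightarrow> i \<in> {1..l} \<Longrightarrow> c i = 0"
  using simple_roots unfolding simple_roots_def by blast

lemma alpha_coeff_unique:
  assumes "\<And>x. (\<Sum>i=1..l. c i * \<alpha> i x) = (\<Sum>i=1..l. d i * \<alpha> i x)" "i \<in> {1..l}"
  shows "c i = d i"
proof -
  have "(\<Sum>i=1..l. (c i - d i) * \<alpha> i x) = 0" for x
    using assms(1)[of x] by (simp add: left_diff_distrib sum_subtractf)
  then have "c i - d i = 0" using assms(2) by (rule alpha_independent)
  then show ?thesis by simp
qed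

lemma alpha_eq_sum: "i \<in> {1..l} \<Longrightarrow> \<alpha> i x = (\<Sum>k=1..l. (if k = i then 1 else 0) * \<alpha> k x)"
  by (simp add: if_distrib[of "\<lambda>c. c * _"] cong: if_cong)

lemma root_comb_cases:
  assumes "f \<in> roots H"
  obtains a where "f = root_comb l \<alpha> a" | a where "f = (\<lambda>x. - root_comb l \<alpha> a x)"
  using simple_roots assms unfolding simple_roots_def by blast

lemma dual_form_alpha: "i \<in> {1..l} \<Longrightarrow> j \<in> {1..l} \<Longrightarrow> dual_form B H (\<alpha> i) (\<alpha> j) = \<alpha> i (tv j)"
  by (rule dual_form_eq[OF alpha_root alpha_root])

lemma alpha_tv_sym: "i \<in> {1..l} \<Longrightarrow> j \<in> {1..l} \<Longrightarrow> \<alpha> i (tv j) = \<alpha> j (tv i)"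
  using dual_form_sym[of "\<alpha> i" "\<alpha> j"] by (simp only: dual_form_alpha)

lemma long_iff: "i \<in> {1..l} \<Longrightarrow> sqlen i = 2 \<longleftrightarrow> i \<in> long_nodes X l"
proof -
  assume i: "i \<in> {1..l}"
  have "dual_form B H (\<alpha> i) (\<alpha> i) = 2 \<longleftrightarrow> i \<in> long_nodes X l"
    using diagram i unfolding has_diagram_def by blast
  then show ?thesis unfolding dual_form_alpha[OF i i] .
qed

lemma diagram_product:
  assumes "i \<in> {1..l}" "j \<in> {1..l}" "i \<noteq> j"
  shows "(2 * \<alpha> i (tv j) / sqlen j) * (2 * \<alpha> j (tv i) / sqlen i) = of_nat (dynkin_lines X l i j)"
proof -
  have "(2 * dual_form B H (\<alpha> i) (\<alpha> j) / dual_form B H (\<alpha> j) (\<alpha> j)) *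
      (2 * dual_form B H (\<alpha> j) (\<alpha> i) / dual_form B H (\<alpha> i) (\<alpha> i)) = of_nat (dynkin_lines X l i j)"
    using diagram assms unfolding has_diagram_def by blast
  then show ?thesis by (simp only: dual_form_alpha[OF assms(1,2)] dual_form_alpha[OF assms(2,1)]
      dual_form_alpha[OF assms(1,1)] dual_form_alpha[OF assms(2,2)])
qed

lemma sqlen_nonzero:
  assumes i: "i \<in> {1..l}"
  shows "sqlen i \<noteq> 0"
proof (cases "l = 1")
  case True
  then have "X = Type_A" using rank by (cases X) auto
  then have "sqlen i = 2" using long_iff[OF i] i by simp
  then show ?thesis by simp
next
  case False
  then have l: "2 \<le> l" using i by simp
  have *: "sqlen j \<noteq> 0 \<and> sqlen (attach X l j) \<noteq> 0" if j: "j \<in> {2..l}" for j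
  proof -
    have a: "attach X l j \<in> {1..l}" "j \<noteq> attach X l j" "j \<in> {1..l}" using attach_bounds[OF rank j] j by auto
    have "edge_lines X l j \<noteq> 0" using edge_lines_cases[OF rank j] by auto
    then have "(2 * \<alpha> j (tv (attach X l j)) / sqlen (attach X l j)) * (2 * \<alpha> (attach X l j) (tv j) / sqlen j) \<noteq> 0"
      unfolding diagram_product[OF a(3,1,2)] dynkin_lines_attach[OF rank j] by simp
    then show ?thesis by auto
  qed
  show ?thesis
  proof (cases "i = 1")
    case True
    then show ?thesis using *[of 2] attach_2[OF rank l] l by simp
  next
    case False
    then show ?thesis using *[of i] i by simp
  qed
qed

lemma sqlen_real:
  assumes i: "i \<in> {1..l}"
  obtains c :: real where "c \<le> 2" "sqlen i = of_real c"
proof -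
  have "\<exists>c::real. c \<le> 2 \<and> dual_form B H (\<alpha> i) (\<alpha> i) = of_real c"
    using normalized alpha_root[OF i] unfolding normalized_on_def by blast
  then show thesis using that dual_form_alpha[OF i i] by auto
qed

text \<open>\<open>cartan_int j i\<close> is \<open>2\<langle>\<alpha>\<^sub>j,\<alpha>\<^sub>i\<rangle> / \<langle>\<alpha>\<^sub>i,\<alpha>\<^sub>i\<rangle>\<close>, the pairing of \<open>\<alpha>\<^sub>j\<close> with the coroot of \<open>\<alpha>\<^sub>i\<close>.\<close>

definition cartan_int :: "nat \<Rightarrow> nat \<Rightarrow> int" where
  "cartan_int j i = (SOME c. 2 * \<alpha> j (tv i) / sqlen i = of_int c)"

lemma root_reflect:
  assumes "i \<in> {1..l}" "f \<in> roots H"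
  shows "\<exists>c::int. 2 * f (tv i) / sqlen i = of_int c" "(\<lambda>x. f x - 2 * f (tv i) / sqlen i * \<alpha> i x) \<in> roots H"
proof -
  obtain c :: int where c: "2 * f (tv i) / sqlen i = of_int c" "(\<lambda>x. f x - of_int c * \<alpha> i x) \<in> roots H"
    by (rule root_reflection[OF alpha_root[OF assms(1)] sqlen_nonzero[OF assms(1)] assms(2)])
  show "\<exists>c::int. 2 * f (tv i) / sqlen i = of_int c" using c(1) by blast
  show "(\<lambda>x. f x - 2 * f (tv i) / sqlen i * \<alpha> i x) \<in> roots H" using c(2) unfolding c(1) .
qed

lemma cartan_int: "i \<in> {1..l} \<Longrightarrow> j \<in> {1..l} \<Longrightarrow> 2 * \<alpha> j (tv i) / sqlen i = of_int (cartan_int j i)"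
  unfolding cartan_int_def using root_reflect(1)[OF _ alpha_root] by (rule someI_ex)

lemma cartan_int_self: "i \<in> {1..l} \<Longrightarrow> cartan_int i i = 2"
  using cartan_int[of i i] sqlen_nonzero[of i] by simp

text \<open>The reflection of \<open>\<alpha> j\<close> in \<open>\<alpha> i\<close> is a root with
  coefficient 1 at \<open>\<alpha> j\<close>, hence a nonnegative combination, and its coefficient
  at \<open>\<alpha> i\<close> is \<open>- cartan_int j i\<close>.\<close>

lemma cartan_int_nonpos:
  assumes i: "i \<in> {1..l}" and j: "j \<in> {1..l}" and ij: "i \<noteq> j"
  shows "cartan_int j i \<le> 0"
proof -
  let ?c = "of_int (cartan_int j i) :: complex"
  let ?d = "\<lambda>k. (if k = j then 1 else 0) - ?c * (if k = i then 1 else 0)"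
  define f where "f = (\<lambda>x. \<alpha> j x - ?c * \<alpha> i x)"
  have "f \<in> roots H" using root_reflect(2)[OF i alpha_root[OF j]] unfolding cartan_int[OF i j] f_def .
  have fd: "f x = (\<Sum>k=1..l. ?d k * \<alpha> k x)" for x
    unfolding f_def alpha_eq_sum[OF j, of x] alpha_eq_sum[OF i, of x]
    by (simp only: left_diff_distrib sum_subtractf sum_distrib_left mult.assoc)
  from \<open>f \<in> roots H\<close> show ?thesis
  proof (cases rule: root_comb_cases)
    case (1 a)
    have "?d i = of_nat (a i)"
      by (rule alpha_coeff_unique[OF _ i]) (simp only: fd[symmetric] 1 root_comb_def)
    then have "of_int (- cartan_int j i) = (of_int (int (a i)) :: complex)" using ij by simp
    then have "- cartan_int j i = int (a i)" by (simp only: of_int_eq_iff)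
    then show ?thesis by simp
  next
    case (2 a)
    have "?d j = - of_nat (a j)"
      by (rule alpha_coeff_unique[where d = "\<lambda>k. - of_nat (a k)", OF _ j])
        (simp only: fd[symmetric] 2 root_comb_def mult_minus_left sum_negf)
    then have "1 = - (of_nat (a j) :: complex)" using ij by simp
    then have "of_nat (Suc (a j)) = (0 :: complex)" by (simp only: of_nat_Suc eq_neg_iff_add_eq_0)
    then show ?thesis by (simp only: of_nat_eq_0_iff)
  qed
qed

lemma cartan_int_prod:
  assumes "i \<in> {1..l}" "j \<in> {1..l}" "i \<noteq> j"
  shows "cartan_int i j * cartan_int j i = int (dynkin_lines X l i j)"
proof -
  have "(of_int (cartan_int i j * cartan_int j i) :: complex) = of_int (int (dynkin_lines X l i j))"
    using diagram_product[OF assms] cartan_int[OF assms(2,1)] cartan_int[OF assms(1,2)] by simp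
  then show ?thesis by (simp only: of_int_eq_iff)
qed

lemma cartan_int_sym:
  assumes "i \<in> {1..l}" "j \<in> {1..l}"
  shows "sqlen i * of_int (cartan_int j i) = sqlen j * of_int (cartan_int i j)"
  using sqlen_nonzero[OF assms(1)] sqlen_nonzero[OF assms(2)] alpha_tv_sym[OF assms]
  by (simp flip: cartan_int[OF assms] cartan_int[OF assms(2,1)])

lemma cartan_int_nonadjacent:
  assumes ij: "i \<in> {1..l}" "j \<in> {1..l}" "i \<noteq> j" and n: "\<not> (2 \<le> i \<and> j = attach X l i)" "\<not> (2 \<le> j \<and> i = attach X l j)"
  shows "cartan_int i j = 0"
proof (rule ccontr)
  assume c: "cartan_int i j \<noteq> 0"
  have "dynkin_lines X l i j = 0" by (simp only: dynkin_lines_def if_not_P[OF n(1)] if_not_P[OF n(2)])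
  then have "cartan_int j i = 0" using cartan_int_prod[OF ij] c by simp
  then have "sqlen j * of_int (cartan_int i j) = 0" using cartan_int_sym[OF ij(1,2)] by simp
  then show False using c sqlen_nonzero[OF ij(2)] by simp
qed

text \<open>Along a simple edge both lengths agree. Along a multiple edge with \<open>e\<close>
  lines the parent has length 2, and the normalization decides which Cartan integer is -1; the child
  then has length 2 / e, so that \<open>mu\<close> is the number of lines.\<close>

lemma cartan_int_edge:
  assumes i: "i \<in> {2..l}"
  shows "cartan_int i (attach X l i) = - 1" "cartan_int (attach X l i) i = - int (edge_lines X l i)"
    "mu B H X l \<alpha> i = edge_lines X l i"
proof -
  define j where "j = attach X l i"
  define e where "e = edge_lines X l i"
  have ij: "i \<in> {1..l}" "j \<in> {1..l}" "i \<noteq> j" using attach_bounds[OF rank i] i by (auto simp: j_def)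
  have p: "cartan_int i j * cartan_int j i = int e"
    using cartan_int_prod[OF ij] dynkin_lines_attach[OF rank i] by (simp add: j_def e_def)
  have n: "cartan_int i j \<le> 0" "cartan_int j i \<le> 0"
    using cartan_int_nonpos ij by auto
  have nu: "nu B H \<alpha> k = (if sqlen k = 2 then 1 else if sqlen k = 1 then 2 else 3)" if "k \<in> {1..l}" for k
    unfolding nu_def dual_form_alpha[OF that that] ..
  have sym: "sqlen i * of_int (cartan_int j i) = sqlen j * of_int (cartan_int i j)"
    by (rule cartan_int_sym[OF ij(1,2)])
  have "cartan_int i j = - 1 \<and> cartan_int j i = - int e \<and> nu B H \<alpha> i div nu B H \<alpha> j = e"
  proof (cases "e = 1")
    case True
    then have c: "cartan_int i j = - 1" "cartan_int j i = - 1" using nonpos_int_factors[OF n p] by auto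
    then have "sqlen i = sqlen j" using sym by simp
    then show ?thesis using c True ij by (simp add: nu)
  next
    case False
    then have e: "e = 2 \<or> e = 3" and long: "j \<in> long_nodes X l" "i \<notin> long_nodes X l"
      using edge_lines_cases[OF rank i] by (auto simp: e_def j_def)
    have sj: "sqlen j = 2" and si: "sqlen i \<noteq> 2" using long long_iff ij by auto
    have or: "cartan_int i j = - 1 \<and> cartan_int j i = - int e \<or> cartan_int i j = - int e \<and> cartan_int j i = - 1"
      using nonpos_int_factors[OF n p] e by auto
    have c: "cartan_int i j = - 1" "cartan_int j i = - int e"
    proof -
      have "\<not> (cartan_int i j = - int e \<and> cartan_int j i = - 1)"
      proof
        \<comment> \<open>The wrong orientation would give the child the length
          \<open>2 * e\<close>, above the maximum 2.\<close>
        assume "cartan_int i j = - int e \<and> cartan_int j i = - 1"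
        then have s: "sqlen i = 2 * of_nat e" using sym sj by simp
        obtain c :: real where c: "c \<le> 2" "sqlen i = of_real c" by (rule sqlen_real[OF ij(1)])
        have "of_real c = (of_real (2 * real e) :: complex)" using s c(2) by simp
        then have "c = 2 * real e" by (simp only: of_real_eq_iff)
        then show False using c(1) e by auto
      qed
      then show "cartan_int i j = - 1" "cartan_int j i = - int e"
        using or by blast+
    qed
    have "sqlen i * of_nat e = 2" using sym unfolding c sj by simp
    then have "sqlen i = 2 / of_nat e" using e by (auto simp: field_simps)
    \<comment> \<open>The length is 1 for \<open>e = 2\<close> and 2/3 for \<open>e = 3\<close>; the
      latter falls into the default branch of \<open>nu\<close>.\<close>
    then have "nu B H \<alpha> i = e" using e si unfolding nu[OF ij(1)] by (auto simp: divide_simps)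
    moreover have "nu B H \<alpha> j = 1" unfolding nu[OF ij(2)] sj by simp
    ultimately show ?thesis using c by simp
  qed
  then show "cartan_int i (attach X l i) = - 1" "cartan_int (attach X l i) i = - int (edge_lines X l i)"
    "mu B H X l \<alpha> i = edge_lines X l i"
    unfolding mu_def j_def[symmetric] e_def[symmetric] by auto
qed

sublocale sums: laurent_sum l "attach X l" "mu B H X l \<alpha>"
proof
  fix i assume i: "i \<in> {2..l}"
  show "1 \<le> attach X l i \<and> attach X l i < i" by (rule attach_bounds[OF rank i])
  show "mu B H X l \<alpha> i \<ge> 1" unfolding cartan_int_edge(3)[OF i] using edge_lines_cases[OF rank i] by auto
qed

text \<open>In the column of \<open>i\<close> the diagonal entry is 2, a child contributes -1 and
  the parent \<open>- mu\<close>. This identifies the combinatorial \<open>sums.reflect\<close> with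
  the simple reflection of the root system.\<close>

lemma sum_cartan_int:
  assumes i: "i \<in> {1..l}"
  shows "(\<Sum>j=1..l. int (a j) * cartan_int j i) = 2 * int (a i) - int (sums.reflection_degree i a)"
proof -
  let ?p = "attach X l i" and ?m = "mu B H X l \<alpha> i" and ?C = "sums.children i"
  have C: "?C \<subseteq> {1..l}" "finite ?C" by (auto simp: sums.children_def)
  have t: "int (a j) * cartan_int j i = (if j = i then 2 * int (a i) else 0) -
      (if j \<in> ?C then int (a j) else 0) - (if j = ?p then (if 2 \<le> i then int (?m * a ?p) else 0) else 0)"
    if j: "j \<in> {1..l}" for j
  proof -
    consider "j = i" | "j \<in> ?C" "j \<noteq> i" | "2 \<le> i" "j = ?p" "j \<noteq> i" "j \<notin> ?C"
      | "j \<noteq> i" "j \<notin> ?C" "\<not> (2 \<le> i \<and> j = ?p)" by blast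
    then show ?thesis
    proof cases
      case 1
      have "j \<notin> ?C" using attach_bounds[OF rank, of j] 1 by (auto simp: sums.children_def)
      moreover have "\<not> (j = ?p \<and> 2 \<le> i)" using attach_bounds[OF rank, of i] i 1 by auto
      ultimately show ?thesis using 1 cartan_int_self[OF i] by auto
    next
      case 2
      then have j2: "j \<in> {2..l}" "attach X l j = i" by (auto simp: sums.children_def)
      then have "\<not> (j = ?p \<and> 2 \<le> i)" using attach_bounds[OF rank j2(1)] attach_bounds[OF rank, of i] i by auto
      moreover have "cartan_int j i = - 1" using cartan_int_edge(1)[OF j2(1)] j2(2) by simp
      ultimately show ?thesis using 2 by auto
    next
      case 3
      then have "i \<in> {2..l}" using i by simp
      from cartan_int_edge(2,3)[OF this] show ?thesis using 3 by simp
    next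
      case 4
      have "\<not> (2 \<le> j \<and> i = attach X l j)" using 4 j by (auto simp: sums.children_def)
      then have "cartan_int j i = 0" using cartan_int_nonadjacent[OF j i 4(1)] 4 by blast
      then show ?thesis using 4 by simp
    qed
  qed
  have "(\<Sum>j=1..l. int (a j) * cartan_int j i) = (\<Sum>j=1..l. (if j = i then 2 * int (a i) else 0) -
      (if j \<in> ?C then int (a j) else 0) - (if j = ?p then (if 2 \<le> i then int (?m * a ?p) else 0) else 0))"
    by (rule sum.cong[OF refl]) (rule t)
  also have "\<dots> = 2 * int (a i) - (\<Sum>j\<in>?C. int (a j)) - (if 2 \<le> i then int (?m * a ?p) else 0)"
  proof -
    have "(\<Sum>j=1..l. if j \<in> ?C then int (a j) else 0) = (\<Sum>j\<in>?C. int (a j))"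
      using C by (simp add: sum.inter_restrict[symmetric] Int_absorb1)
    moreover have "(\<Sum>j=1..l. if j = ?p then (if 2 \<le> i then int (?m * a ?p) else 0) else 0) = (if 2 \<le> i then int (?m * a ?p) else 0)"
      using attach_bounds[OF rank, of i] i by (auto simp: sum.delta)
    moreover have "(\<Sum>j=1..l. if j = i then 2 * int (a i) else 0) = 2 * int (a i)" using i by (simp add: sum.delta)
    ultimately show ?thesis by (simp only: sum_subtractf)
  qed
  finally show ?thesis by (simp add: sums.reflection_degree_def)
qed

section \<open>Positive roots as exponents\<close>

definition root_mset :: "('a \<Rightarrow> complex) \<Rightarrow> nat multiset" where
  "root_mset f = (\<Sum>i=1..l. replicate_mset (root_coeff l \<alpha> f i) i)"

lemma count_root_mset: "count (root_mset f) j = (if j \<in> {1..l} then root_coeff l \<alpha> f j else 0)"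
proof -
  have "count (root_mset f) j = (\<Sum>i=1..l. if i = j then root_coeff l \<alpha> f j else 0)"
    unfolding root_mset_def count_sum by (intro sum.cong refl) auto
  then show ?thesis by simp
qed

lemma root_mset_eqI:
  assumes M: "set_mset M \<subseteq> {1..l}" and f: "f = root_comb l \<alpha> (count M)"
  shows "root_mset f = M"
proof -
  have "root_coeff l \<alpha> f = count M"
    unfolding root_coeff_def
  proof (rule the_equality)
    show "(\<forall>i. i \<notin> {1..l} \<longrightarrow> count M i = 0) \<and> f = root_comb l \<alpha> (count M)"
      using M f by (auto simp: not_in_iff[symmetric])
    fix a assume a: "(\<forall>i. i \<notin> {1..l} \<longrightarrow> a i = 0) \<and> f = root_comb l \<alpha> a"
    show "a = count M"
    proof
      fix i
      show "a i = count M i"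
      proof (cases "i \<in> {1..l}")
        case True
        have "(of_nat (a i) :: complex) = of_nat (count M i)"
        proof (rule alpha_coeff_unique[OF _ True])
          fix x
          have "root_comb l \<alpha> a x = root_comb l \<alpha> (count M) x" using a f by simp
          then show "(\<Sum>i=1..l. of_nat (a i) * \<alpha> i x) = (\<Sum>i=1..l. of_nat (count M i) * \<alpha> i x)"
            by (simp only: root_comb_def)
        qed
        then show ?thesis by (simp only: of_nat_eq_iff)
      next
        case False
        then have "i \<notin># M" using M by blast
        then show ?thesis using a False by (simp add: not_in_iff)
      qed
    qed
  qed
  then show ?thesis
    using M by (intro multiset_eqI) (auto simp: count_root_mset not_in_iff[symmetric])
qed

lemma root_comb_mset:
  assumes "f = root_comb l \<alpha> a"
  obtains M where "set_mset M \<subseteq> {1..l}" "f = root_comb l \<alpha> (count M)" "\<And>i. i \<in> {1..l} \<Longrightarrow> count M i = a i"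
proof -
  define M where "M = (\<Sum>i=1..l. replicate_mset (a i) i)"
  have c: "count M j = (if j \<in> {1..l} then a j else 0)" for j
  proof -
    have "count M j = (\<Sum>i=1..l. if i = j then a j else 0)"
      unfolding M_def count_sum by (intro sum.cong refl) auto
    then show ?thesis by simp
  qed
  have "set_mset M \<subseteq> {1..l}"
  proof
    fix j assume "j \<in># M"
    then have "count M j \<noteq> 0" by simp
    then show "j \<in> {1..l}" unfolding c by (rule contrapos_np) (rule if_not_P)
  qed
  moreover have "f = root_comb l \<alpha> (count M)"
    unfolding assms root_comb_def by (intro ext sum.cong refl) (simp add: c)
  ultimately show thesis using c by (intro that[of M]) auto
qed

lemma positive_root_mset:
  assumes "f \<in> positive_roots l \<alpha> (roots H)"
  shows "set_mset (root_mset f) \<subseteq> {1..l}" "f = root_comb l \<alpha> (count (root_mset f))" "f \<in> roots H"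
proof -
  obtain a where "f = root_comb l \<alpha> a" using assms by (auto simp: positive_roots_def)
  then obtain M where M: "set_mset M \<subseteq> {1..l}" "f = root_comb l \<alpha> (count M)" by (rule root_comb_mset) blast
  have "root_mset f = M" by (rule root_mset_eqI[OF M])
  then show "set_mset (root_mset f) \<subseteq> {1..l}" "f = root_comb l \<alpha> (count (root_mset f))" using M by auto
  show "f \<in> roots H" using assms by (simp add: positive_roots_def)
qed

lemma root_mset_in:
  assumes "set_mset M \<subseteq> {1..l}" "root_comb l \<alpha> (count M) \<in> roots H"
  shows "M \<in> root_mset ` positive_roots l \<alpha> (roots H)"
proof
  show "M = root_mset (root_comb l \<alpha> (count M))" using root_mset_eqI[OF assms(1) refl] by simp
  show "root_comb l \<alpha> (count M) \<in> positive_roots l \<alpha> (roots H)" using assms(2) by (auto simp: positive_roots_def)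
qed

lemma root_comb_single: "i \<in> {1..l} \<Longrightarrow> root_comb l \<alpha> (count (replicate_mset k i)) = (\<lambda>x. of_nat k * \<alpha> i x)"
proof
  fix x assume i: "i \<in> {1..l}"
  have "root_comb l \<alpha> (count (replicate_mset k i)) x = (\<Sum>j=1..l. if j = i then of_nat k * \<alpha> i x else 0)"
    unfolding root_comb_def by (intro sum.cong refl) simp
  then show "root_comb l \<alpha> (count (replicate_mset k i)) x = of_nat k * \<alpha> i x" using i by simp
qed

lemma root_comb_tv:
  assumes i: "i \<in> {1..l}"
  shows "2 * root_comb l \<alpha> a (tv i) / sqlen i = of_int (2 * int (a i) - int (sums.reflection_degree i a))"
proof -
  have "2 * root_comb l \<alpha> a (tv i) / sqlen i = (\<Sum>j=1..l. of_nat (a j) * (2 * \<alpha> j (tv i) / sqlen i))"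
    unfolding root_comb_def sum_distrib_left sum_divide_distrib by (intro sum.cong refl) simp
  also have "\<dots> = (\<Sum>j=1..l. of_int (int (a j) * cartan_int j i))"
    by (intro sum.cong refl) (simp add: cartan_int[OF i])
  also have "\<dots> = of_int (\<Sum>j=1..l. int (a j) * cartan_int j i)" by (rule of_int_sum[symmetric])
  finally show ?thesis unfolding sum_cartan_int[OF i] .
qed

text \<open>A positive root other than \<open>\<alpha> i\<close> involves some further simple root
  \<open>\<alpha> j\<close>, because proper multiples of \<open>\<alpha> i\<close> are not roots.
  The reflection keeps the coefficient at \<open>\<alpha> j\<close>, so the image cannot be a
  negative root.\<close>

lemma reflect_root_mset:
  assumes i: "i \<in> {1..l}" and b: "b \<in> root_mset ` positive_roots l \<alpha> (roots H) - {{#i#}}"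
  shows "sums.reflectable i b \<and> sums.reflect i b \<in> root_mset ` positive_roots l \<alpha> (roots H) - {{#i#}}"
proof -
  obtain f where f: "f \<in> positive_roots l \<alpha> (roots H)" "b = root_mset f" using b by blast
  note pf = positive_root_mset[OF f(1), folded f(2)]
  have "\<exists>j\<in>{1..l}. j \<noteq> i \<and> count b j \<noteq> 0"
  proof (rule ccontr)
    assume n: "\<not> (\<exists>j\<in>{1..l}. j \<noteq> i \<and> count b j \<noteq> 0)"
    have bk: "b = replicate_mset (count b i) i"
    proof (rule multiset_eqI)
      fix j
      show "count b j = count (replicate_mset (count b i) i) j"
      proof (cases "j = i")
        case False
        have "count b j = 0" using n False pf(1) by (cases "j \<in> {1..l}") (auto simp: not_in_iff[symmetric])
        then show ?thesis using False by simp
      qed simp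
    qed
    define k where "k = count b i"
    have fk: "f = (\<lambda>x. of_nat k * \<alpha> i x)" using pf(2) bk root_comb_single[OF i, of k] by (simp add: k_def)
    have "k \<noteq> 0"
    proof
      assume "k = 0"
      then have "f = (\<lambda>_. 0)" using fk by simp
      then show False using pf(3) by (simp add: roots_def)
    qed
    moreover have "k \<noteq> 1"
    proof
      assume "k = 1"
      then have "b = {#i#}" using bk by (simp add: k_def)
      then show False using b by blast
    qed
    ultimately have "k \<ge> 2" by linarith
    then show False using root_multiple[OF alpha_root[OF i] sqlen_nonzero[OF i], of k] pf(3) unfolding fk by blast
  qed
  then obtain j where j: "j \<in> {1..l}" "j \<noteq> i" "count b j \<noteq> 0" by blast
  define c where "c = 2 * int (count b i) - int (sums.reflection_degree i (count b))"
  define g where "g = (\<lambda>x. f x - of_int c * \<alpha> i x)"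
  have g: "g \<in> roots H"
    using root_reflect(2)[OF i pf(3)] root_comb_tv[OF i, of "count b"] pf(2) by (simp add: g_def c_def)
  let ?d = "\<lambda>k. of_nat (count b k) - of_int c * (if k = i then 1 else 0) :: complex"
  have gd: "g x = (\<Sum>k=1..l. ?d k * \<alpha> k x)" for x
  proof -
    have "f x = (\<Sum>k=1..l. of_nat (count b k) * \<alpha> k x)" using fun_cong[OF pf(2), of x] by (simp only: root_comb_def)
    then show ?thesis unfolding g_def alpha_eq_sum[OF i, of x]
      by (simp only: left_diff_distrib sum_subtractf sum_distrib_left mult.assoc)
  qed
  obtain a where a: "g = root_comb l \<alpha> a"
    using g
  proof (cases rule: root_comb_cases)
    case (2 a)
    have "?d j = - of_nat (a j)"
      by (rule alpha_coeff_unique[where d = "\<lambda>k. - of_nat (a k)", OF _ j(1)])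
        (simp only: gd[symmetric] 2 root_comb_def mult_minus_left sum_negf)
    then have "of_nat (count b j + a j) = (0 :: complex)" using j(2) by simp
    then show thesis using j(3) by (simp only: of_nat_eq_0_iff)
  qed (rule that)
  obtain M where M: "set_mset M \<subseteq> {1..l}" "g = root_comb l \<alpha> (count M)" using a by (rule root_comb_mset) blast
  have cM: "of_int (int (count M k)) = (of_int (int (count b k) - c * (if k = i then 1 else 0)) :: complex)" if k: "k \<in> {1..l}" for k
  proof -
    have "?d k = of_nat (count M k)"
      by (rule alpha_coeff_unique[OF _ k]) (simp only: gd[symmetric] M root_comb_def)
    from this[symmetric] show ?thesis by (cases "k = i") simp_all
  qed
  then have cM': "int (count M k) = int (count b k) - c * (if k = i then 1 else 0)" if "k \<in> {1..l}" for k
    using that by (simp only: of_int_eq_iff)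
  have ci: "int (count M i) = int (sums.reflection_degree i (count b)) - int (count b i)"
    using cM'[OF i] by (simp add: c_def)
  have re: "sums.reflectable i b" using ci by (simp add: sums.reflectable_def sums.mset_degree_def)
  have "sums.reflect i b = M"
  proof (rule multiset_eqI)
    fix k
    show "count (sums.reflect i b) k = count M k"
    proof (cases "k \<in> {1..l}")
      case True
      then show ?thesis using cM'[OF True] ci re
        by (auto simp: sums.count_reflect sums.reflectable_def sums.mset_degree_def)
    next
      case False
      then have "count M k = 0" "count b k = 0" "k \<noteq> i" using M(1) pf(1) i by (auto simp: not_in_iff[symmetric])
      then show ?thesis by (simp add: sums.count_reflect)
    qed
  qed
  moreover have "M \<in> root_mset ` positive_roots l \<alpha> (roots H)"
    using root_mset_in[OF M(1)] g M(2) by simp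
  moreover have "count M j \<noteq> 0" using cM'[OF j(1)] j by simp
  then have "M \<noteq> {#i#}" using j(2) by auto
  ultimately show ?thesis using re by blast
qed

text \<open>The form \<open>(\<lambda>, \<mu>) \<mapsto> \<Sum>\<^sub>\<beta> \<langle>\<lambda>, \<beta>\<rangle>\<langle>\<mu>, \<beta>\<rangle>\<close>, summed over all roots, is positive definite on real
  combinations of roots and invariant under the simple reflections.\<close>

lemma exists_descent:
  assumes M: "M \<noteq> {#}" "set_mset M \<subseteq> {1..l}"
  shows "\<exists>i\<in>{1..l}. sums.mset_degree i M < 2 * count M i"
proof (rule ccontr)
  \<comment> \<open>In other words the weight \<lambda> with coefficients \<open>count M\<close>
    pairs nonpositively with all simple coroots; the aim is \<lambda> = 0.\<close>
  assume n: "\<not> (\<exists>i\<in>{1..l}. sums.mset_degree i M < 2 * count M i)"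
  define a where "a = count M"
  define len where "len i = Re (sqlen i)" for i
  have len: "sqlen i = of_real (len i)" if i: "i \<in> {1..l}" for i
    by (rule sqlen_real[OF i]) (simp add: len_def)
  have len0: "len i \<noteq> 0" if "i \<in> {1..l}" for i using sqlen_nonzero[OF that] len[OF that] by auto
  define r where "r i f = Re (f (tv i))" for i and f :: "'a \<Rightarrow> complex"
  \<comment> \<open>The value is an integer times half of a real square length, hence real.\<close>
  have r: "f (tv i) = of_real (r i f)" if i: "i \<in> {1..l}" and f: "f \<in> roots H" for i f
  proof -
    obtain c :: int where c: "2 * f (tv i) / sqlen i = of_int c" using root_reflect(1)[OF i f] by blast
    then have "f (tv i) = of_int c * sqlen i / 2" using sqlen_nonzero[OF i] by (simp add: field_simps)
    also have "\<dots> = of_real (of_int c * len i / 2)" using len[OF i] by simp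
    finally have e: "f (tv i) = of_real (of_int c * len i / 2)" .
    show ?thesis by (simp only: r_def e Re_complex_of_real)
  qed
  define s where "s i f = (\<lambda>x. f x - 2 * f (tv i) / sqlen i * \<alpha> i x)" for i and f :: "'a \<Rightarrow> complex"
  have s_root: "s i f \<in> roots H" if "i \<in> {1..l}" "f \<in> roots H" for i f
    unfolding s_def by (rule root_reflect(2)[OF that])
  have r_s: "r j (s i f) = r j f - 2 * r i f / len i * r j (\<alpha> i)"
    if i: "i \<in> {1..l}" and j: "j \<in> {1..l}" and f: "f \<in> roots H" for i j f
  proof -
    have "(of_real (r j (s i f)) :: complex) = of_real (r j f - 2 * r i f / len i * r j (\<alpha> i))"
      unfolding r[OF j s_root[OF i f], symmetric] of_real_diff of_real_mult of_real_divide
      by (simp add: s_def r[OF j f] r[OF i f] len[OF i] r[OF j alpha_root[OF i]])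
    then show ?thesis by (simp only: of_real_eq_iff)
  qed
  have r_self: "r i (\<alpha> i) = len i" for i by (simp add: r_def len_def)
  have r_sym: "r j (\<alpha> i) = r i (\<alpha> j)" if "i \<in> {1..l}" "j \<in> {1..l}" for i j
    using alpha_tv_sym[OF that] by (simp add: r_def)
  have s_invol: "s i (s i f) = f" if i: "i \<in> {1..l}" for i f
  proof -
    have "2 * s i f (tv i) / sqlen i = - (2 * f (tv i) / sqlen i)"
      using sqlen_nonzero[OF i] by (simp add: s_def field_simps)
    then show ?thesis unfolding s_def[of i "s i f"] by (simp add: s_def)
  qed
  \<comment> \<open>\<open>g f\<close> is the pairing of \<lambda> with the root \<open>f\<close>, a
    real number by \<open>r\<close>.\<close>
  define g where "g f = (\<Sum>j=1..l. real (a j) * r j f)" for f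
  have g_s: "g (s i f) = g f - 2 * r i f / len i * g (\<alpha> i)" if i: "i \<in> {1..l}" and f: "f \<in> roots H" for i f
  proof -
    have "g (s i f) = (\<Sum>j=1..l. real (a j) * r j f - 2 * r i f / len i * (real (a j) * r j (\<alpha> i)))"
      unfolding g_def by (intro sum.cong refl) (simp add: r_s[OF i _ f] algebra_simps)
    then show ?thesis by (simp only: sum_subtractf sum_distrib_left[symmetric] g_def)
  qed
  \<comment> \<open>The quotient is the pairing of \<lambda> with the coroot of
    \<open>\<alpha> i\<close>. It is kept as a quotient because the normalization bounds lengths
    only from above and leaves the sign of \<open>len i\<close> open.\<close>
  have gi: "2 * g (\<alpha> i) / len i \<le> 0" if i: "i \<in> {1..l}" for i
  proof -
    have "(of_real (2 * g (\<alpha> i) / len i) :: complex) = 2 * root_comb l \<alpha> a (tv i) / sqlen i"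
    proof -
      have "root_comb l \<alpha> a (tv i) = (\<Sum>j=1..l. of_real (real (a j) * r j (\<alpha> i)))"
        unfolding root_comb_def
        by (intro sum.cong refl) (simp add: r[OF i alpha_root] r_sym[OF i])
      also have "\<dots> = of_real (g (\<alpha> i))" unfolding g_def by (rule of_real_sum[symmetric])
      finally show ?thesis by (simp add: len[OF i])
    qed
    also have "\<dots> = of_real (of_int (2 * int (a i) - int (sums.reflection_degree i a)))"
      unfolding root_comb_tv[OF i] by simp
    finally have "2 * g (\<alpha> i) / len i = of_int (2 * int (a i) - int (sums.reflection_degree i a))"
      by (simp only: of_real_eq_iff)
    moreover have "2 * int (a i) - int (sums.reflection_degree i a) \<le> 0"
    proof -
      have "2 * a i \<le> sums.reflection_degree i a"
        using n i by (force simp: a_def sums.mset_degree_def)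
      then show ?thesis by linarith
    qed
    ultimately show ?thesis by (simp only: of_int_le_0_iff)
  qed
  \<comment> \<open>The value of the form summed over all roots at \<lambda> and
    \<open>\<alpha> i\<close>.\<close>
  define S where "S i = (\<Sum>f\<in>roots H. g f * r i f)" for i
  have "S i \<le> 0" if i: "i \<in> {1..l}" for i
  proof -
    \<comment> \<open>Re-indexing by the reflection gives an equation for \<open>S i\<close>, whose
      solution is half the coroot pairing times a sum of squares.\<close>
    have "S i = (\<Sum>f\<in>roots H. g (s i f) * r i (s i f))"
      unfolding S_def
      by (rule sum.reindex_bij_witness[where i = "s i" and j = "s i"])
        (simp_all add: s_invol[OF i] s_root[OF i])
    also have "\<dots> = (\<Sum>f\<in>roots H. 2 * g (\<alpha> i) / len i * (r i f)\<^sup>2 - g f * r i f)"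
    proof (rule sum.cong[OF refl])
      fix f assume f: "f \<in> roots H"
      have ri: "r i (s i f) = - r i f" using r_s[OF i i f] len0[OF i] by (simp add: r_self)
      have "(x - 2 * y' / d * z) * (- y') = 2 * z / d * y'\<^sup>2 - x * y'" for x y' z d :: real
        by (simp add: power2_eq_square algebra_simps)
      then show "g (s i f) * r i (s i f) = 2 * g (\<alpha> i) / len i * (r i f)\<^sup>2 - g f * r i f"
        unfolding g_s[OF i f] ri .
    qed
    also have "\<dots> = 2 * g (\<alpha> i) / len i * (\<Sum>f\<in>roots H. (r i f)\<^sup>2) - S i"
      by (simp only: sum_subtractf sum_distrib_left[symmetric] S_def)
    finally have "2 * S i = 2 * g (\<alpha> i) / len i * (\<Sum>f\<in>roots H. (r i f)\<^sup>2)" by linarith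
    also have "\<dots> \<le> 0" using gi[OF i] by (rule mult_nonpos_nonneg) (simp add: sum_nonneg)
    finally show ?thesis by simp
  qed
  then have "(\<Sum>i=1..l. real (a i) * S i) \<le> 0" by (intro sum_nonpos mult_nonneg_nonpos) auto
  \<comment> \<open>Both sides are the value of the form at \<lambda> and \<lambda>; being a sum of
    squares and nonpositive, it vanishes.\<close>
  moreover have "(\<Sum>i=1..l. real (a i) * S i) = (\<Sum>f\<in>roots H. (g f)\<^sup>2)"
  proof -
    have "(\<Sum>i=1..l. real (a i) * S i) = (\<Sum>i=1..l. \<Sum>f\<in>roots H. g f * (real (a i) * r i f))"
      unfolding S_def sum_distrib_left by (intro sum.cong refl) simp
    also have "\<dots> = (\<Sum>f\<in>roots H. g f * g f)"
      by (subst sum.swap) (simp only: sum_distrib_left[symmetric] g_def)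
    finally show ?thesis by (simp only: power2_eq_square)
  qed
  ultimately have "(\<Sum>f\<in>roots H. (g f)\<^sup>2) = 0"
    by (intro antisym) (simp_all add: sum_nonneg)
  then have g0: "g f = 0" if "f \<in> roots H" for f
    using that by (simp add: sum_nonneg_eq_0_iff[OF finite_roots])
  \<comment> \<open>The vector of \<open>H\<close> that represents \<lambda>. All roots vanish on
    it, so it is central and therefore 0; independence of the simple roots then makes all
    coefficients 0.\<close>
  define T where "T = (\<Sum>j=1..l. scale (of_nat (a j)) (tv j))"
  have tvH: "tv j \<in> H" if "j \<in> {1..l}" for j by (rule representing_vector(1)[OF alpha_root[OF that]])
  have TH: "T \<in> H"
    unfolding T_def by (intro subspace_sum[OF H_subspace] subspace_scale[OF H_subspace] tvH)
  have "T = 0"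
  proof (rule center_trivial[OF simple_algebra TH])
    fix f assume f: "f \<in> roots H"
    have "f T = B T (representing_vector B H f)"
      using representing_vector(2)[OF f TH] by (simp add: B_sym)
    also have "\<dots> = (\<Sum>j=1..l. of_nat (a j) * B (tv j) (representing_vector B H f))"
      unfolding T_def B_sum_left B_scale_left ..
    also have "\<dots> = (\<Sum>j=1..l. of_real (real (a j) * r j f))"
    proof (rule sum.cong[OF refl])
      fix j assume j: "j \<in> {1..l}"
      have "B (tv j) (representing_vector B H f) = f (tv j)"
        using representing_vector(2)[OF f tvH[OF j]] by (simp add: B_sym)
      then show "of_nat (a j) * B (tv j) (representing_vector B H f) = of_real (real (a j) * r j f)"
        using r[OF j f] by simp
    qed
    also have "\<dots> = of_real (g f)" unfolding g_def by (rule of_real_sum[symmetric])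
    finally show "f T = 0" using g0[OF f] by simp
  qed
  have "(\<Sum>j=1..l. of_nat (a j) * \<alpha> j h) = 0" for h
  proof (cases "h \<in> H")
    case True
    have "(\<Sum>j=1..l. of_nat (a j) * \<alpha> j h) = (\<Sum>j=1..l. of_nat (a j) * B (tv j) h)"
      by (intro sum.cong refl) (simp add: representing_vector(2)[OF alpha_root True])
    also have "\<dots> = B T h" unfolding T_def B_sum_left B_scale_left ..
    finally show ?thesis using \<open>T = 0\<close> by (simp add: B_zero_left)
  next
    case False
    have "\<alpha> j h = 0" if "j \<in> {1..l}" for j using roots_dual[OF alpha_root[OF that]] False by (simp add: dual_def)
    then show ?thesis by (intro sum.neutral) simp
  qed
  then have "(of_nat (a j) :: complex) = 0" if "j \<in> {1..l}" for j
    using that by (rule alpha_independent)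
  then have "count M j = 0" if "j \<in> {1..l}" for j
    using that by (simp add: a_def)
  moreover have "count M j = 0" if "j \<notin> {1..l}" for j
    using M(2) that by (auto simp: not_in_iff[symmetric])
  ultimately have "M = {#}" by (intro multiset_eqI) (metis count_empty)
  then show False using M(1) by blast
qed

theorem sum_side_has_sum:
  "(summand l (attach X l) (mu B H X l \<alpha>) has_sum
     (1 / (\<Prod>\<beta>\<in>positive_roots l \<alpha> (roots H). root_qpoch_inf l \<alpha> \<beta>))) (descending_tuples l)"
proof -
  let ?P = "positive_roots l \<alpha> (roots H)"
  let ?R = "root_mset ` ?P"
  have fin: "finite ?R" by (intro finite_imageI finite_subset[OF _ finite_roots]) (auto simp: positive_roots_def)
  have ne: "{#} \<notin> ?R"
  proof
    assume "{#} \<in> ?R"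
    then obtain f where f: "f \<in> ?P" "root_mset f = {#}" by force
    have "f = (\<lambda>_. 0)" using positive_root_mset(2)[OF f(1)] f(2) by (simp add: root_comb_def)
    then show False using positive_root_mset(3)[OF f(1)] by (simp add: roots_def)
  qed
  have supp: "set_mset b \<subseteq> {1..l}" if "b \<in> ?R" for b using positive_root_mset(1) that by blast
  have simple: "{#i#} \<in> ?R" if i: "i \<in> {1..l}" for i
    using root_mset_in[of "{#i#}"] alpha_root[OF i] root_comb_single[OF i, of 1] i by simp
  have "sums.sum_mfps * (\<Prod>b\<in>?R. monomial_fps b (inverse laurent.inverse_poch_fps)) = 1"
    by (rule sums.sum_mfps_prod[OF fin ne simple reflect_root_mset supp exists_descent])
  from sums.summand_has_sum[OF fin ne supp this]
  have *: "(summand l (attach X l) (mu B H X l \<alpha>) has_sum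
     (1 / (\<Prod>b\<in>?R. qpoch_inf (q * (\<Prod>i=1..l. y i ^ count b i))))) (descending_tuples l)" .
  have inj: "inj_on root_mset ?P"
  proof (rule inj_onI)
    fix f g assume fg: "f \<in> ?P" "g \<in> ?P" "root_mset f = root_mset g"
    have "f = root_comb l \<alpha> (count (root_mset f))" by (rule positive_root_mset(2)[OF fg(1)])
    also have "\<dots> = g" unfolding fg(3) by (rule positive_root_mset(2)[OF fg(2), symmetric])
    finally show "f = g" .
  qed
  have "(\<Prod>b\<in>?R. qpoch_inf (q * (\<Prod>i=1..l. y i ^ count b i))) = (\<Prod>\<beta>\<in>?P. root_qpoch_inf l \<alpha> \<beta>)"
    unfolding prod.reindex[OF inj]
  proof (rule prod.cong[OF refl])
    fix f
    have "(\<Prod>i=1..l. y i ^ count (root_mset f) i) = (\<Prod>i=1..l. y i ^ root_coeff l \<alpha> f i)"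
      by (rule prod.cong[OF refl]) (simp add: count_root_mset)
    then show "((\<lambda>b. qpoch_inf (q * (\<Prod>i=1..l. y i ^ count b i))) \<circ> root_mset) f = root_qpoch_inf l \<alpha> f"
      by (simp add: root_qpoch_inf_def)
  qed
  then show ?thesis using * by simp
qed

end

theorem theorem7p3:
  fixes scale :: "complex \<Rightarrow> 'a::ab_group_add \<Rightarrow> 'a"
    and bracket :: "'a \<Rightarrow> 'a \<Rightarrow> 'a"
    and H :: "'a set"
    and B :: "'a \<Rightarrow> 'a \<Rightarrow> complex"
    and X :: dynkin_family
    and l :: nat
    and \<alpha> :: "nat \<Rightarrow> 'a \<Rightarrow> complex"
    and R :: "('a \<Rightarrow> complex) set"
  assumes "lie_algebra scale bracket"
    and "lie_algebra.simple scale bracket"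
    and "lie_algebra.cartan_subalgebra scale bracket H"
    and "vector_space.dim scale H = l"
    and "R = lie_algebra.roots scale bracket H"
    and "lie_algebra.invariant_form scale bracket B"
    and "normalized_on B H R"
    and "simple_roots l \<alpha> R"
    and "has_diagram B H X l \<alpha>"
  shows "((\<lambda>r. summand l (attach X l) (mu B H X l \<alpha>) r) has_sum
           (1 / (\<Prod>\<beta>\<in>positive_roots l \<alpha> R. root_qpoch_inf l \<alpha> \<beta>)))
         (descending_tuples l)"
proof -
  interpret lie_algebra scale bracket by (rule assms(1))
  interpret simple_lie_algebra_roots scale bracket H B X l \<alpha>
    by unfold_locales (use assms in simp_all)
  show ?thesis using sum_side_has_sum unfolding assms(5) .
qed

end
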